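(* For every $N\ge4$, with $\Lambda=(\mathbb{Z}/N\mathbb{Z})^2$, all $i,j\in\Lambda$ and all $0<\beta^*\le\frac1{12}$, \[ \frac{4}{\beta^*}(G_{ii}-G_{ij})-\frac{4}{(\beta^* )^2}M_{(4\beta^* )^{-1}}\ \le\ \operatorname{Var}^*_{\Lambda,\beta^*}(U_{ij})=E^*_{\Lambda,\beta^*}[U_{ij}^2]\ \le\ \frac{4}{\beta^*}(G_{ii}-G_{ij}). \] Consequently $E^*_{\Lambda,\beta^*}[U_{ij}^2]\sim\frac{4}{\beta^*}(G_{ii}-G_{ij})$ as $\beta^*\to0$.
   Context: $\Lambda=(\mathbb{Z}/N\mathbb{Z})^2$ is the $N\times N$ box with periodic boundary conditions containing $0$. $G$ is the Green's function $G_{ij}=\lim_{\lambda\downarrow0}\sum_{t\ge0}(P_i(X_t=j)-1/|\Lambda|)e^{-\lambda t}$, with $P_i$ the law of simple random walk on $\Lambda$ started at $i$. $\Omega^*_\Lambda=\{k\in 2\pi\mathbb{Z}^\Lambda:\sum_{i}k_i=0\}$ and the lattice Coulomb gas at inverse temperature $\beta^*$ is $P^*_{\Lambda,\beta^*}=\frac{1}{Z^*_{\Lambda,\beta^*}}\sum_{k\in\Omega^*_\Lambda}e^{-\frac{\beta^*}{4}k^tGk}\delta_k$, $Z^*_{\Lambda,\beta^*}=\sum_{k\in\Omega^*_\Lambda}e^{-\frac{\beta^*}{4}k^tGk}$; $E^*$, $\operatorname{Var}^*$ are expectation and variance under it. The voltage between $i$ and $j$ is $U_{ij}(k)=\sum_{\ell\in\Lambda}(G_{i\ell}-G_{j\ell})k_\ell$.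 For $\beta\ge3$, $\varphi(\beta):=480(3e^{-\beta})^4$ and $M_\beta:=\frac{2\varphi(\beta)(1+\varphi(\beta))}{(1-\varphi(\beta))^3}$. *)

theory Defs
  imports "HOL-Analysis.Analysis" "HOL-Library.Landau_Symbols"
begin

type_synonym site = "nat \<times> nat"

text \<open>The discrete torus (Z/NZ)^2, represented by coordinates in {0..<N}.\<close>
definition Lam :: "nat \<Rightarrow> site set" where
  "Lam N = {0..<N} \<times> {0..<N}"

definition srw_step :: "nat \<Rightarrow> site \<Rightarrow> site \<Rightarrow> real" where
  "srw_step N x y = (1/4) *
     (of_bool (y = ((fst x + 1) mod N, snd x)) + of_bool (y = ((fst x + N - 1) mod N, snd x))
    + of_bool (y = (fst x, (snd x + 1) mod N)) + of_bool (y = (fst x, (snd x + N - 1) mod N)))"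

fun srw_prob :: "nat \<Rightarrow> nat \<Rightarrow> site \<Rightarrow> site \<Rightarrow> real" where
  "srw_prob N 0 x y = of_bool (x = y)"
| "srw_prob N (Suc t) x y = (\<Sum>z\<in>Lam N. srw_prob N t x z * srw_step N z y)"

definition green :: "nat \<Rightarrow> site \<Rightarrow> site \<Rightarrow> real" where
  "green N i j = Lim (at_right 0)
     (\<lambda>lam. \<Sum>t. (srw_prob N t i j - 1 / real (card (Lam N))) * exp (- lam * real t))"

definition Omega :: "nat \<Rightarrow> (site \<Rightarrow> real) set" where
  "Omega N = {k. (\<forall>x. x \<notin> Lam N \<longrightarrow> k x = 0) \<and>
                 (\<forall>x\<in>Lam N. \<exists>n::int. k x = 2 * pi * real_of_int n) \<and>
                 (\<Sum>x\<in>Lam N. k x) = 0}"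

definition energy :: "nat \<Rightarrow> (site \<Rightarrow> real) \<Rightarrow> real" where
  "energy N k = (\<Sum>i\<in>Lam N. \<Sum>l\<in>Lam N. k i * green N i l * k l)"

definition cg_weight :: "nat \<Rightarrow> real \<Rightarrow> (site \<Rightarrow> real) \<Rightarrow> real" where
  "cg_weight N b k = exp (- (b / 4) * energy N k)"

definition cg_Z :: "nat \<Rightarrow> real \<Rightarrow> real" where
  "cg_Z N b = infsum (cg_weight N b) (Omega N)"

definition cg_E :: "nat \<Rightarrow> real \<Rightarrow> ((site \<Rightarrow> real) \<Rightarrow> real) \<Rightarrow> real" where
  "cg_E N b f = infsum (\<lambda>k. f k * cg_weight N b k) (Omega N) / cg_Z N b"

definition cg_Var :: "nat \<Rightarrow> real \<Rightarrow> ((site \<Rightarrow> real) \<Rightarrow> real) \<Rightarrow> real" where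
  "cg_Var N b f = cg_E N b (\<lambda>k. (f k)^2) - (cg_E N b f)^2"

definition voltage :: "nat \<Rightarrow> site \<Rightarrow> site \<Rightarrow> (site \<Rightarrow> real) \<Rightarrow> real" where
  "voltage N i j k = (\<Sum>l\<in>Lam N. (green N i l - green N j l) * k l)"

definition phi :: "real \<Rightarrow> real" where
  "phi \<beta> = 480 * (3 * exp (- \<beta>))^4"

definition Mconst :: "real \<Rightarrow> real" where
  "Mconst \<beta> = 2 * phi \<beta> * (1 + phi \<beta>) / (1 - phi \<beta>)^3"

end

(*
  By Poisson summation, applied one coordinate at a time after completing the square, the Coulomb
  gas at inverse temperature b is dual to the integer-valued Gaussian free field m with weight
  exp(- beta * sum of squared gradients), beta = 1/(4b) >= 3. Two derivatives of the duality
  relation give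
    E*[U_ij^2] = 4/b (G_ii - G_ij) - 4/b^2 Var(m_i - m_j),
  so the theorem amounts to 0 <= Var(m_i - m_j) <= M_beta. This is a Peierls estimate: if
  m_i > m_j, some contour S inside a superlevel set separates i from j, and lowering m by one
  inside S gains a factor exp(- beta |dS|), while these factors summed over all S are at most
  phi(beta). Contours on the torus are circulations of dual arcs. A minimal separating one is
  either a single closed trail, which must pass near i or near j, or it consists of
  noncontractible closed trails, each of length at least N.
*)
theory Submission
  imports Defs "HOL-Probability.Probability" "HOL-Real_Asymp.Real_Asymp"
begin

section \<open>Poisson summation for one-dimensional Gaussians\<close>

text \<open>The field is pinned to 0 at the origin, because otherwise the gradient form has the
  constants as kernel and no inverse. Its inverse is the Green's function with Dirichlet condition
  at the origin; on neutral charges the two Green's functions give the same energy, and neutrality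
  is what fixes the charge at the origin. A phase exp(i tau (m_i - m_j)) shifts the dual charges by
  the neutral amount tau (delta_i - delta_j), so expanding the square yields both the tilt exp(b/2
  tau U_ij) and the Gaussian factor with G_ii - G_ij. The obstacle in the Peierls part is that
  cutting the torus along one closed trail need not disconnect it. A trail with zero periods has an
  integer potential, whose level sets do separate. The other trails are not tied to i or j: their
  length pays for the at most 2 N starting points, and unions of them are summed as a geometric
  series. Four continuations per step give 30 (4 q)^4 with q = exp(- beta), which lies below
  phi(beta) = 480 (3 q)^4.\<close>

inductive trig_poly :: "(real \<Rightarrow> complex) \<Rightarrow> bool" where
  mono: "trig_poly (\<lambda>x. c * cis (2 * pi * of_int s * x))"
| add: "trig_poly f \<Longrightarrow> trig_poly g \<Longrightarrow> trig_poly (\<lambda>x. f x + g x)"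

lemma trig_poly_mult_mono: "trig_poly f \<Longrightarrow> trig_poly (\<lambda>x. (c * cis (2 * pi * of_int s * x)) * f x)"
proof (induction rule: trig_poly.induct)
  case (mono c' s')
  have eq: "(\<lambda>x. (c * cis (2 * pi * of_int s * x)) * (c' * cis (2 * pi * of_int s' * x)))
     = (\<lambda>x. (c * c') * cis (2 * pi * of_int (s + s') * x))"
    by (auto simp: fun_eq_iff cis_mult algebra_simps simp flip: cis_mult)
  show ?case unfolding eq by (rule trig_poly.mono)
next
  case (add f g)
  then show ?case by (auto simp: distrib_left intro: trig_poly.add)
qed

lemma trig_poly_mult: "trig_poly f \<Longrightarrow> trig_poly g \<Longrightarrow> trig_poly (\<lambda>x. f x * g x)"
proof (induction rule: trig_poly.induct)
  case (mono c s)
  then show ?case by (rule trig_poly_mult_mono)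
next
  case (add f1 f2)
  then show ?case by (auto simp: distrib_right intro: trig_poly.add)
qed

text \<open>A real-linear functional on the complex plane, restricted to the unit circle, is a
  combination of the frequencies 1 and -1, and products of characters are characters. This turns
  Stone-Weierstrass on the circle into density of trigonometric polynomials.\<close>

lemma trig_poly_real_polynomial:
  assumes "real_polynomial_function (g :: complex \<Rightarrow> real)"
  shows "trig_poly (\<lambda>x. of_real (g (cis (2 * pi * x))))"
  using assms
proof (induction rule: real_polynomial_function.induct)
  case (linear f)
  interpret bounded_linear f by fact
  have f: "f z = Re z * f 1 + Im z * f \<i>" for z
  proof -
    have "z = Re z *\<^sub>R 1 + Im z *\<^sub>R \<i>"
      by (simp add: complex_eq_iff)
    then have "f z = f (Re z *\<^sub>R 1 + Im z *\<^sub>R \<i>)" by (rule arg_cong)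
    then show ?thesis by (simp only: add scaleR real_scaleR_def)
  qed
  have "(\<lambda>x. complex_of_real (f (cis (2 * pi * x))))
      = (\<lambda>x. ((f 1 - \<i> * f \<i>) / 2) * cis (2 * pi * of_int 1 * x) + ((f 1 + \<i> * f \<i>) / 2) * cis (2 * pi * of_int (-1) * x))"
    by (subst f) (auto simp: fun_eq_iff complex_eq_iff field_simps)
  then show ?case by (simp only:) (intro trig_poly.intros)
next
  case (const c)
  show ?case using trig_poly.mono[of "of_real c" 0] by simp
next
  case (add f g)
  then show ?case by (simp add: trig_poly.add)
next
  case (mult f g)
  then show ?case by (simp add: trig_poly_mult)
qed

lemma continuous_on_trig_poly: "trig_poly f \<Longrightarrow> continuous_on A f"
  by (induction rule: trig_poly.induct) (auto intro!: continuous_intros)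

section \<open>Uniqueness of Fourier coefficients for continuous periodic functions\<close>

lemma periodic_int:
  fixes D :: "real \<Rightarrow> 'a"
  assumes "\<And>x. D (x + 1) = D x"
  shows "D (x + of_int n) = D x"
proof -
  have nat: "D (x + real n) = D x" for n x
  proof (induction n)
    case (Suc n)
    then show ?case using assms[of "x + real n"] by (simp add: algebra_simps)
  qed simp
  show ?thesis
  proof (cases "n \<ge> 0")
    case True
    then show ?thesis using nat[of x "nat n"] by simp
  next
    case False
    then show ?thesis using nat[of "x + of_int n" "nat (-n)"] by simp
  qed
qed

text \<open>A periodic function factors through the unit circle; near \<open>-1\<close> the branch cut of
  \<^const>\<open>Arg\<close> is avoided by using the argument of \<open>- z\<close>.\<close>
lemma periodic_circle_factor:
  fixes D :: "real \<Rightarrow> real"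
  assumes cont: "continuous_on UNIV D" and per: "\<And>x. D (x + 1) = D x"
  obtains F where "continuous_on (sphere (0::complex) 1) F" "\<And>x. F (cis (2 * pi * x)) = D x"
proof -
  define F where "F = (\<lambda>z. D (Arg z / (2 * pi)))"
  have F1: "D y = D x" if "cis (2 * pi * y) = cis (2 * pi * x)" for x y
  proof -
    obtain n :: int where "2 * pi * y = 2 * pi * x + 2 * pi * of_int n"
    proof -
      have "exp (\<i> * of_real (2 * pi * y)) = exp (\<i> * of_real (2 * pi * x))"
        using \<open>cis (2 * pi * y) = cis (2 * pi * x)\<close> by (simp only: cis_conv_exp)
      then obtain n :: int where "\<i> * of_real (2 * pi * y) = \<i> * of_real (2 * pi * x) + of_real (of_int (2 * n) * pi) * \<i>"
        unfolding exp_eq by blast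
      then have "2 * pi * y = 2 * pi * x + 2 * pi * of_int n"
        by (simp add: complex_eq_iff)
      then show ?thesis using that by blast
    qed
    then have "2 * pi * y = 2 * pi * (x + of_int n)" by (simp add: algebra_simps)
    then have "y = x + of_int n" by simp
    then show ?thesis using periodic_int[of D x n, OF per] by simp
  qed
  have F2: "F z = D (y / (2 * pi))" if "z \<in> sphere 0 1" "cis y = z" for z y
  proof -
    have "z \<noteq> 0" using that by auto
    then have "cis (Arg z) = z" using that by (simp add: cis_Arg sgn_div_norm)
    then show ?thesis unfolding F_def using that by (intro F1) simp
  qed
  have c1: "continuous_on (sphere 0 1 - \<real>\<^sub>\<le>\<^sub>0) F"
    unfolding F_def
    by (rule continuous_on_compose2[OF cont]) (auto intro!: continuous_intros continuous_on_subset[OF continuous_on_Arg])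
  have c2: "continuous_on (sphere 0 1 - \<real>\<^sub>\<ge>\<^sub>0) (\<lambda>z. D ((Arg (- z) + pi) / (2 * pi)))"
  proof (rule continuous_on_compose2[OF cont])
    have "- z \<notin> \<real>\<^sub>\<le>\<^sub>0" if "z \<notin> \<real>\<^sub>\<ge>\<^sub>0" for z :: complex
      using that by (simp add: complex_nonpos_Reals_iff complex_nonneg_Reals_iff)
    then have "continuous_on (uminus ` (sphere 0 1 - \<real>\<^sub>\<ge>\<^sub>0)) Arg"
      by (intro continuous_on_subset[OF continuous_on_Arg]) blast
    then have "continuous_on (sphere 0 1 - \<real>\<^sub>\<ge>\<^sub>0) (\<lambda>z. Arg (- z))"
      by (intro continuous_on_compose2[where f = uminus and g = Arg]) (auto intro!: continuous_intros)
    then show "continuous_on (sphere 0 1 - \<real>\<^sub>\<ge>\<^sub>0) (\<lambda>z. (Arg (- z) + pi) / (2 * pi))"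
      by (intro continuous_intros) auto
  qed auto
  have c3: "continuous_on (sphere 0 1 - \<real>\<^sub>\<ge>\<^sub>0) F"
  proof (rule continuous_on_eq[OF c2])
    fix z :: complex assume z: "z \<in> sphere 0 1 - \<real>\<^sub>\<ge>\<^sub>0"
    have "- z \<noteq> 0" using z by auto
    then have "cis (Arg (- z)) = - z" using z by (subst cis_Arg) (auto simp: sgn_div_norm)
    then have "cis (Arg (- z) + pi) = z" by (simp add: cis_mult[symmetric])
    then show "D ((Arg (- z) + pi) / (2 * pi)) = F z" using F2[of z] z by simp
  qed
  have "continuous_on ((sphere 0 1 - \<real>\<^sub>\<le>\<^sub>0) \<union> (sphere 0 1 - \<real>\<^sub>\<ge>\<^sub>0)) F"
  proof (rule continuous_on_Un_local_open[OF _ _ c1 c3])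
    have eq: "(sphere 0 1 - \<real>\<^sub>\<le>\<^sub>0) \<union> (sphere 0 1 - \<real>\<^sub>\<ge>\<^sub>0) = sphere (0::complex) 1"
      by (auto simp: complex_nonpos_Reals_iff complex_nonneg_Reals_iff cmod_def)
    have n: "sphere (0::complex) 1 - A = sphere 0 1 \<inter> (- A)" for A by auto
    show "openin (top_of_set (sphere 0 1 - \<real>\<^sub>\<le>\<^sub>0 \<union> (sphere 0 1 - \<real>\<^sub>\<ge>\<^sub>0))) (sphere (0::complex) 1 - \<real>\<^sub>\<le>\<^sub>0)"
      unfolding eq unfolding n by (intro openin_open_Int) auto
    show "openin (top_of_set (sphere 0 1 - \<real>\<^sub>\<le>\<^sub>0 \<union> (sphere 0 1 - \<real>\<^sub>\<ge>\<^sub>0))) (sphere (0::complex) 1 - \<real>\<^sub>\<ge>\<^sub>0)"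
      unfolding eq unfolding n by (intro openin_open_Int) auto
  qed
  moreover have "(sphere 0 1 - \<real>\<^sub>\<le>\<^sub>0) \<union> (sphere 0 1 - \<real>\<^sub>\<ge>\<^sub>0) = sphere (0::complex) 1"
    by (auto simp: complex_nonpos_Reals_iff complex_nonneg_Reals_iff cmod_def)
  ultimately have "continuous_on (sphere 0 1) F" by simp
  moreover have "F (cis (2 * pi * x)) = D x" for x
    using F2[of "cis (2 * pi * x)" "2 * pi * x"] by simp
  ultimately show ?thesis using that by blast
qed

text \<open>\<open>D\<close> is orthogonal to every trigonometric polynomial p, so the integral of
  D^2 equals that of D (D - p), which is at most e times the integral of |D| when p is uniformly
  e-close to D. Hence the integral of D^2 vanishes. The real case comes first because the
  approximation theorem used is the real one.\<close>

lemma fourier_unique_real: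
  fixes D :: "real \<Rightarrow> real"
  assumes cont: "continuous_on UNIV D" and per: "\<And>x. D (x + 1) = D x"
    and zero: "\<And>s::int. integral {0..1} (\<lambda>x. of_real (D x) * cis (2 * pi * of_int s * x)) = 0"
  shows "D x = 0"
proof -
  have cD: "continuous_on A D" for A using cont continuous_on_subset by blast
  have T: "integral {0..1} (\<lambda>x. of_real (D x) * p x) = 0" if "trig_poly p" for p
    using that
  proof (induction rule: trig_poly.induct)
    case (mono c s)
    have "(\<lambda>x. complex_of_real (D x) * (c * cis (2 * pi * of_int s * x))) = (\<lambda>x. c * (complex_of_real (D x) * cis (2 * pi * of_int s * x)))"
      by (auto simp: fun_eq_iff)
    then show ?case using zero[of s] by (simp only: integral_mult_right) simp
  next
    case (add f g)
    have "integral {0..1} (\<lambda>x. of_real (D x) * f x + of_real (D x) * g x) = 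
      integral {0..1} (\<lambda>x. of_real (D x) * f x) + integral {0..1} (\<lambda>x. of_real (D x) * g x)"
      by (intro Henstock_Kurzweil_Integration.integral_add integrable_continuous_interval continuous_intros cD continuous_on_trig_poly add.hyps)
    then show ?case using add by (simp add: distrib_left)
  qed
  obtain F where F: "continuous_on (sphere (0::complex) 1) F" "\<And>x. F (cis (2 * pi * x)) = D x"
    using periodic_circle_factor[OF cont per] by blast
  define B where "B = integral {0..1} (\<lambda>x. \<bar>D x\<bar>)"
  have B0: "B \<ge> 0" unfolding B_def by (rule integral_nonneg) (auto intro!: integrable_continuous_interval continuous_intros cD)
  have le: "integral {0..1} (\<lambda>x. D x * D x) \<le> e * B" if e: "e > 0" for e
  proof -
    obtain g where g: "real_polynomial_function g" "\<And>x. x \<in> sphere (0::complex) 1 \<Longrightarrow> \<bar>F x - g x\<bar> < e"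
      using Stone_Weierstrass_real_polynomial_function[OF _ F(1) e] by auto
    define p where "p = (\<lambda>x. g (cis (2 * pi * x)))"
    have tp: "trig_poly (\<lambda>x. of_real (p x))" unfolding p_def by (rule trig_poly_real_polynomial[OF g(1)])
    have pc: "continuous_on A p" for A
    proof -
      have "continuous_on A (\<lambda>x. Re (of_real (p x)))" by (intro continuous_intros continuous_on_trig_poly tp)
      then show ?thesis by simp
    qed
    have z: "integral {0..1} (\<lambda>x. D x * p x) = 0"
    proof -
      have i: "(\<lambda>x. of_real (D x * p x) :: complex) integrable_on {0..1}"
        by (intro integrable_continuous_interval continuous_intros cD pc)
      have "Re (integral {0..1} (\<lambda>x. of_real (D x * p x) :: complex)) = integral {0..1} (\<lambda>x. Re (of_real (D x * p x) :: complex))"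
        using integral_linear[OF i bounded_linear_Re] by (simp add: o_def)
      then show ?thesis using T[OF tp] by simp
    qed
    have "integral {0..1} (\<lambda>x. D x * D x) = integral {0..1} (\<lambda>x. D x * D x) - integral {0..1} (\<lambda>x. D x * p x)"
      using z by simp
    also have "\<dots> = integral {0..1} (\<lambda>x. D x * D x - D x * p x)"
      by (rule Henstock_Kurzweil_Integration.integral_diff[symmetric]) (intro integrable_continuous_interval continuous_intros cD pc)+
    also have "\<dots> \<le> integral {0..1} (\<lambda>x. e * \<bar>D x\<bar>)"
    proof (rule integral_le)
      fix x :: real
      have "\<bar>D x - p x\<bar> < e" using g(2)[of "cis (2 * pi * x)"] F(2)[of x] by (simp add: p_def)
      then have "\<bar>D x\<bar> * \<bar>D x - p x\<bar> \<le> \<bar>D x\<bar> * e" by (intro mult_left_mono) auto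
      then have "\<bar>D x * (D x - p x)\<bar> \<le> \<bar>D x\<bar> * e" by (simp add: abs_mult)
      then show "D x * D x - D x * p x \<le> e * \<bar>D x\<bar>" by (simp add: algebra_simps)
    qed (intro integrable_continuous_interval continuous_intros cD pc)+
    also have "\<dots> = e * B" unfolding B_def by simp
    finally show ?thesis .
  qed
  have "integral {0..1} (\<lambda>x. D x * D x) \<le> 0"
  proof (rule field_le_epsilon)
    fix e :: real assume "e > 0"
    have "integral {0..1} (\<lambda>x. D x * D x) \<le> e / (B + 1) * B" using \<open>e > 0\<close> B0 by (intro le) auto
    also have "\<dots> \<le> e" using \<open>e > 0\<close> B0 by (simp add: field_simps)
    finally show "integral {0..1} (\<lambda>x. D x * D x) \<le> 0 + e" by simp
  qed
  moreover have "integral {0..1} (\<lambda>x. D x * D x) \<ge> 0"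
    by (rule integral_nonneg) (auto intro!: integrable_continuous_interval continuous_intros cD)
  ultimately have i0: "integral {0..1} (\<lambda>x. D x * D x) = 0" by simp
  have D0: "D y = 0" if "y \<in> {0..1}" for y
  proof -
    have "((\<lambda>x. D x * D x) has_integral 0) (cbox 0 1)"
      using i0 by (auto simp: has_integral_iff intro!: integrable_continuous_interval continuous_intros cD)
    then have "D y * D y = 0"
      by (rule has_integral_0_cbox_imp_0[rotated 2]) (use that in \<open>auto intro!: continuous_intros cD\<close>)
    then show ?thesis by simp
  qed
  have "D x = D (frac x)" using periodic_int[of D "frac x" "\<lfloor>x\<rfloor>", OF per] by (simp add: frac_def)
  also have "\<dots> = 0" by (rule D0) (auto simp: frac_ge_0 less_imp_le[OF frac_lt_1])
  finally show ?thesis .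
qed

text \<open>Conjugation maps the coefficient of \<open>D\<close> at -s to that of its conjugate at
  s, so all coefficients of the real and imaginary parts vanish too.\<close>

lemma fourier_unique:
  fixes D :: "real \<Rightarrow> complex"
  assumes cont: "continuous_on UNIV D" and per: "\<And>x. D (x + 1) = D x"
    and zero: "\<And>s::int. integral {0..1} (\<lambda>x. D x * cis (2 * pi * of_int s * x)) = 0"
  shows "D x = 0"
proof -
  have cD: "continuous_on A D" for A using cont continuous_on_subset by blast
  have int: "(\<lambda>x. D x * cis (2 * pi * of_int s * x)) integrable_on {0..1}"
            "(\<lambda>x. cnj (D x) * cis (2 * pi * of_int s * x)) integrable_on {0..1}" for s
    by (intro integrable_continuous_interval continuous_intros cD)+
  have zero': "integral {0..1} (\<lambda>x. cnj (D x) * cis (2 * pi * of_int s * x)) = 0" for s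
  proof -
    have "(\<lambda>x. cnj (D x) * cis (2 * pi * of_int s * x)) = (\<lambda>x. cnj (D x * cis (2 * pi * of_int (-s) * x)))"
      by (simp add: cis_cnj)
    then show ?thesis using zero[of "-s"] by (simp only: integral_cnj[symmetric]) simp
  qed
  have "Re (D x) = 0"
  proof (rule fourier_unique_real[where D = "\<lambda>x. Re (D x)"])
    fix s :: int
    have "(\<lambda>x. complex_of_real (Re (D x)) * cis (2 * pi * of_int s * x)) =
       (\<lambda>x. (1/2) * (D x * cis (2 * pi * of_int s * x) + cnj (D x) * cis (2 * pi * of_int s * x)))"
      by (auto simp: fun_eq_iff complex_eq_iff field_simps)
    then show "integral {0..1} (\<lambda>x. complex_of_real (Re (D x)) * cis (2 * pi * of_int s * x)) = 0"
      by (simp only: integral_mult_right Henstock_Kurzweil_Integration.integral_add[OF int] zero zero') simp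
  qed (auto intro!: continuous_intros cD simp: per)
  moreover have "Im (D x) = 0"
  proof (rule fourier_unique_real[where D = "\<lambda>x. Im (D x)"])
    fix s :: int
    have "(\<lambda>x. complex_of_real (Im (D x)) * cis (2 * pi * of_int s * x)) =
       (\<lambda>x. (-\<i>/2) * (D x * cis (2 * pi * of_int s * x) - cnj (D x) * cis (2 * pi * of_int s * x)))"
      by (auto simp: fun_eq_iff complex_eq_iff field_simps)
    then show "integral {0..1} (\<lambda>x. complex_of_real (Im (D x)) * cis (2 * pi * of_int s * x)) = 0"
      by (simp only: integral_mult_right Henstock_Kurzweil_Integration.integral_diff[OF int] zero zero') simp
  qed (auto intro!: continuous_intros cD simp: per)
  ultimately show ?thesis by (simp add: complex_eq_iff)
qed

section \<open>Gaussian series over the integers and Poisson summation in one variable\<close>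

lemma summable_on_int_power:
  fixes r :: real
  assumes "0 \<le> r" "r < 1"
  shows "(\<lambda>t::int. r ^ nat \<bar>t\<bar>) summable_on UNIV"
proof -
  have s: "(\<lambda>n. r ^ n) summable_on UNIV"
    by (rule summable_nonneg_imp_summable_on) (use assms in auto)
  have 1: "(\<lambda>t::int. r ^ nat \<bar>t\<bar>) summable_on range int"
    by (subst summable_on_reindex) (use s in \<open>auto simp: o_def\<close>)
  have 2: "(\<lambda>t::int. r ^ nat \<bar>t\<bar>) summable_on range (\<lambda>n. - int n)"
    by (subst summable_on_reindex) (use s in \<open>auto simp: o_def inj_on_def\<close>)
  have "(UNIV :: int set) = range int \<union> range (\<lambda>n. - int n)"
  proof -
    have "t \<in> range int \<union> range (\<lambda>n. - int n)" for t
      by (cases t rule: int_cases2) auto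
    then show ?thesis by blast
  qed
  then show ?thesis using summable_on_union[OF 1 2] by simp
qed

text \<open>Uses (t + x)^2 >= t^2/2 - x^2 and, t being an integer, t^2 >= |t|. The majorant is
  geometric in |t| and uniform for |x| <= R, as the Weierstrass test requires.\<close>

lemma gauss_bound:
  fixes t :: int and x :: real
  assumes "a > 0" "\<bar>x\<bar> \<le> R"
  shows "exp (- a * (of_int t + x)\<^sup>2) \<le> exp (a * R\<^sup>2) * exp (- a / 2) ^ nat \<bar>t\<bar>"
proof -
  have "x\<^sup>2 \<le> R\<^sup>2" using assms by (metis abs_ge_zero power2_abs power_mono)
  moreover have "(of_int t)\<^sup>2 / 2 - x\<^sup>2 \<le> (of_int t + x)\<^sup>2"
  proof -
    have "0 \<le> (of_int t + 2 * x)\<^sup>2" by simp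
    then show ?thesis by (simp add: power2_eq_square field_simps)
  qed
  moreover have "real (nat \<bar>t\<bar>) \<le> (of_int t)\<^sup>2"
  proof -
    have "\<bar>t\<bar> \<le> t\<^sup>2" by (metis abs_le_square_iff power2_abs abs_ge_zero abs_abs int_one_le_iff_zero_less
          mult_le_cancel_left1 not_less power2_eq_square abs_mult_self_eq le_less mult_zero_left)
    then have "real_of_int \<bar>t\<bar> \<le> real_of_int (t\<^sup>2)" by (rule of_int_le_iff[THEN iffD2])
    then show ?thesis by simp
  qed
  ultimately have "real (nat \<bar>t\<bar>) / 2 - R\<^sup>2 \<le> (of_int t + x)\<^sup>2" by linarith
  then have "a * (real (nat \<bar>t\<bar>) / 2 - R\<^sup>2) \<le> a * (of_int t + x)\<^sup>2" using assms by simp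
  then have "exp (- a * (of_int t + x)\<^sup>2) \<le> exp (a * R\<^sup>2 + real (nat \<bar>t\<bar>) * (- a / 2))"
    by (simp add: algebra_simps)
  also have "\<dots> = exp (a * R\<^sup>2) * exp (- a / 2) ^ nat \<bar>t\<bar>" by (simp only: exp_add exp_of_nat_mult)
  finally show ?thesis .
qed

lemma summable_gauss_bound:
  fixes a R :: real
  assumes "a > 0"
  shows "(\<lambda>t::int. exp (a * R\<^sup>2) * exp (- a / 2) ^ nat \<bar>t\<bar>) summable_on UNIV"
  by (intro summable_on_cmult_right summable_on_int_power) (use assms in auto)

lemma summable_gauss:
  fixes a x :: real
  assumes "a > 0"
  shows "(\<lambda>t::int. exp (- a * (of_int t + x)\<^sup>2)) summable_on UNIV"
  by (rule summable_on_comparison_test[OF summable_gauss_bound[OF assms, where R = "\<bar>x\<bar>"]])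
     (use gauss_bound[OF assms, of x "\<bar>x\<bar>"] in auto)

lemma has_sum_integral_uniform:
  fixes F :: "int \<Rightarrow> real \<Rightarrow> complex"
  assumes cont: "\<And>t. continuous_on UNIV (F t)"
    and bound: "\<And>t x. \<bar>x\<bar> \<le> 1 \<Longrightarrow> norm (F t x) \<le> M t"
    and M: "M summable_on UNIV"
  shows "((\<lambda>t. integral {0..1} (F t)) has_sum integral {0..1} (\<lambda>x. \<Sum>\<^sub>\<infinity>t. F t x)) UNIV"
proof -
  have u: "uniform_limit {0..1} (\<lambda>X y. \<Sum>x\<in>X. F x y) (\<lambda>y. \<Sum>\<^sub>\<infinity>x. F x y) (finite_subsets_at_top UNIV)"
    by (rule Weierstrass_m_test_general[OF _ M]) (auto intro!: bound)
  have c: "continuous_on {0..1} (F t)" for t by (rule continuous_on_subset[OF cont]) auto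
  obtain I J where IJ: "\<And>X. ((\<lambda>y. \<Sum>x\<in>X. F x y) has_integral I X) {0..1}"
     "((\<lambda>y. \<Sum>\<^sub>\<infinity>x. F x y) has_integral J) {0..1}" "(I \<longlongrightarrow> J) (finite_subsets_at_top UNIV)"
    by (rule uniform_limit_integral[OF u]) (auto intro!: continuous_intros c)
  have "I X = (\<Sum>t\<in>X. integral {0..1} (F t))" if "finite X" for X
  proof -
    have "((\<lambda>y. \<Sum>t\<in>X. F t y) has_integral (\<Sum>t\<in>X. integral {0..1} (F t))) {0..1}"
      by (intro has_integral_sum that integrable_integral integrable_continuous_interval c)
    then show ?thesis using IJ(1) has_integral_unique by blast
  qed
  then have "((\<lambda>X. \<Sum>t\<in>X. integral {0..1} (F t)) \<longlongrightarrow> J) (finite_subsets_at_top UNIV)"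
    using IJ(3) by (elim Lim_transform_eventually) (auto intro!: eventually_finite_subsets_at_top_weakI)
  then show ?thesis using IJ(2) by (simp add: has_sum_def integral_unique)
qed

text \<open>The majorant depends on R because translated Gaussians are dominated only locally
  uniformly in x. Continuity on each interval (-R, R) is enough, as these open sets cover the
  line.\<close>

lemma continuous_on_infsum:
  fixes F :: "int \<Rightarrow> real \<Rightarrow> complex"
  assumes cont: "\<And>t. continuous_on UNIV (F t)"
    and bound: "\<And>R t x. \<bar>x\<bar> \<le> R \<Longrightarrow> norm (F t x) \<le> M R t"
    and M: "\<And>R. M R summable_on UNIV"
  shows "continuous_on UNIV (\<lambda>x. \<Sum>\<^sub>\<infinity>t. F t x)"
proof -
  have "continuous_on {-R<..<R} (\<lambda>x. \<Sum>\<^sub>\<infinity>t. F t x)" for R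
  proof (rule uniform_limit_theorem)
    show "uniform_limit {-R<..<R} (\<lambda>X y. \<Sum>x\<in>X. F x y) (\<lambda>y. \<Sum>\<^sub>\<infinity>x. F x y) (finite_subsets_at_top UNIV)"
      by (rule Weierstrass_m_test_general[OF _ M[of R]]) (auto intro!: bound)
    show "\<forall>\<^sub>F X in finite_subsets_at_top UNIV. continuous_on {-R<..<R} (\<lambda>y. \<Sum>x\<in>X. F x y)"
      by (intro always_eventually allI continuous_on_sum continuous_on_subset[OF cont]) auto
  qed auto
  then have "continuous_on (\<Union>R\<in>UNIV. {-R<..<R}) (\<lambda>x. \<Sum>\<^sub>\<infinity>t. F t x)"
    by (intro continuous_on_open_UN) auto
  moreover have "(\<Union>R\<in>UNIV. {-R<..<R::real}) = UNIV"
  proof -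
    have "x \<in> {-(\<bar>x\<bar> + 1)<..<\<bar>x\<bar> + 1}" for x :: real by auto
    then show ?thesis by blast
  qed
  ultimately show ?thesis by simp
qed

text \<open>This is the characteristic function of the standard normal law after substituting
  \<open>\<kappa> * y\<close>, with \<open>\<kappa>\<close> chosen so that (kappa y)^2 / 2 = pi c
  y^2.\<close>

lemma gauss_fourier_integral:
  fixes c v :: real
  assumes c: "c > 0"
  shows "((\<lambda>y. of_real (exp (- (pi * c) * y\<^sup>2)) * cis (2 * pi * v * y)) has_integral
     of_real (exp (- (pi / c) * v\<^sup>2) / sqrt c)) UNIV"
proof -
  define \<kappa> where "\<kappa> = sqrt (2 * pi * c)"
  have k0: "\<kappa> > 0" and k2: "\<kappa>\<^sup>2 = 2 * pi * c" using c by (auto simp: \<kappa>_def)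
  define t where "t = 2 * pi * v / \<kappa>"
  define G where "G = (\<lambda>x. std_normal_density x *\<^sub>R iexp (t * x))"
  have int: "integrable lborel G"
    unfolding G_def
  proof (rule Bochner_Integration.integrable_bound)
    show "integrable lborel std_normal_density" by (rule integrable_std_normal_distribution_moment[of 0, simplified] integrable_normal_density; simp)
    show "AE x in lborel. norm (std_normal_density x *\<^sub>R iexp (t * x)) \<le> norm (std_normal_density x)"
      by simp
  qed measurable
  have val: "integral\<^sup>L lborel G = of_real (exp (- t\<^sup>2 / 2))"
  proof -
    have "char std_normal_distribution t = integral\<^sup>L lborel G"
      unfolding char_def G_def by (subst integral_density) (auto simp: normal_density_nonneg)
    then show ?thesis by (simp add: char_std_normal_distribution)
  qed
  have "has_bochner_integral lborel G (of_real (exp (- t\<^sup>2 / 2)))"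
    using int val by (simp add: has_bochner_integral_iff)
  then have "has_bochner_integral lborel (\<lambda>y. G (0 + \<kappa> * y)) (of_real (exp (- t\<^sup>2 / 2)) /\<^sub>R \<bar>\<kappa>\<bar>)"
    using k0 by (subst (asm) lborel_has_bochner_integral_real_affine_iff[where c = \<kappa> and t = 0]) auto
  then have "has_bochner_integral lborel (\<lambda>y. sqrt (2 * pi) *\<^sub>R G (0 + \<kappa> * y)) (sqrt (2 * pi) *\<^sub>R (of_real (exp (- t\<^sup>2 / 2)) /\<^sub>R \<bar>\<kappa>\<bar>))"
    by (rule has_bochner_integral_scaleR_right)
  then have "((\<lambda>y. sqrt (2 * pi) *\<^sub>R G (0 + \<kappa> * y)) has_integral (sqrt (2 * pi) *\<^sub>R (of_real (exp (- t\<^sup>2 / 2)) /\<^sub>R \<bar>\<kappa>\<bar>))) UNIV"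
    by (metis has_bochner_integral_iff has_integral_integral_lborel)
  moreover have "sqrt (2 * pi) *\<^sub>R G (0 + \<kappa> * y) = of_real (exp (- (pi * c) * y\<^sup>2)) * cis (2 * pi * v * y)" for y
  proof -
    have tk: "t * (\<kappa> * y) = 2 * pi * v * y" using k0 by (simp add: t_def)
    have "(\<kappa> * y)\<^sup>2 / 2 = pi * c * y\<^sup>2" by (simp add: power_mult_distrib k2)
    then have "std_normal_density (\<kappa> * y) = exp (- (pi * c) * y\<^sup>2) / sqrt (2 * pi)"
      by (simp add: std_normal_density_def)
    moreover have "iexp (t * (\<kappa> * y)) = cis (2 * pi * v * y)"
      by (simp only: tk cis_conv_exp)
    ultimately show ?thesis
      by (simp add: G_def scaleR_conv_of_real del: of_real_exp)
  qed
  moreover have "sqrt (2 * pi) *\<^sub>R (of_real (exp (- t\<^sup>2 / 2)) /\<^sub>R \<bar>\<kappa>\<bar>) = (of_real (exp (- (pi / c) * v\<^sup>2) / sqrt c) :: complex)"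
  proof -
    have "t\<^sup>2 / 2 = pi / c * v\<^sup>2"
      unfolding t_def power_divide power_mult_distrib k2 using c by (simp add: power2_eq_square field_simps)
    moreover have "sqrt (2 * pi) / \<kappa> = 1 / sqrt c" using c by (simp add: \<kappa>_def real_sqrt_mult)
    ultimately show ?thesis using k0 by (simp add: scaleR_conv_of_real field_simps flip: of_real_mult of_real_divide)
  qed
  ultimately show ?thesis by simp
qed

lemma integral_unit_shift_sum:
  fixes g :: "real \<Rightarrow> complex"
  assumes cont: "continuous_on UNIV g"
  shows "(\<Sum>t\<in>{- int n..<int n}. integral {0..1} (\<lambda>x. g (of_int t + x))) = integral {- real n..real n} g"
proof -
  have c: "continuous_on A g" for A by (rule continuous_on_subset[OF cont]) auto
  have i: "g integrable_on {a..b}" for a b by (rule integrable_continuous_interval[OF c])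
  have sh: "integral {0..1} (\<lambda>x. g (a + x)) = integral {a..a + 1} g" for a
  proof -
    have "integral {a..a + 1} g = integral {0..1} (\<lambda>x. g (x + a))"
      using integral_shift[of 0 a 1 g] c by (simp add: add.commute o_def)
    then show ?thesis by (simp add: add.commute)
  qed
  show ?thesis
  proof (induction n)
    case (Suc n)
    have "{- int (Suc n)..<int (Suc n)} = insert (- int (Suc n)) (insert (int n) {- int n..<int n})" by auto
    then have "(\<Sum>t\<in>{- int (Suc n)..<int (Suc n)}. integral {0..1} (\<lambda>x. g (of_int t + x)))
      = integral {- real (Suc n)..- real n} g + (integral {real n..real (Suc n)} g + integral {- real n..real n} g)"
    proof -
      have "of_int (- int (Suc n)) + 1 = - real n" "of_int (int n) + 1 = real (Suc n)"
        "of_int (- int (Suc n)) = - real (Suc n)" "of_int (int n) = real n" by simp_all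
      then show ?thesis
        using \<open>{- int (Suc n)..<int (Suc n)} = insert (- int (Suc n)) (insert (int n) {- int n..<int n})\<close> Suc
        by (simp only: sh) (subst sum.insert; simp add: add.commute)+
    qed
    also have "\<dots> = integral {- real (Suc n)..real (Suc n)} g"
      using Henstock_Kurzweil_Integration.integral_combine[of "- real (Suc n)" "- real n" "real n" g]
        Henstock_Kurzweil_Integration.integral_combine[of "- real (Suc n)" "real n" "real (Suc n)" g] i
      by (simp add: ac_simps) (metis add.assoc add.commute)
    finally show ?case .
  qed simp
qed

text \<open>The unordered sum is evaluated along the windows \<open>{- int n..<int n}\<close>, where
  the unit integrals combine to the integral over [-n, n]; the same sequence converges to the line
  integral.\<close>

lemma integral_line_eq_sum:
  fixes g :: "real \<Rightarrow> complex"
  assumes cont: "continuous_on UNIV g" and I: "(g has_integral I) UNIV"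
    and J: "((\<lambda>t. integral {0..1} (\<lambda>x. g (of_int t + x))) has_sum J) UNIV"
  shows "J = I"
proof (rule LIMSEQ_unique)
  have "filterlim (\<lambda>n. {- int n..<int n}) (finite_subsets_at_top UNIV) sequentially"
    unfolding filterlim_finite_subsets_at_top
  proof (intro allI impI)
    fix X :: "int set" assume "finite X \<and> X \<subseteq> UNIV"
    then have "bdd_above (abs ` X)" by auto
    then obtain b where b: "\<And>x. x \<in> X \<Longrightarrow> \<bar>x\<bar> \<le> b" by (auto simp: bdd_above_def)
    show "\<forall>\<^sub>F n in sequentially. finite {- int n..<int n} \<and> X \<subseteq> {- int n..<int n} \<and> {- int n..<int n} \<subseteq> UNIV"
      using eventually_ge_at_top[of "nat (b + 1)"]
      by eventually_elim (use b in \<open>force simp: abs_le_iff\<close>)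
  qed
  then have "(\<lambda>n. \<Sum>t\<in>{- int n..<int n}. integral {0..1} (\<lambda>x. g (of_int t + x))) \<longlonglongrightarrow> J"
    using J unfolding has_sum_def by (rule filterlim_compose[rotated])
  then show "(\<lambda>n. integral {- real n..real n} g) \<longlonglongrightarrow> J"
    by (simp only: integral_unit_shift_sum[OF cont])
  show "(\<lambda>n. integral {- real n..real n} g) \<longlonglongrightarrow> I"
  proof (rule LIMSEQ_I)
    fix r :: real assume "r > 0"
    then obtain B where B: "\<And>a b. ball 0 B \<subseteq> cbox a b \<Longrightarrow> norm (integral (cbox a b) g - I) < r"
      using I unfolding has_integral_alt' by (auto simp: ball_def) meson
    show "\<exists>no. \<forall>n\<ge>no. norm (integral {- real n..real n} g - I) < r"
    proof (intro exI allI impI)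
      fix n assume n: "n \<ge> nat \<lceil>B\<rceil>"
      have "ball 0 B \<subseteq> cbox (- real n) (real n)" using n by (auto simp: ball_def dist_real_def)
      then show "norm (integral {- real n..real n} g - I) < r" using B[of "- real n" "real n"] by simp
    qed
  qed
qed

text \<open>Both sides are continuous and 1-periodic in x. The coefficients of the left side unfold
  to Gaussian integrals over the line, those of the right side follow from orthogonality of the
  characters, and they agree.\<close>

theorem poisson_gauss_1d:
  fixes c w x :: real
  assumes c: "c > 0"
  shows "(\<Sum>\<^sub>\<infinity>t::int. of_real (exp (- (pi * c) * (of_int t + x)\<^sup>2)) * cis (2 * pi * w * (of_int t + x)))
    = (\<Sum>\<^sub>\<infinity>s::int. of_real (exp (- (pi / c) * (of_int s - w)\<^sup>2) / sqrt c) * cis (2 * pi * of_int s * x))"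
proof -
  define h where "h = (\<lambda>y. of_real (exp (- (pi * c) * y\<^sup>2)) * cis (2 * pi * w * y))"
  define f where "f = (\<lambda>x. \<Sum>\<^sub>\<infinity>t::int. h (of_int t + x))"
  define d where "d = (\<lambda>s::int. exp (- (pi / c) * (of_int s - w)\<^sup>2) / sqrt c)"
  define g where "g = (\<lambda>x. \<Sum>\<^sub>\<infinity>s::int. of_real (d s) * cis (2 * pi * of_int s * x))"
  define M where "M = (\<lambda>R (t::int). exp (pi * c * R\<^sup>2) * exp (- (pi * c) / 2) ^ nat \<bar>t\<bar>)"
  have pc: "pi * c > 0" and pc': "pi / c > 0" using c by auto
  have M: "M R summable_on UNIV" for R unfolding M_def by (rule summable_gauss_bound[OF pc])
  have hM: "norm (h (of_int t + x)) \<le> M R t" if "\<bar>x\<bar> \<le> R" for t :: int and x R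
    unfolding h_def M_def using gauss_bound[OF pc that, of t] by (simp add: norm_mult)
  have hc: "continuous_on A h" for A unfolding h_def by (intro continuous_intros)
  have dpos: "d s \<ge> 0" for s using c by (simp add: d_def)
  have ds: "d summable_on UNIV"
  proof -
    have "(\<lambda>s::int. exp (- (pi / c) * (of_int s + (- w))\<^sup>2) * inverse (sqrt c)) summable_on UNIV"
      by (intro summable_on_cmult_left summable_gauss pc')
    then show ?thesis by (simp add: d_def divide_inverse)
  qed
  have gd: "norm (of_real (d s) * cis (2 * pi * of_int s * x)) \<le> d s" for s x
    using dpos[of s] by (simp add: norm_mult)
  have per_c: "cis (2 * pi * of_int s * (x + 1)) = cis (2 * pi * of_int s * x)" for s x
    by (simp add: distrib_left cis_mult[symmetric] cis_multiple_2pi)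
  have fc: "continuous_on UNIV f"
    unfolding f_def by (rule continuous_on_infsum[where M = M])
      (auto intro!: continuous_intros continuous_on_compose2[OF hc[of UNIV]] hM M)
  have gc: "continuous_on UNIV g"
    unfolding g_def by (rule continuous_on_infsum[where M = "\<lambda>_. d"])
      (auto intro!: continuous_intros gd ds)
  have fp: "f (x + 1) = f x" for x
  proof -
    have "f x = (\<Sum>\<^sub>\<infinity>t::int. h (of_int (t + 1) + x))"
      unfolding f_def by (rule infsum_reindex_bij_witness[where i = "\<lambda>t. t + 1" and j = "\<lambda>t. t - 1"]) auto
    then show ?thesis unfolding f_def by (simp add: algebra_simps)
  qed
  have gp: "g (x + 1) = g x" for x unfolding g_def by (simp only: per_c)
  \<comment> \<open>Unfolding: \<open>cis (2 * pi * of_int s * x)\<close> is unchanged when x moves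
    by an integer, so it can be pulled into each translate. Pairing with frequency s picks out the
    coefficient at -s.\<close>
  have fi: "integral {0..1} (\<lambda>x. f x * cis (2 * pi * of_int s * x)) = of_real (d (- s))" for s
  proof -
    define k where "k = (\<lambda>y. of_real (exp (- (pi * c) * y\<^sup>2)) * cis (2 * pi * (w + of_int s) * y))"
    have kc: "continuous_on A k" for A unfolding k_def by (intro continuous_intros)
    have hk: "h (of_int t + x) * cis (2 * pi * of_int s * x) = k (of_int t + x)" for t x
    proof -
      have "cis (2 * pi * of_int s * (of_int t + x)) = cis (2 * pi * of_int (s * t)) * cis (2 * pi * of_int s * x)"
        by (simp add: cis_mult algebra_simps)
      then have "cis (2 * pi * of_int s * (of_int t + x)) = cis (2 * pi * of_int s * x)"
        by (simp only: cis_multiple_2pi[OF Ints_of_int]) simp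
      then show ?thesis unfolding h_def k_def by (simp add: distrib_left distrib_right flip: cis_mult)
    qed
    have fk: "f x * cis (2 * pi * of_int s * x) = (\<Sum>\<^sub>\<infinity>t::int. k (of_int t + x))" for x
      unfolding f_def by (simp only: infsum_cmult_left'[symmetric] hk)
    have kM: "norm (k (of_int t + x)) \<le> M 1 t" if "\<bar>x\<bar> \<le> 1" for t :: int and x
      using hM[OF that, of t] by (simp add: hk[symmetric] norm_mult)
    have "((\<lambda>t. integral {0..1} (\<lambda>x. k (of_int t + x))) has_sum integral {0..1} (\<lambda>x. \<Sum>\<^sub>\<infinity>t::int. k (of_int t + x))) UNIV"
      by (rule has_sum_integral_uniform[where M = "M 1"])
         (auto intro!: continuous_intros continuous_on_compose2[OF kc[of UNIV]] kM M)
    from integral_line_eq_sum[OF kc _ this] gauss_fourier_integral[OF c, of "w + of_int s"]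
    have "integral {0..1} (\<lambda>x. \<Sum>\<^sub>\<infinity>t::int. k (of_int t + x)) = of_real (exp (- (pi / c) * (w + of_int s)\<^sup>2) / sqrt c)"
      unfolding k_def by blast
    moreover have "(w + of_int s)\<^sup>2 = (of_int (- s) - w)\<^sup>2" by (simp add: power2_eq_square algebra_simps)
    ultimately show ?thesis unfolding fk d_def by simp
  qed
  have ci: "integral {0..1} (\<lambda>x. cis (2 * pi * of_int m * x)) = of_bool (m = 0)" for m :: int
  proof (cases "m = 0")
    case False
    have "((\<lambda>x. cis (2 * pi * of_int m * x)) has_integral
       (cis (2 * pi * of_int m * 1) / (2 * pi * of_int m * \<i>) - cis (2 * pi * of_int m * 0) / (2 * pi * of_int m * \<i>))) {0..1}"
    proof (rule fundamental_theorem_of_calculus)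
      fix x :: real
      have "((\<lambda>x. exp (\<i> * of_real (2 * pi * of_int m * x)) / (2 * pi * of_int m * \<i>)) has_vector_derivative exp (\<i> * of_real (2 * pi * of_int m * x))) (at x within {0..1})"
        using False by (auto intro!: derivative_eq_intros has_vector_derivative_real_field)
      then show "((\<lambda>x. cis (2 * pi * of_int m * x) / (2 * pi * of_int m * \<i>)) has_vector_derivative cis (2 * pi * of_int m * x)) (at x within {0..1})"
        by (simp add: cis_conv_exp)
    qed auto
    then show ?thesis using False by (simp add: cis_multiple_2pi integral_unique)
  qed simp
  have gi: "integral {0..1} (\<lambda>x. g x * cis (2 * pi * of_int s * x)) = of_real (d (- s))" for s
  proof -
    have eq: "of_real (d r) * cis (2 * pi * of_int r * x) * cis (2 * pi * of_int s * x) = of_real (d r) * cis (2 * pi * of_int (r + s) * x)" for r x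
      by (simp add: mult.assoc cis_mult algebra_simps)
    have "((\<lambda>r. integral {0..1} (\<lambda>x. of_real (d r) * cis (2 * pi * of_int (r + s) * x))) has_sum
        integral {0..1} (\<lambda>x. \<Sum>\<^sub>\<infinity>r. of_real (d r) * cis (2 * pi * of_int (r + s) * x))) UNIV"
      by (rule has_sum_integral_uniform[where M = d])
         (use dpos ds in \<open>auto intro!: continuous_intros simp: norm_mult\<close>)
    moreover have "integral {0..1} (\<lambda>x. of_real (d r) * cis (2 * pi * of_int (r + s) * x)) = (if r = - s then of_real (d (-s)) else 0)" for r
      by (simp only: integral_mult_right ci) auto
    ultimately have "((\<lambda>r. if r = - s then of_real (d (-s)) else 0) has_sum
        integral {0..1} (\<lambda>x. \<Sum>\<^sub>\<infinity>r. of_real (d r) * cis (2 * pi * of_int (r + s) * x))) UNIV" by simp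
    moreover have "((\<lambda>r. if r = - s then of_real (d (-s)) else 0) has_sum (of_real (d (-s)) :: complex)) UNIV"
      by (rule has_sum_finite_neutralI[of "{- s}"]) auto
    ultimately have "integral {0..1} (\<lambda>x. \<Sum>\<^sub>\<infinity>r. of_real (d r) * cis (2 * pi * of_int (r + s) * x)) = of_real (d (-s))"
      using has_sum_unique by blast
    then show ?thesis unfolding g_def by (simp only: infsum_cmult_left'[symmetric] eq)
  qed
  have "f x - g x = 0"
  proof (rule fourier_unique)
    fix s :: int
    have "integral {0..1} (\<lambda>x. f x * cis (2 * pi * of_int s * x) - g x * cis (2 * pi * of_int s * x)) = 0"
      by (subst Henstock_Kurzweil_Integration.integral_diff)
         (auto intro!: integrable_continuous_interval continuous_intros continuous_on_subset[OF fc] continuous_on_subset[OF gc] simp: fi gi)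
    then show "integral {0..1} (\<lambda>x. (f x - g x) * cis (2 * pi * of_int s * x)) = 0" by (simp add: left_diff_distrib)
  qed (auto intro!: continuous_intros fc gc simp: fp gp)
  then show ?thesis unfolding f_def g_def h_def d_def by simp
qed


section \<open>Poisson summation for multi-dimensional Gaussians\<close>

lemma infsum_complex_of_real: "(\<Sum>\<^sub>\<infinity>x\<in>A. complex_of_real (f x)) = of_real (infsum f A)"
proof (cases "f summable_on A")
  case True
  then show ?thesis by (intro infsumI has_sum_of_real has_sum_infsum)
next
  \<comment> \<open>A family that is not summable has \<open>infsum\<close> 0, over the reals as
    over the complex numbers.\<close>
  case False
  then have "\<not> (\<lambda>x. complex_of_real (f x)) summable_on A"
    using summable_on_Re[of "\<lambda>x. complex_of_real (f x)" A] by auto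
  with False show ?thesis by (simp add: infsum_not_exists)
qed

text \<open>Z^I, realised as functions vanishing off I, so that a coordinate is added by a function
  update and both sides of the duality are indexed by the same set.\<close>

definition int_funs :: "'a set \<Rightarrow> ('a \<Rightarrow> int) set" where
  "int_funs I = {m. \<forall>x. x \<notin> I \<longrightarrow> m x = 0}"

definition quad :: "'a set \<Rightarrow> ('a \<Rightarrow> 'a \<Rightarrow> real) \<Rightarrow> ('a \<Rightarrow> real) \<Rightarrow> real" where
  "quad I a v = (\<Sum>x\<in>I. \<Sum>y\<in>I. v x * a x y * v y)"

lemma quad_insert:
  assumes "finite I" "x \<notin> I" "\<And>y. y \<in> I \<Longrightarrow> a x y = a y x"
  shows "quad (insert x I) a v = (v x)\<^sup>2 * a x x + 2 * v x * (\<Sum>y\<in>I. a x y * v y) + quad I a v"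
proof -
  have 1: "(\<Sum>y\<in>I. v y * a y x * v x) = v x * (\<Sum>y\<in>I. a x y * v y)"
    unfolding sum_distrib_left by (rule sum.cong) (auto simp: assms)
  have 2: "(\<Sum>y\<in>I. v x * a x y * v y) = v x * (\<Sum>y\<in>I. a x y * v y)"
    unfolding sum_distrib_left by (rule sum.cong) auto
  show ?thesis
    unfolding quad_def sum.insert[OF assms(1,2)] sum.distrib 1 2
    by (simp add: power2_eq_square algebra_simps)
qed

lemma quad_add_mult:
  assumes "\<And>x y. x \<in> I \<Longrightarrow> y \<in> I \<Longrightarrow> a x y = a y x"
  shows "quad I a (\<lambda>y. v y + s * u y) = quad I a v + 2 * s * (\<Sum>x\<in>I. \<Sum>y\<in>I. u x * a x y * v y) + s\<^sup>2 * quad I a u"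
proof -
  have "(\<Sum>x\<in>I. \<Sum>y\<in>I. v x * a x y * u y) = (\<Sum>x\<in>I. \<Sum>y\<in>I. u x * a x y * v y)"
    by (subst sum.swap, intro sum.cong refl) (simp add: assms ac_simps)
  then have "s * (\<Sum>x\<in>I. \<Sum>y\<in>I. v x * a x y * u y) = s * (\<Sum>x\<in>I. \<Sum>y\<in>I. u x * a x y * v y)" by simp
  then show ?thesis
    unfolding quad_def by (simp add: algebra_simps sum.distrib sum_distrib_left power2_eq_square)
qed

lemma quad_complete_square:
  assumes "finite I" "x \<notin> I" and sym: "\<And>y z. y \<in> insert x I \<Longrightarrow> z \<in> insert x I \<Longrightarrow> a y z = a z y"
    and c: "a x x \<noteq> 0" and l: "\<And>y. l y = a y x / a x x"
  shows "quad (insert x I) a v = quad I (\<lambda>y z. a y z - a x x * l y * l z) v + a x x * (v x + (\<Sum>y\<in>I. l y * v y))\<^sup>2"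
proof -
  have "quad I (\<lambda>y z. a y z - a x x * l y * l z) v = quad I a v - a x x * (\<Sum>y\<in>I. l y * v y)\<^sup>2"
    unfolding quad_def power2_eq_square sum_product
    by (simp add: algebra_simps sum_subtractf sum_distrib_left)
  moreover have "(\<Sum>y\<in>I. a x y * v y) = a x x * (\<Sum>y\<in>I. l y * v y)"
    unfolding sum_distrib_left by (rule sum.cong) (use c in \<open>auto simp: l sym\<close>)
  moreover have "quad (insert x I) a v = (v x)\<^sup>2 * a x x + 2 * v x * (\<Sum>y\<in>I. a x y * v y) + quad I a v"
    by (rule quad_insert) (auto simp: assms)
  ultimately show ?thesis by (simp add: power2_eq_square algebra_simps)
qed

text \<open>Block inversion: if g inverts a on \<open>insert x I\<close>, then the restriction of g
  to I inverts the Schur complement of a at the pivot \<open>a x x\<close>. So an induction may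
  replace a while keeping g. The second claim completes the square on the inverse side: the charge
  at x is split off by shifting the others along \<open>l\<close>.\<close>

lemma schur_inverse:
  fixes a g :: "'a \<Rightarrow> 'a \<Rightarrow> real"
  assumes fin: "finite I" and x: "x \<notin> I"
    and syma: "\<And>y z. y \<in> insert x I \<Longrightarrow> z \<in> insert x I \<Longrightarrow> a y z = a z y"
    and symg: "\<And>y z. y \<in> insert x I \<Longrightarrow> z \<in> insert x I \<Longrightarrow> g y z = g z y"
    and inv: "\<And>y z. y \<in> insert x I \<Longrightarrow> z \<in> insert x I \<Longrightarrow> (\<Sum>r\<in>insert x I. a y r * g r z) = of_bool (y = z)"
    and c: "a x x \<noteq> 0" and l: "\<And>y. l y = a y x / a x x"
  shows "\<And>y z. y \<in> I \<Longrightarrow> z \<in> I \<Longrightarrow> (\<Sum>r\<in>I. (a y r - a x x * l y * l r) * g r z) = of_bool (y = z)" (is "PROP ?A")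
    and "quad (insert x I) g k = quad I g (\<lambda>y. k y - k x * l y) + (k x)\<^sup>2 / a x x" (is "?B")
proof -
  have row: "(\<Sum>r\<in>I. l r * g r y) = of_bool (x = y) / a x x - g x y" if "y \<in> insert x I" for y
  proof -
    have "(\<Sum>r\<in>I. a x r * g r y) = a x x * (\<Sum>r\<in>I. l r * g r y)"
      unfolding sum_distrib_left by (rule sum.cong) (use c in \<open>auto simp: l syma\<close>)
    moreover have "a x x * g x y + (\<Sum>r\<in>I. a x r * g r y) = of_bool (x = y)"
      using inv[of x y] that fin x by simp
    ultimately have "a x x * (g x y + (\<Sum>r\<in>I. l r * g r y)) = of_bool (x = y)" by (simp add: algebra_simps)
    then have "g x y + (\<Sum>r\<in>I. l r * g r y) = of_bool (x = y) / a x x" using c by (simp add: field_simps)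
    then show ?thesis by simp
  qed
  show "PROP ?A"
  proof -
    fix y z assume yz: "y \<in> I" "z \<in> I"
    have "(\<Sum>r\<in>I. a y r * g r z) = of_bool (y = z) - a y x * g x z"
      using inv[of y z] yz fin x by (simp add: algebra_simps)
    moreover have "(\<Sum>r\<in>I. a x x * l y * l r * g r z) = a x x * l y * (\<Sum>r\<in>I. l r * g r z)"
      by (simp add: sum_distrib_left mult.assoc)
    moreover have "x \<noteq> z" using x yz by auto
    moreover have "a x x * l y = a y x" using c by (simp add: l)
    ultimately show "(\<Sum>r\<in>I. (a y r - a x x * l y * l r) * g r z) = of_bool (y = z)"
      using row[of z] yz by (simp add: left_diff_distrib sum_subtractf)
  qed
  have 1: "(\<Sum>r\<in>I. \<Sum>y\<in>I. l r * g r y * k y) = - (\<Sum>y\<in>I. g x y * k y)" for k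
  proof -
    have "(\<Sum>r\<in>I. \<Sum>y\<in>I. l r * g r y * k y) = (\<Sum>y\<in>I. (\<Sum>r\<in>I. l r * g r y) * k y)"
      by (subst sum.swap) (simp add: sum_distrib_right)
    also have "\<dots> = (\<Sum>y\<in>I. - g x y * k y)"
      by (rule sum.cong) (use x in \<open>auto simp: row\<close>)
    finally show ?thesis by (simp add: sum_negf)
  qed
  have 2: "quad I g l = g x x - 1 / a x x"
  proof -
    have "quad I g l = - (\<Sum>y\<in>I. g x y * l y)" unfolding quad_def by (rule 1)
    also have "(\<Sum>y\<in>I. g x y * l y) = (\<Sum>y\<in>I. l y * g y x)"
      by (rule sum.cong) (auto simp: symg)
    finally show ?thesis using row[of x] by simp
  qed
  have "quad I g (\<lambda>y. k y + (- k x) * l y) = quad I g k + 2 * (- k x) * (\<Sum>r\<in>I. \<Sum>y\<in>I. l r * g r y * k y) + (- k x)\<^sup>2 * quad I g l"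
    by (rule quad_add_mult) (auto simp: symg)
  then have "quad I g (\<lambda>y. k y - k x * l y) = quad I g k + 2 * k x * (\<Sum>y\<in>I. g x y * k y) + (k x)\<^sup>2 * (g x x - 1 / a x x)"
    by (simp add: 1 2)
  moreover have "quad (insert x I) g k = (k x)\<^sup>2 * g x x + 2 * k x * (\<Sum>y\<in>I. g x y * k y) + quad I g k"
    by (rule quad_insert) (auto simp: fin x symg)
  ultimately show ?B by (simp add: algebra_simps)
qed

lemma bij_betw_int_funs_insert:
  assumes "x \<notin> I"
  shows "bij_betw (\<lambda>(m, t). m(x := t)) (int_funs I \<times> UNIV) (int_funs (insert x I))"
  using assms
  by (intro bij_betw_byWitness[where f' = "\<lambda>m. (m(x := 0), m x)"]) (auto simp: int_funs_def fun_eq_iff)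

text \<open>Poisson summation at w = 0 writes the periodised Gaussian as a Fourier series with
  positive coefficients, so it is largest where all phases are 1. The bound does not depend on x,
  which matters because x will be a shift that varies with the other coordinates.\<close>

lemma gauss_sum_bound:
  fixes c x :: real
  assumes c: "c > 0"
  shows "(\<Sum>\<^sub>\<infinity>t::int. exp (- (pi * c) * (of_int t + x)\<^sup>2)) \<le> (\<Sum>\<^sub>\<infinity>s::int. exp (- (pi / c) * (of_int s)\<^sup>2) / sqrt c)"
proof -
  have pc: "pi * c > 0" "pi / c > 0" using c by auto
  have s: "(\<lambda>s::int. exp (- (pi / c) * (of_int s)\<^sup>2) / sqrt c) summable_on UNIV"
    using summable_on_cmult_left[OF summable_gauss[OF pc(2), of 0], of "inverse (sqrt c)"] by (simp add: divide_inverse)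
  have s': "(\<lambda>s::int. norm (of_real (exp (- (pi / c) * (of_int s)\<^sup>2) / sqrt c) * cis (2 * pi * of_int s * x))) summable_on UNIV"
    using s c by (simp add: norm_mult norm_divide)
  have "complex_of_real (\<Sum>\<^sub>\<infinity>t::int. exp (- (pi * c) * (of_int t + x)\<^sup>2)) =
     (\<Sum>\<^sub>\<infinity>s::int. of_real (exp (- (pi / c) * (of_int s)\<^sup>2) / sqrt c) * cis (2 * pi * of_int s * x))"
    using poisson_gauss_1d[OF c, of x 0] by (simp add: infsum_complex_of_real)
  also have "norm \<dots> \<le> (\<Sum>\<^sub>\<infinity>s::int. norm (of_real (exp (- (pi / c) * (of_int s)\<^sup>2) / sqrt c) * cis (2 * pi * of_int s * x)))"
    by (rule norm_infsum_bound[OF s'])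
  finally show ?thesis using c by (simp add: norm_mult norm_divide)
qed

text \<open>Induction over the coordinates. Completing the square isolates the coordinate x as a
  Gaussian in t + L m, to which the one-dimensional formula applies; its dual variable s moves the
  remaining source z to z' s, where the induction hypothesis is used. Summability on both sides is
  part of the claim because sums have to be exchanged. The constant \<open>C\<close> is independent
  of z: a product of inverse square roots of the pivots.\<close>

theorem poisson_gauss:
  fixes a g :: "'a \<Rightarrow> 'a \<Rightarrow> real"
  assumes "finite I"
    and "\<And>y z. y \<in> I \<Longrightarrow> z \<in> I \<Longrightarrow> a y z = a z y"
    and "\<And>y z. y \<in> I \<Longrightarrow> z \<in> I \<Longrightarrow> g y z = g z y"
    and "\<And>y z. y \<in> I \<Longrightarrow> z \<in> I \<Longrightarrow> (\<Sum>r\<in>I. a y r * g r z) = of_bool (y = z)"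
    and "\<And>v. \<exists>x\<in>I. v x \<noteq> 0 \<Longrightarrow> quad I a v > 0"
  shows "(\<lambda>m. exp (- pi * quad I a (\<lambda>x. of_int (m x)))) summable_on int_funs I \<and>
    (\<exists>C>0. \<forall>z. (\<lambda>k. exp (- pi * quad I g (\<lambda>x. of_int (k x) - z x))) summable_on int_funs I \<and>
      (\<Sum>\<^sub>\<infinity>m\<in>int_funs I. of_real (exp (- pi * quad I a (\<lambda>x. of_int (m x)))) * cis (2 * pi * (\<Sum>x\<in>I. of_int (m x) * z x)))
       = of_real (C * (\<Sum>\<^sub>\<infinity>k\<in>int_funs I. exp (- pi * quad I g (\<lambda>x. of_int (k x) - z x)))))"
  using assms
proof (induction I arbitrary: a rule: finite_induct)
  case empty
  have "int_funs {} = {\<lambda>_::'a. 0}" by (auto simp: int_funs_def)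
  then show ?case by (auto simp: quad_def intro!: exI[of _ 1])
next
  case (insert x I)
  note fin = \<open>finite I\<close> and x = \<open>x \<notin> I\<close>
  define c where "c = a x x"
  define l where "l = (\<lambda>y. a y x / c)"
  define a' where "a' = (\<lambda>y z. a y z - c * l y * l z)"
  define L where "L = (\<lambda>m::'a \<Rightarrow> int. \<Sum>y\<in>I. l y * of_int (m y))"
  have c0: "c > 0"
  proof -
    have "quad (insert x I) a (\<lambda>y. of_bool (y = x)) > 0" by (rule insert.prems(4)) auto
    also have "quad (insert x I) a (\<lambda>y. of_bool (y = x)) = c"
    proof -
      have z: "of_bool (y = x) = (0::real)" if "y \<in> I" for y using that x by auto
      then have "quad I a (\<lambda>y. of_bool (y = x)) = 0" "(\<Sum>y\<in>I. a x y * of_bool (y = x)) = 0"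
        unfolding quad_def by (auto intro!: sum.neutral)
      then show ?thesis
        using quad_insert[OF fin x, of a "\<lambda>y. of_bool (y = x)"] insert.prems(1) by (simp add: c_def)
    qed
    finally show ?thesis .
  qed
  have quada: "quad (insert x I) a v = quad I a' v + c * (v x + (\<Sum>y\<in>I. l y * v y))\<^sup>2" for v
    unfolding a'_def c_def using c0
    by (intro quad_complete_square fin x insert.prems(1)) (auto simp: l_def c_def)
  have quadg: "quad (insert x I) g k = quad I g (\<lambda>y. k y - k x * l y) + (k x)\<^sup>2 / c" for k
    unfolding c_def using c0
    by (intro schur_inverse(2)[OF fin x insert.prems(1-3)]) (auto simp: l_def c_def)
  have inv': "(\<Sum>r\<in>I. a' y r * g r z) = of_bool (y = z)" if "y \<in> I" "z \<in> I" for y z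
    unfolding a'_def c_def using c0 that
    by (intro schur_inverse(1)[OF fin x insert.prems(1-3)]) (auto simp: l_def c_def)
  have pos': "quad I a' v > 0" if v: "\<exists>y\<in>I. v y \<noteq> 0" for v
  proof -
    \<comment> \<open>The coordinate at x is chosen to annihilate the completed square, so
      positivity passes to the Schur complement.\<close>
    define u where "u = v(x := - (\<Sum>y\<in>I. l y * v y))"
    have u: "u y = v y" if "y \<in> I" for y using that x by (auto simp: u_def)
    have "quad I a' u = quad I a' v" unfolding quad_def by (intro sum.cong refl) (simp add: u)
    moreover have "(\<Sum>y\<in>I. l y * u y) = (\<Sum>y\<in>I. l y * v y)" by (intro sum.cong refl) (simp add: u)
    moreover have "u x = - (\<Sum>y\<in>I. l y * v y)" by (simp add: u_def)
    moreover have "quad (insert x I) a u > 0" using v u by (intro insert.prems(4)) auto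
    ultimately show ?thesis using quada[of u] by simp
  qed
  have sym': "a' y z = a' z y" if "y \<in> I" "z \<in> I" for y z
    using that insert.prems(1) by (simp add: a'_def)
  note IH = insert.IH[OF sym' insert.prems(2) inv' pos', simplified]
  define E where "E = (\<lambda>m::'a \<Rightarrow> int. exp (- pi * quad I a' (\<lambda>x. of_int (m x))))"
  define R where "R = (\<lambda>z. \<Sum>\<^sub>\<infinity>k\<in>int_funs I. exp (- pi * quad I g (\<lambda>x. of_int (k x) - z x)))"
  have Es: "E summable_on int_funs I" using IH unfolding E_def by simp
  obtain C where C: "C > 0" and Rs: "\<And>z. (\<lambda>k. exp (- pi * quad I g (\<lambda>x. of_int (k x) - z x))) summable_on int_funs I"
    and CR: "\<And>z. (\<Sum>\<^sub>\<infinity>m\<in>int_funs I. of_real (E m) * cis (2 * pi * (\<Sum>x\<in>I. of_int (m x) * z x))) = of_real (C * R z)"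
    using IH unfolding E_def R_def by auto
  have E0: "E m \<ge> 0" for m by (simp add: E_def)
  have R0: "R z \<ge> 0" for z unfolding R_def by (rule infsum_nonneg) auto
  \<comment> \<open>The left side is a sum of positive weights times phases, so its modulus is at
    most the total weight. This bounds \<open>R\<close> uniformly and gives summability over s
    below.\<close>
  have RW: "C * R z \<le> infsum E (int_funs I)" for z
  proof -
    have "norm (\<Sum>\<^sub>\<infinity>m\<in>int_funs I. of_real (E m) * cis (2 * pi * (\<Sum>x\<in>I. of_int (m x) * z x)))
       \<le> (\<Sum>\<^sub>\<infinity>m\<in>int_funs I. norm (of_real (E m) * cis (2 * pi * (\<Sum>x\<in>I. of_int (m x) * z x))))"
      using Es E0 by (intro norm_infsum_bound) (simp add: norm_mult)
    then show ?thesis unfolding CR using E0 C R0 by (simp add: norm_mult)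
  qed
  define G where "G = (\<lambda>(m, t::int). E m * exp (- (pi * c) * (of_int t + L m)\<^sup>2))"
  have pc: "pi * c > 0" "pi / c > 0" using c0 by auto
  define B where "B = (\<Sum>\<^sub>\<infinity>s::int. exp (- (pi / c) * (of_int s)\<^sup>2) / sqrt c)"
  have Gs: "G summable_on int_funs I \<times> UNIV"
  proof (rule summable_on_SigmaI)
    show "((\<lambda>t. G (m, t)) has_sum (E m * (\<Sum>\<^sub>\<infinity>t::int. exp (- (pi * c) * (of_int t + L m)\<^sup>2)))) UNIV" for m
      unfolding G_def by (simp, intro has_sum_cmult_right has_sum_infsum) (use summable_gauss[OF pc(1)] in simp)
    show "(\<lambda>m. E m * (\<Sum>\<^sub>\<infinity>t::int. exp (- (pi * c) * (of_int t + L m)\<^sup>2))) summable_on int_funs I"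
    proof (rule summable_on_comparison_test)
      show "(\<lambda>m. E m * B) summable_on int_funs I" by (intro summable_on_cmult_left Es)
      show "E m * (\<Sum>\<^sub>\<infinity>t::int. exp (- (pi * c) * (of_int t + L m)\<^sup>2)) \<le> E m * B" for m
        unfolding B_def by (intro mult_left_mono gauss_sum_bound c0 E0)
      show "0 \<le> E m * (\<Sum>\<^sub>\<infinity>t::int. exp (- (pi * c) * (of_int t + L m)\<^sup>2))" for m
        by (intro mult_nonneg_nonneg E0 infsum_nonneg) auto
    qed
  qed (auto simp: G_def E0)
  have upd: "(\<Sum>y\<in>I. f y ((m(x := t)) y)) = (\<Sum>y\<in>I. f y (m y))" for f :: "'a \<Rightarrow> int \<Rightarrow> real" and m :: "'a \<Rightarrow> int" and t
    by (intro sum.cong refl) (use x in auto)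
  have upd2: "quad I b (\<lambda>y. f y ((m(x := t)) y)) = quad I b (\<lambda>y. f y (m y))" for b and f :: "'a \<Rightarrow> int \<Rightarrow> real" and m :: "'a \<Rightarrow> int" and t
    unfolding quad_def by (intro sum.cong refl) (use x in auto)
  have wG: "exp (- pi * quad (insert x I) a (\<lambda>y. of_int ((m(x := t)) y))) = G (m, t)" for m t
    unfolding quada upd[of "\<lambda>y i. l y * of_int i"] upd2[of a' "\<lambda>_. of_int"] G_def E_def L_def
    by (simp add: exp_add[symmetric] algebra_simps)
  have bij: "bij_betw (\<lambda>(m, t). m(x := t)) (int_funs I \<times> UNIV) (int_funs (insert x I))"
    by (rule bij_betw_int_funs_insert[OF x])
  have part1: "(\<lambda>m. exp (- pi * quad (insert x I) a (\<lambda>x. of_int (m x)))) summable_on int_funs (insert x I)"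
    unfolding summable_on_reindex_bij_betw[OF bij, symmetric]
    using Gs by (simp only: case_prod_unfold wG prod.collapse)
  have part2: "(\<lambda>k. exp (- pi * quad (insert x I) g (\<lambda>x. of_int (k x) - z x))) summable_on int_funs (insert x I) \<and>
      (\<Sum>\<^sub>\<infinity>m\<in>int_funs (insert x I). of_real (exp (- pi * quad (insert x I) a (\<lambda>x. of_int (m x)))) *
         cis (2 * pi * (\<Sum>x\<in>insert x I. of_int (m x) * z x)))
       = of_real (C / sqrt c * (\<Sum>\<^sub>\<infinity>k\<in>int_funs (insert x I). exp (- pi * quad (insert x I) g (\<lambda>x. of_int (k x) - z x))))" for z
  proof -
    define w where "w = z x"
    define d where "d = (\<lambda>s::int. exp (- (pi / c) * (of_int s - w)\<^sup>2) / sqrt c)"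
    define z' where "z' = (\<lambda>(s::int) y. z y + (of_int s - w) * l y)"
    have d0: "d s \<ge> 0" for s using c0 by (simp add: d_def)
    have ds: "d summable_on UNIV"
      using summable_on_cmult_left[OF summable_gauss[OF pc(2), of "- w"], of "inverse (sqrt c)"] by (simp add: d_def divide_inverse)
    define K where "K = (\<lambda>(k, s). d s * exp (- pi * quad I g (\<lambda>y. of_int (k y) - z' s y)))"
    have kG: "exp (- pi * quad (insert x I) g (\<lambda>y. of_int ((k(x := s)) y) - z y)) = sqrt c * K (k, s)" for k s
    proof -
      have "quad (insert x I) g (\<lambda>y. of_int ((k(x := s)) y) - z y) =
          quad I g (\<lambda>y. of_int (k y) - z' s y) + (of_int s - w)\<^sup>2 / c"
        unfolding quadg upd2[of g "\<lambda>y i. of_int i - z y - (of_int ((k(x := s)) x) - z x) * l y"]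
        by (simp add: z'_def w_def algebra_simps)
      then show ?thesis using c0 by (simp add: K_def d_def exp_add[symmetric] algebra_simps)
    qed
    have Ksum: "((\<lambda>k. K (k, s)) has_sum d s * R (z' s)) (int_funs I)" for s
      unfolding K_def R_def by (simp, intro has_sum_cmult_right has_sum_infsum) (use Rs in simp)
    have Kswap: "(\<lambda>(s, k). K (k, s)) summable_on UNIV \<times> int_funs I"
    proof (rule summable_on_SigmaI)
      show "((\<lambda>k. case (s, k) of (s, k) \<Rightarrow> K (k, s)) has_sum d s * R (z' s)) (int_funs I)" for s using Ksum by simp
      show "(\<lambda>s. d s * R (z' s)) summable_on UNIV"
      proof (rule summable_on_comparison_test)
        show "(\<lambda>s. d s * (infsum E (int_funs I) / C)) summable_on UNIV" by (intro summable_on_cmult_left ds)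
        show "d s * R (z' s) \<le> d s * (infsum E (int_funs I) / C)" for s
          using RW[of "z' s"] C d0 by (intro mult_left_mono) (auto simp: field_simps)
      qed (auto simp: d0 R0)
    qed (auto simp: K_def d0)
    then have Ks: "K summable_on int_funs I \<times> UNIV" by (subst summable_on_swap) (simp add: case_prod_unfold)
    have Kinf: "infsum K (int_funs I \<times> UNIV) = (\<Sum>\<^sub>\<infinity>s. d s * R (z' s))"
    proof -
      have "infsum K (int_funs I \<times> UNIV) = (\<Sum>\<^sub>\<infinity>k\<in>int_funs I. \<Sum>\<^sub>\<infinity>s. K (k, s))"
        using infsum_Sigma'_banach[of "\<lambda>k s. K (k, s)" "int_funs I" "\<lambda>_. UNIV"] Ks by simp
      also have "\<dots> = (\<Sum>\<^sub>\<infinity>s. \<Sum>\<^sub>\<infinity>k\<in>int_funs I. K (k, s))"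
        using infsum_swap_banach[of "\<lambda>k s. K (k, s)"] Ks by simp
      also have "\<dots> = (\<Sum>\<^sub>\<infinity>s. d s * R (z' s))" by (intro infsum_cong infsumI Ksum)
      finally show ?thesis .
    qed
    have s1: "(\<lambda>k. exp (- pi * quad (insert x I) g (\<lambda>x. of_int (k x) - z x))) summable_on int_funs (insert x I)"
      unfolding summable_on_reindex_bij_betw[OF bij, symmetric]
      using summable_on_cmult_right[OF Ks, of "sqrt c"] by (simp only: case_prod_unfold kG prod.collapse)
    have s2: "(\<Sum>\<^sub>\<infinity>k\<in>int_funs (insert x I). exp (- pi * quad (insert x I) g (\<lambda>x. of_int (k x) - z x))) = sqrt c * (\<Sum>\<^sub>\<infinity>s. d s * R (z' s))"
      unfolding infsum_reindex_bij_betw[OF bij, symmetric] Kinf[symmetric]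
      by (simp only: case_prod_unfold kG prod.collapse infsum_cmult_right')
    define e where "e = (\<lambda>m::'a \<Rightarrow> int. cis (2 * pi * (\<Sum>y\<in>I. of_int (m y) * z y)))"
    have phase: "e m * cis (- (2 * pi * w * L m)) * cis (2 * pi * of_int s * L m) = cis (2 * pi * (\<Sum>y\<in>I. of_int (m y) * z' s y))" for m s
    proof -
      have "(\<Sum>y\<in>I. of_int (m y) * z' s y) = (\<Sum>y\<in>I. of_int (m y) * z y) + (of_int s - w) * L m"
        unfolding L_def sum_distrib_left sum.distrib[symmetric] z'_def by (intro sum.cong) (auto simp: algebra_simps)
      then have "2 * pi * (\<Sum>y\<in>I. of_int (m y) * z y) + - (2 * pi * w * L m) + 2 * pi * of_int s * L m = 2 * pi * (\<Sum>y\<in>I. of_int (m y) * z' s y)"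
        by (simp only:) (simp add: algebra_simps)
      then show ?thesis by (simp only: e_def cis_mult)
    qed
    have inner: "(\<Sum>\<^sub>\<infinity>t::int. of_real (G (m, t)) * (e m * cis (2 * pi * of_int t * w)))
       = (\<Sum>\<^sub>\<infinity>s. of_real (E m * d s) * cis (2 * pi * (\<Sum>y\<in>I. of_int (m y) * z' s y)))" for m
    proof -
      have "cis (2 * pi * of_int t * w) = cis (2 * pi * w * (of_int t + L m)) * cis (- (2 * pi * w * L m))" for t
        by (simp add: cis_mult algebra_simps)
      then have "(\<Sum>\<^sub>\<infinity>t::int. of_real (G (m, t)) * (e m * cis (2 * pi * of_int t * w)))
         = (\<Sum>\<^sub>\<infinity>t::int. (of_real (E m) * e m * cis (- (2 * pi * w * L m))) *
             (of_real (exp (- (pi * c) * (of_int t + L m)\<^sup>2)) * cis (2 * pi * w * (of_int t + L m))))"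
        by (intro infsum_cong) (simp add: G_def mult_ac)
      also have "\<dots> = (of_real (E m) * e m * cis (- (2 * pi * w * L m))) * (\<Sum>\<^sub>\<infinity>s. of_real (d s) * cis (2 * pi * of_int s * L m))"
        unfolding infsum_cmult_right' d_def by (subst poisson_gauss_1d[OF c0]) simp
      also have "\<dots> = (\<Sum>\<^sub>\<infinity>s. of_real (E m * d s) * cis (2 * pi * (\<Sum>y\<in>I. of_int (m y) * z' s y)))"
        unfolding infsum_cmult_right'[symmetric] phase[symmetric] by (intro infsum_cong) (simp add: mult_ac)
      finally show ?thesis .
    qed
    have EDs: "(\<lambda>(m, s). E m * d s) summable_on int_funs I \<times> UNIV"
    proof (rule summable_on_SigmaI)
      show "((\<lambda>s. case (m, s) of (m, s) \<Rightarrow> E m * d s) has_sum E m * infsum d UNIV) UNIV" for m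
        by (simp, intro has_sum_cmult_right has_sum_infsum ds)
      show "(\<lambda>m. E m * infsum d UNIV) summable_on int_funs I" by (intro summable_on_cmult_left Es)
    qed (auto simp: E0 d0)
    have summand: "of_real (exp (- pi * quad (insert x I) a (\<lambda>y. of_int ((m(x := t)) y)))) *
         cis (2 * pi * (\<Sum>y\<in>insert x I. of_int ((m(x := t)) y) * z y)) = of_real (G (m, t)) * (e m * cis (2 * pi * of_int t * w))" for m t
    proof -
      have "(\<Sum>y\<in>insert x I. of_int ((m(x := t)) y) * z y) = of_int t * w + (\<Sum>y\<in>I. of_int (m y) * z y)"
        using fin x upd[of "\<lambda>y i. of_int i * z y" m t] by (simp add: w_def)
      then show ?thesis unfolding wG e_def by (simp add: cis_mult algebra_simps)
    qed
    have "(\<Sum>\<^sub>\<infinity>m\<in>int_funs (insert x I). of_real (exp (- pi * quad (insert x I) a (\<lambda>x. of_int (m x)))) *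
         cis (2 * pi * (\<Sum>x\<in>insert x I. of_int (m x) * z x)))
       = (\<Sum>\<^sub>\<infinity>(m, t)\<in>int_funs I \<times> UNIV. of_real (G (m, t)) * (e m * cis (2 * pi * of_int t * w)))"
      unfolding infsum_reindex_bij_betw[OF bij, symmetric] by (simp only: case_prod_unfold summand)
    also have "\<dots> = (\<Sum>\<^sub>\<infinity>m\<in>int_funs I. \<Sum>\<^sub>\<infinity>t. of_real (G (m, t)) * (e m * cis (2 * pi * of_int t * w)))"
    proof (rule infsum_Sigma'_banach[symmetric])
      have "(\<lambda>p. norm (case p of (m, t) \<Rightarrow> complex_of_real (G (m, t)) * (e m * cis (2 * pi * of_int t * w)))) summable_on int_funs I \<times> UNIV"
        by (rule summable_on_cong[THEN iffD1, OF _ Gs]) (auto simp: norm_mult e_def G_def E0)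
      then show "(\<lambda>(m, t). complex_of_real (G (m, t)) * (e m * cis (2 * pi * of_int t * w))) summable_on int_funs I \<times> UNIV"
        by (rule abs_summable_summable)
    qed
    also have "\<dots> = (\<Sum>\<^sub>\<infinity>m\<in>int_funs I. \<Sum>\<^sub>\<infinity>s. of_real (E m * d s) * cis (2 * pi * (\<Sum>y\<in>I. of_int (m y) * z' s y)))"
      by (simp only: inner)
    also have "\<dots> = (\<Sum>\<^sub>\<infinity>s. \<Sum>\<^sub>\<infinity>m\<in>int_funs I. of_real (E m * d s) * cis (2 * pi * (\<Sum>y\<in>I. of_int (m y) * z' s y)))"
    proof (rule infsum_swap_banach)
      have "(\<lambda>p. norm (case p of (m, s) \<Rightarrow> complex_of_real (E m * d s) * cis (2 * pi * (\<Sum>y\<in>I. of_int (m y) * z' s y)))) summable_on int_funs I \<times> UNIV"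
        by (rule summable_on_cong[THEN iffD1, OF _ EDs]) (auto simp: norm_mult E0 d0)
      then show "(\<lambda>(m, s). complex_of_real (E m * d s) * cis (2 * pi * (\<Sum>y\<in>I. of_int (m y) * z' s y))) summable_on int_funs I \<times> UNIV"
        by (rule abs_summable_summable)
    qed
    also have "\<dots> = (\<Sum>\<^sub>\<infinity>s. of_real (d s) * of_real (C * R (z' s)))"
      unfolding CR[symmetric] infsum_cmult_right'[symmetric] by (intro infsum_cong) (simp add: mult_ac)
    also have "\<dots> = of_real (C * (\<Sum>\<^sub>\<infinity>s. d s * R (z' s)))"
      unfolding infsum_cmult_right'[symmetric] infsum_complex_of_real[symmetric] by (intro infsum_cong) (simp add: mult_ac)
    finally show ?thesis using s1 s2 c0 by simp
  qed
  show ?case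
    using part1 part2 C c0 by (intro conjI exI[of _ "C / sqrt c"]) auto
qed


section \<open>The Green's function of the torus\<close>

definition rt :: "nat \<Rightarrow> site \<Rightarrow> site" where "rt N s = ((fst s + 1) mod N, snd s)"
definition lf :: "nat \<Rightarrow> site \<Rightarrow> site" where "lf N s = ((fst s + N - 1) mod N, snd s)"
definition up :: "nat \<Rightarrow> site \<Rightarrow> site" where "up N s = (fst s, (snd s + 1) mod N)"
definition dn :: "nat \<Rightarrow> site \<Rightarrow> site" where "dn N s = (fst s, (snd s + N - 1) mod N)"

lemma finite_Lam [simp]: "finite (Lam N)" by (simp add: Lam_def)

lemma card_Lam: "card (Lam N) = N * N" by (simp add: Lam_def)

lemma mod_pred_succ:
  fixes x N :: nat
  assumes "x < N"
  shows "((x + N - 1) mod N + 1) mod N = x" "((x + 1) mod N + N - 1) mod N = x"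
proof -
  have "((x + N - 1) mod N + 1) mod N = (x + N - 1 + 1) mod N" by (rule mod_add_left_eq)
  also have "\<dots> = x" using assms by simp
  finally show "((x + N - 1) mod N + 1) mod N = x" .
  show "((x + 1) mod N + N - 1) mod N = x"
  proof (cases "x + 1 = N")
    case True then show ?thesis by auto
  next
    case False then show ?thesis using assms by simp
  qed
qed

lemma nbr_in_Lam [simp]:
  assumes "s \<in> Lam N"
  shows "rt N s \<in> Lam N" "lf N s \<in> Lam N" "up N s \<in> Lam N" "dn N s \<in> Lam N"
  using assms by (auto simp: Lam_def rt_def lf_def up_def dn_def)

lemma nbr_inverse [simp]:
  assumes "s \<in> Lam N"
  shows "rt N (lf N s) = s" "lf N (rt N s) = s" "up N (dn N s) = s" "dn N (up N s) = s"
  using assms mod_pred_succ[of "fst s" N] mod_pred_succ[of "snd s" N]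
  by (auto simp: Lam_def rt_def lf_def up_def dn_def prod_eq_iff)

lemma rt_up_commute: "rt N (up N s) = up N (rt N s)"
  by (simp add: rt_def up_def)

lemma bij_nbr:
  "bij_betw (rt N) (Lam N) (Lam N)" "bij_betw (up N) (Lam N) (Lam N)"
  by (rule bij_betw_byWitness[where f' = "lf N"]; auto)
     (rule bij_betw_byWitness[where f' = "dn N"]; auto)

lemma sum_nbr:
  "(\<Sum>s\<in>Lam N. f (rt N s)) = sum f (Lam N)" "(\<Sum>s\<in>Lam N. f (up N s)) = sum f (Lam N)"
  using sum.reindex_bij_betw[OF bij_nbr(1)[of N], of f] sum.reindex_bij_betw[OF bij_nbr(2)[of N], of f] by auto

lemma srw_step_sum:
  assumes y: "y \<in> Lam N"
  shows "(\<Sum>z\<in>Lam N. f z * srw_step N z y) = (f (lf N y) + f (rt N y) + f (dn N y) + f (up N y)) / 4"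
proof -
  have st: "srw_step N z y = (of_bool (z = lf N y) + of_bool (z = rt N y) + of_bool (z = dn N y) + of_bool (z = up N y)) / 4"
    if z: "z \<in> Lam N" for z
  proof -
    have "srw_step N z y = (of_bool (y = rt N z) + of_bool (y = lf N z) + of_bool (y = up N z) + of_bool (y = dn N z)) / 4"
      unfolding srw_step_def rt_def lf_def up_def dn_def by simp
    moreover have "(y = rt N z) = (z = lf N y)" "(y = lf N z) = (z = rt N y)" "(y = up N z) = (z = dn N y)" "(y = dn N z) = (z = up N y)"
      using y z nbr_inverse by metis+
    ultimately show ?thesis by simp
  qed
  have "(\<Sum>z\<in>Lam N. f z * srw_step N z y) = (\<Sum>z\<in>Lam N. (of_bool (z = lf N y) * f z + of_bool (z = rt N y) * f z
      + of_bool (z = dn N y) * f z + of_bool (z = up N y) * f z) / 4)"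
    by (rule sum.cong) (auto simp: st algebra_simps add_divide_distrib)
  also have "\<dots> = (f (lf N y) + f (rt N y) + f (dn N y) + f (up N y)) / 4"
    using y by (simp add: sum_divide_distrib[symmetric] sum.distrib of_bool_def if_distrib[where f = "\<lambda>c. c * _"] sum.delta cong: if_cong)
  finally show ?thesis .
qed

section \<open>Fourier diagonalisation of the random walk and of the Green's function\<close>

definition ang :: "nat \<Rightarrow> site \<Rightarrow> site \<Rightarrow> real" where
  "ang N p s = 2 * pi * (real (fst p) * real (fst s) + real (snd p) * real (snd s)) / real N"

text \<open>The eigenvalue of the transition matrix on the character of frequency p. It is real and
  even in p, so cosines suffice throughout.\<close>

definition eigv :: "nat \<Rightarrow> site \<Rightarrow> real" where
  "eigv N p = (cos (2 * pi * real (fst p) / real N) + cos (2 * pi * real (snd p) / real N)) / 2"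

lemma cos_diff_commute: "cos (x - y) = cos (y - x)" for x y :: real
  by (metis cos_minus minus_diff_eq)

lemma cos_sub_2pi_nat: "cos (a - 2 * pi * real n) = cos a"
  using cos_int_2pin[of "int n"] sin_int_2pin[of "int n"] by (simp add: cos_diff)

lemma cos_shift_mod:
  assumes k: "k < N"
  shows "cos (a - 2 * pi * (real p * real ((k + 1) mod N) + c) / real N)
    = cos (a - 2 * pi * (real p * real k + c) / real N - 2 * pi * real p / real N)"
proof (cases "k + 1 = N")
  case True
  then have N: "real N = real k + 1" "real N \<noteq> 0" by auto
  have "a - 2 * pi * (real p * real k + c) / real N - 2 * pi * real p / real N
      = a - 2 * pi * c / real N - 2 * pi * real p * (real k + 1) / real N"
    by (simp add: distrib_left add_divide_distrib mult.assoc)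
  also have "\<dots> = (a - 2 * pi * c / real N) - 2 * pi * real p"
    unfolding N(1)[symmetric] using N(2) by simp
  finally have "cos (a - 2 * pi * (real p * real k + c) / real N - 2 * pi * real p / real N) = cos (a - 2 * pi * c / real N)"
    by (simp only: cos_sub_2pi_nat)
  moreover have "(k + 1) mod N = 0" using True by simp
  ultimately show ?thesis by simp
next
  case False
  then have "(k + 1) mod N = k + 1" using k by simp
  then show ?thesis by (simp add: distrib_left add_divide_distrib diff_diff_eq ac_simps)
qed

lemma cos_ang_nbr:
  assumes s: "s \<in> Lam N"
  shows "cos (a - ang N p (rt N s)) = cos (a - ang N p s - 2 * pi * real (fst p) / real N)"
    "cos (a - ang N p (up N s)) = cos (a - ang N p s - 2 * pi * real (snd p) / real N)"
    "cos (a - ang N p (lf N s)) = cos (a - ang N p s + 2 * pi * real (fst p) / real N)"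
    "cos (a - ang N p (dn N s)) = cos (a - ang N p s + 2 * pi * real (snd p) / real N)"
proof -
  have r: "cos (a - ang N p (rt N s)) = cos (a - ang N p s - 2 * pi * real (fst p) / real N)" if "s \<in> Lam N" for s a
    using cos_shift_mod[of "fst s" N a "fst p" "real (snd p) * real (snd s)"] that by (auto simp: ang_def rt_def Lam_def)
  have u: "cos (a - ang N p (up N s)) = cos (a - ang N p s - 2 * pi * real (snd p) / real N)" if "s \<in> Lam N" for s a
    using cos_shift_mod[of "snd s" N a "snd p" "real (fst p) * real (fst s)"] that by (auto simp: ang_def up_def Lam_def add.commute)
  show "cos (a - ang N p (rt N s)) = cos (a - ang N p s - 2 * pi * real (fst p) / real N)"
    "cos (a - ang N p (up N s)) = cos (a - ang N p s - 2 * pi * real (snd p) / real N)"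
    using r u s by auto
  \<comment> \<open>A left step inverts a right step: the identity for \<open>rt\<close> is used at
    \<open>lf N s\<close>, with the phase absorbed into a.\<close>
  show "cos (a - ang N p (lf N s)) = cos (a - ang N p s + 2 * pi * real (fst p) / real N)"
    using r[of "lf N s" "a + 2 * pi * real (fst p) / real N"] s by (simp add: algebra_simps)
  show "cos (a - ang N p (dn N s)) = cos (a - ang N p s + 2 * pi * real (snd p) / real N)"
    using u[of "dn N s" "a + 2 * pi * real (snd p) / real N"] s by (simp add: algebra_simps)
qed

lemma cos_ang_nbr_sum:
  assumes s: "s \<in> Lam N"
  shows "cos (a - ang N p (lf N s)) + cos (a - ang N p (rt N s)) + cos (a - ang N p (dn N s)) + cos (a - ang N p (up N s))
     = 4 * eigv N p * cos (a - ang N p s)"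
proof -
  define A where "A = a - ang N p s"
  have key: "cos (A + t) + cos (A - t) = 2 * cos A * cos t" for t
    by (simp add: cos_add cos_diff)
  show ?thesis
    unfolding cos_ang_nbr[OF s] eigv_def
    using key[of "2 * pi * real (fst p) / real N"] key[of "2 * pi * real (snd p) / real N"]
    unfolding A_def[symmetric] by (simp add: algebra_simps)
qed

lemma sum_cis_roots:
  fixes d :: int
  assumes N: "N > 0" and d: "\<bar>d\<bar> < int N"
  shows "(\<Sum>a<N. cis (2 * pi * real a * of_int d / real N)) = of_bool (d = 0) * of_nat N"
proof (cases "d = 0")
  case False
  define r where "r = cis (2 * pi * of_int d / real N)"
  have "r \<noteq> 1"
  proof
    assume "r = 1"
    then have "cos (2 * pi * of_int d / real N) = 1" by (simp add: r_def complex_eq_iff)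
    then obtain n :: int where "2 * pi * of_int d / real N = of_int n * (2 * pi)"
      by (auto simp: cos_one_2pi_int)
    then have "of_int d = of_int n * real N" using N by (simp add: field_simps)
    then have "d = n * int N" by (metis of_int_eq_iff of_int_mult of_int_of_nat_eq)
    then show False using d False by (cases "n = 0") (auto simp: abs_mult mult_less_cancel_right1)
  qed
  moreover have "r ^ N = 1"
    unfolding r_def Complex.DeMoivre using N by (simp add: cis_multiple_2pi)
  moreover have "cis (2 * pi * real a * of_int d / real N) = r ^ a" for a
    unfolding r_def Complex.DeMoivre by (simp add: mult_ac)
  ultimately show ?thesis using False by (simp add: geometric_sum)
qed simp

lemma sum_cos_ang:
  assumes i: "i \<in> Lam N" and j: "j \<in> Lam N"
  shows "(\<Sum>p\<in>Lam N. cos (ang N p i - ang N p j)) = of_bool (i = j) * (real N * real N)"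
proof -
  have N: "N > 0" using i by (auto simp: Lam_def)
  define d where "d = int (fst i) - int (fst j)"
  define e where "e = int (snd i) - int (snd j)"
  have "(\<Sum>p\<in>Lam N. cis (ang N p i - ang N p j)) =
     (\<Sum>p\<in>Lam N. cis (2 * pi * real (fst p) * of_int d / real N) * cis (2 * pi * real (snd p) * of_int e / real N))"
    by (rule sum.cong) (auto simp: ang_def d_def e_def cis_mult algebra_simps diff_divide_distrib add_divide_distrib)
  also have "\<dots> = (\<Sum>a<N. cis (2 * pi * real a * of_int d / real N)) * (\<Sum>a<N. cis (2 * pi * real a * of_int e / real N))"
    unfolding Lam_def sum_product sum.cartesian_product by (simp add: case_prod_unfold atLeast0LessThan)
  also have "\<dots> = of_bool (d = 0) * of_nat N * (of_bool (e = 0) * of_nat N)"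
    using i j by (subst (1 2) sum_cis_roots) (auto simp: N d_def e_def Lam_def)
  also have "\<dots> = of_bool (i = j) * (of_nat N * of_nat N)"
    by (auto simp: d_def e_def prod_eq_iff)
  finally have "Re (\<Sum>p\<in>Lam N. cis (ang N p i - ang N p j)) = Re (of_bool (i = j) * (of_nat N * of_nat N))" by simp
  then show ?thesis by (cases "i = j") auto
qed

lemma srw_prob_spectral:
  assumes i: "i \<in> Lam N" and j: "j \<in> Lam N"
  shows "srw_prob N t i j = (\<Sum>p\<in>Lam N. eigv N p ^ t * cos (ang N p i - ang N p j)) / (real N * real N)"
  using j
proof (induction t arbitrary: j)
  case 0
  have "N > 0" using i by (auto simp: Lam_def)
  then show ?case using sum_cos_ang[OF i 0] by simp
next
  case (Suc t)
  have "srw_prob N (Suc t) i j = (srw_prob N t i (lf N j) + srw_prob N t i (rt N j) + srw_prob N t i (dn N j) + srw_prob N t i (up N j)) / 4"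
    using srw_step_sum[OF Suc.prems, of "srw_prob N t i"] by simp
  also have "\<dots> = (\<Sum>p\<in>Lam N. eigv N p ^ t * (cos (ang N p i - ang N p (lf N j)) + cos (ang N p i - ang N p (rt N j))
       + cos (ang N p i - ang N p (dn N j)) + cos (ang N p i - ang N p (up N j)))) / (real N * real N) / 4"
    using Suc by (simp add: distrib_left sum.distrib add_divide_distrib)
  also have "\<dots> = (\<Sum>p\<in>Lam N. eigv N p ^ Suc t * cos (ang N p i - ang N p j)) / (real N * real N)"
    unfolding cos_ang_nbr_sum[OF Suc.prems] by (simp add: sum_divide_distrib mult_ac)
  finally show ?case .
qed

text \<open>Off the zero mode the upper bound is strict. The lower one is attained for even N at the
  frequency (N/2, N/2): the walk is then periodic, and it takes the factor exp(- lam t) to make the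
  series for \<open>green\<close> converge.\<close>

lemma eigv_bounds:
  assumes p: "p \<in> Lam N - {(0, 0)}"
  shows "eigv N p < 1" "- 1 \<le> eigv N p"
proof -
  have N: "N > 0" using p by (auto simp: Lam_def)
  have lt: "cos (2 * pi * real a / real N) < 1" if a: "a < N" "a \<noteq> 0" for a
  proof -
    have "cos (2 * pi * real a / real N) \<noteq> 1"
    proof
      assume "cos (2 * pi * real a / real N) = 1"
      then obtain n :: int where "2 * pi * real a / real N = of_int n * (2 * pi)"
        by (auto simp: cos_one_2pi_int)
      then have "real a = of_int n * real N" using N by (simp add: field_simps)
      then have "int a = n * int N" by (metis of_int_eq_iff of_int_mult of_int_of_nat_eq)
      then show False using a by (metis int_dvd_int_iff dvd_triv_right nat_dvd_not_less neq0_conv)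
    qed
    then show ?thesis using cos_le_one[of "2 * pi * real a / real N"] by linarith
  qed
  have "fst p \<noteq> 0 \<or> snd p \<noteq> 0" "fst p < N" "snd p < N" using p by (auto simp: Lam_def prod_eq_iff)
  then have "cos (2 * pi * real (fst p) / real N) < 1 \<or> cos (2 * pi * real (snd p) / real N) < 1"
    using lt by blast
  then have "cos (2 * pi * real (fst p) / real N) + cos (2 * pi * real (snd p) / real N) < 2"
    using cos_le_one[of "2 * pi * real (fst p) / real N"] cos_le_one[of "2 * pi * real (snd p) / real N"] by linarith
  then show "eigv N p < 1" unfolding eigv_def by simp
  have "- 1 \<le> (x + y) / 2" if "- 1 \<le> x" "- 1 \<le> y" for x y :: real
    using that by simp
  from this[OF cos_ge_minus_one cos_ge_minus_one] show "- 1 \<le> eigv N p"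
    unfolding eigv_def .
qed

text \<open>Subtracting 1 / |Lambda| removes exactly the zero mode, whose eigenvalue is 1. Every
  other mode is a geometric series of ratio \<open>eigv N p * exp (- lam)\<close>, and the sum over
  p is finite, so lam may tend to 0 term by term.\<close>

theorem green_spectral:
  assumes i: "i \<in> Lam N" and j: "j \<in> Lam N"
  shows "green N i j = (\<Sum>p\<in>Lam N - {(0, 0)}. cos (ang N p i - ang N p j) / (1 - eigv N p)) / (real N * real N)"
proof -
  have N: "N > 0" using i by (auto simp: Lam_def)
  have o: "(0, 0) \<in> Lam N" using N by (auto simp: Lam_def)
  let ?S = "Lam N - {(0, 0)}"
  let ?c = "\<lambda>p. cos (ang N p i - ang N p j)"
  have summand: "(srw_prob N t i j - 1 / real (card (Lam N))) * exp (- lam * real t) =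
     (\<Sum>p\<in>?S. ?c p * (eigv N p * exp (- lam)) ^ t) / (real N * real N)" for lam t
  proof -
    have "(\<Sum>p\<in>Lam N. eigv N p ^ t * ?c p) = 1 + (\<Sum>p\<in>?S. eigv N p ^ t * ?c p)"
      using sum.remove[OF finite_Lam o, of "\<lambda>p. eigv N p ^ t * ?c p"] by (simp add: eigv_def ang_def)
    then have "srw_prob N t i j - 1 / real (card (Lam N)) = (\<Sum>p\<in>?S. eigv N p ^ t * ?c p) / (real N * real N)"
      unfolding srw_prob_spectral[OF i j] card_Lam by (simp add: add_divide_distrib)
    moreover have "exp (- lam * real t) = exp (- lam) ^ t" by (simp add: exp_of_nat_mult[symmetric] mult.commute)
    ultimately show ?thesis by (simp add: sum_distrib_left power_mult_distrib mult_ac)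
  qed
  have ser: "(\<Sum>t. (srw_prob N t i j - 1 / real (card (Lam N))) * exp (- lam * real t)) =
      (\<Sum>p\<in>?S. ?c p / (1 - eigv N p * exp (- lam))) / (real N * real N)" if lam: "lam > 0" for lam
  proof (rule sums_unique[symmetric], unfold summand, intro sums_divide sums_sum)
    fix p assume p: "p \<in> ?S"
    have e: "0 < exp (- lam)" "exp (- lam) < 1" using lam by auto
    have "\<bar>eigv N p\<bar> \<le> 1" using eigv_bounds[OF p] by linarith
    then have "\<bar>eigv N p\<bar> * exp (- lam) \<le> exp (- lam)" using e by simp
    then have "\<bar>eigv N p\<bar> * exp (- lam) < 1" using e by linarith
    then have "norm (eigv N p * exp (- lam)) < 1" by (simp add: abs_mult)
    from sums_mult[OF geometric_sums[OF this], of "?c p"]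
    show "(\<lambda>t. ?c p * (eigv N p * exp (- lam)) ^ t) sums (?c p / (1 - eigv N p * exp (- lam)))" by simp
  qed
  have "((\<lambda>lam. (\<Sum>p\<in>?S. ?c p / (1 - eigv N p * exp (- lam))) / (real N * real N)) \<longlongrightarrow>
      (\<Sum>p\<in>?S. ?c p / (1 - eigv N p * exp (- 0))) / (real N * real N)) (at_right 0)"
  proof (intro tendsto_intros)
    show "1 - eigv N p * exp (- 0) \<noteq> 0" if "p \<in> ?S" for p
      using eigv_bounds(1)[OF that] by simp
  qed (use N in auto)
  then have "((\<lambda>lam. \<Sum>t. (srw_prob N t i j - 1 / real (card (Lam N))) * exp (- lam * real t)) \<longlongrightarrow>
      (\<Sum>p\<in>?S. ?c p / (1 - eigv N p)) / (real N * real N)) (at_right 0)"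
    by (subst tendsto_cong[OF eventually_mono[OF eventually_at_right_less ser]]) auto
  then show ?thesis unfolding green_def by (intro tendsto_Lim) auto
qed

lemma green_sym: "i \<in> Lam N \<Longrightarrow> j \<in> Lam N \<Longrightarrow> green N i j = green N j i"
  by (simp add: green_spectral cos_diff_commute[of "ang N p i" for p])

lemma green_diag: "i \<in> Lam N \<Longrightarrow> j \<in> Lam N \<Longrightarrow> green N i i = green N j j"
  by (simp add: green_spectral)

section \<open>Laplacian, Dirichlet form and a Poincare inequality\<close>

definition lap :: "nat \<Rightarrow> (site \<Rightarrow> real) \<Rightarrow> site \<Rightarrow> real" where
  "lap N u s = 4 * u s - (u (lf N s) + u (rt N s) + u (dn N s) + u (up N s))"

text \<open>Mode by mode the Laplacian multiplies by 4 (1 - eigv), which cancels the denominator;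
  the missing zero mode accounts for the term 1 / N^2. The factor 4 appears because
  \<open>lap\<close> is not normalised by the degree.\<close>

lemma lap_green:
  assumes i: "i \<in> Lam N" and j: "j \<in> Lam N"
  shows "lap N (\<lambda>z. green N z j) i = 4 * (of_bool (i = j) - 1 / (real N * real N))"
proof -
  have N: "N > 0" using i by (auto simp: Lam_def)
  have o: "(0, 0) \<in> Lam N" using N by (auto simp: Lam_def)
  let ?S = "Lam N - {(0, 0)}"
  define F where "F = (\<lambda>p z. cos (ang N p j - ang N p z) / (1 - eigv N p))"
  have G: "green N z j = (\<Sum>p\<in>?S. F p z) / (real N * real N)" if "z \<in> Lam N" for z
    unfolding green_spectral[OF that j] F_def by (simp only: cos_diff_commute[of "ang N p z" for p])
  have "lap N (\<lambda>z. green N z j) i = (\<Sum>p\<in>?S. 4 * F p i - (F p (lf N i) + F p (rt N i) + F p (dn N i) + F p (up N i))) / (real N * real N)"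
    unfolding lap_def G[OF i] G[OF nbr_in_Lam(1)[OF i]] G[OF nbr_in_Lam(2)[OF i]] G[OF nbr_in_Lam(3)[OF i]] G[OF nbr_in_Lam(4)[OF i]]
      sum_subtractf sum.distrib sum_distrib_left[symmetric]
    by (simp add: add_divide_distrib diff_divide_distrib)
  also have "\<dots> = (\<Sum>p\<in>?S. 4 * cos (ang N p i - ang N p j)) / (real N * real N)"
  proof -
    have "4 * F p i - (F p (lf N i) + F p (rt N i) + F p (dn N i) + F p (up N i)) = 4 * cos (ang N p i - ang N p j)" if p: "p \<in> ?S" for p
    proof -
      have "4 * F p i - (F p (lf N i) + F p (rt N i) + F p (dn N i) + F p (up N i)) =
        (4 * cos (ang N p j - ang N p i) - (cos (ang N p j - ang N p (lf N i)) + cos (ang N p j - ang N p (rt N i))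
       + cos (ang N p j - ang N p (dn N i)) + cos (ang N p j - ang N p (up N i)))) / (1 - eigv N p)"
        unfolding F_def by (simp only: add_divide_distrib diff_divide_distrib times_divide_eq_right)
      also have "\<dots> = 4 * cos (ang N p j - ang N p i) * (1 - eigv N p) / (1 - eigv N p)"
        unfolding cos_ang_nbr_sum[OF i] by (simp add: algebra_simps)
      finally show ?thesis using eigv_bounds(1)[OF p] by (simp add: cos_diff_commute[of "ang N p i"])
    qed
    then show ?thesis by simp
  qed
  also have "\<dots> = 4 * ((\<Sum>p\<in>Lam N. cos (ang N p i - ang N p j)) - 1) / (real N * real N)"
    using sum.remove[OF finite_Lam o, of "\<lambda>p. cos (ang N p i - ang N p j)"] by (simp add: ang_def sum_distrib_left[symmetric])
  also have "\<dots> = 4 * (of_bool (i = j) - 1 / (real N * real N))"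
    unfolding sum_cos_ang[OF i j] using N by (simp add: field_simps)
  finally show ?thesis .
qed

definition lapm :: "nat \<Rightarrow> site \<Rightarrow> site \<Rightarrow> real" where
  "lapm N x y = lap N (\<lambda>s. of_bool (s = y)) x"

definition dir :: "nat \<Rightarrow> (site \<Rightarrow> real) \<Rightarrow> real" where
  "dir N u = (\<Sum>s\<in>Lam N. (u s - u (rt N s))\<^sup>2 + (u s - u (up N s))\<^sup>2)"

lemma sum_lapm:
  assumes "x \<in> Lam N"
  shows "(\<Sum>y\<in>Lam N. lapm N x y * v y) = lap N v x"
proof -
  have d: "(\<Sum>y\<in>Lam N. of_bool (s = y) * v y) = v s" if "s \<in> Lam N" for s
    using that by (simp add: of_bool_def if_distrib[where f = "\<lambda>c. c * _"] sum.delta' cong: if_cong)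
  have "(\<Sum>y\<in>Lam N. lapm N x y * v y) = (\<Sum>y\<in>Lam N. 4 * (of_bool (x = y) * v y) - (of_bool (lf N x = y) * v y + of_bool (rt N x = y) * v y
     + of_bool (dn N x = y) * v y + of_bool (up N x = y) * v y))"
    by (intro sum.cong refl) (simp only: lapm_def lap_def left_diff_distrib distrib_right mult.assoc)
  also have "\<dots> = lap N v x"
    using assms by (simp only: sum_subtractf sum.distrib sum_distrib_left[symmetric] d nbr_in_Lam lap_def)
  finally show ?thesis .
qed

lemma lapm_sym:
  assumes "x \<in> Lam N" "y \<in> Lam N"
  shows "lapm N x y = lapm N y x"
proof -
  have "(lf N x = y) = (rt N y = x)" "(rt N x = y) = (lf N y = x)" "(dn N x = y) = (up N y = x)" "(up N x = y) = (dn N y = x)" "(x = y) = (y = x)"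
    using assms nbr_inverse by metis+
  then show ?thesis by (simp add: lapm_def lap_def)
qed

text \<open>Summation by parts; there are no boundary terms since \<open>rt\<close> and
  \<open>up\<close> permute the torus.\<close>

lemma quad_lapm: "quad (Lam N) (lapm N) v = dir N v"
proof -
  have "quad (Lam N) (lapm N) v = (\<Sum>x\<in>Lam N. v x * lap N v x)"
    unfolding quad_def by (intro sum.cong refl) (simp add: sum_lapm[symmetric] sum_distrib_left mult.assoc)
  also have "\<dots> = 4 * (\<Sum>x\<in>Lam N. (v x)\<^sup>2) - ((\<Sum>x\<in>Lam N. v x * v (lf N x)) + (\<Sum>x\<in>Lam N. v x * v (rt N x))
      + (\<Sum>x\<in>Lam N. v x * v (dn N x)) + (\<Sum>x\<in>Lam N. v x * v (up N x)))"
    by (simp add: lap_def algebra_simps sum.distrib sum_subtractf sum_distrib_left power2_eq_square)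
  also have "(\<Sum>x\<in>Lam N. v x * v (lf N x)) = (\<Sum>x\<in>Lam N. v x * v (rt N x))"
    using sum_nbr(1)[of "\<lambda>x. v x * v (lf N x)" N] by (simp add: mult.commute)
  also have "(\<Sum>x\<in>Lam N. v x * v (dn N x)) = (\<Sum>x\<in>Lam N. v x * v (up N x))"
    using sum_nbr(2)[of "\<lambda>x. v x * v (dn N x)" N] by (simp add: mult.commute)
  finally show ?thesis
    using sum_nbr[of "\<lambda>x. (v x)\<^sup>2" N]
    by (simp add: dir_def power2_diff sum.distrib sum_subtractf sum_distrib_left[symmetric] mult.assoc)
qed

lemma quad_subset:
  assumes "finite J" "I \<subseteq> J" "\<And>x. x \<in> J - I \<Longrightarrow> v x = 0"
  shows "quad I a v = quad J a v"
proof -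
  have "quad J a v = (\<Sum>x\<in>I. \<Sum>y\<in>J. v x * a x y * v y)"
    unfolding quad_def by (rule sum.mono_neutral_right) (use assms in auto)
  also have "\<dots> = quad I a v"
    unfolding quad_def by (intro sum.cong refl sum.mono_neutral_right) (use assms in auto)
  finally show ?thesis by simp
qed

text \<open>Any site is joined to the origin by a path along the bottom row and then up a column,
  with at most 2 N edges. This serves as a Poincare inequality when eps is the square root of the
  energy, and as connectedness of the torus when eps = 0.\<close>

lemma gradient_bound:
  fixes u :: "site \<Rightarrow> real"
  assumes g: "\<And>s. s \<in> Lam N \<Longrightarrow> \<bar>u s - u (rt N s)\<bar> \<le> \<epsilon>" "\<And>s. s \<in> Lam N \<Longrightarrow> \<bar>u s - u (up N s)\<bar> \<le> \<epsilon>"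
    and st: "s \<in> Lam N" "t \<in> Lam N"
  shows "\<bar>u s - u t\<bar> \<le> 4 * real N * \<epsilon>"
proof -
  have N: "N > 0" using st by (auto simp: Lam_def)
  have e: "\<epsilon> \<ge> 0" using g(1)[OF st(1)] by linarith
  have x: "\<bar>u (x, 0) - u (0, 0)\<bar> \<le> real x * \<epsilon>" if "x < N" for x
    using that
  proof (induction x)
    case (Suc x)
    then have "(x, 0) \<in> Lam N" "rt N (x, 0) = (Suc x, 0)" by (auto simp: Lam_def rt_def)
    then show ?case using g(1)[of "(x, 0)"] Suc by (auto simp: algebra_simps)
  qed simp
  have y: "\<bar>u (x, y) - u (x, 0)\<bar> \<le> real y * \<epsilon>" if "x < N" "y < N" for x y
    using that
  proof (induction y)
    case (Suc y)
    then have "(x, y) \<in> Lam N" "up N (x, y) = (x, Suc y)" by (auto simp: Lam_def up_def)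
    then show ?case using g(2)[of "(x, y)"] Suc by (auto simp: algebra_simps)
  qed simp
  have "\<bar>u s - u (0, 0)\<bar> \<le> 2 * real N * \<epsilon>" if s: "s \<in> Lam N" for s
  proof -
    have "real (fst s) * \<epsilon> \<le> real N * \<epsilon>" "real (snd s) * \<epsilon> \<le> real N * \<epsilon>"
      using s e by (auto intro!: mult_right_mono simp: Lam_def)
    moreover have "fst s < N" "snd s < N" using s by (auto simp: Lam_def)
    ultimately show ?thesis using x[of "fst s"] y[of "fst s" "snd s"] by auto
  qed
  from this[OF st(1)] this[OF st(2)] show ?thesis by linarith
qed

lemma gradient_le_dir:
  assumes "s \<in> Lam N"
  shows "(u s - u (rt N s))\<^sup>2 \<le> dir N u" "(u s - u (up N s))\<^sup>2 \<le> dir N u"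
proof -
  have "(u s - u (rt N s))\<^sup>2 + (u s - u (up N s))\<^sup>2 \<le> dir N u"
    unfolding dir_def by (rule member_le_sum[OF assms]) auto
  then show "(u s - u (rt N s))\<^sup>2 \<le> dir N u" "(u s - u (up N s))\<^sup>2 \<le> dir N u"
    by (smt (verit) zero_le_power2)+
qed

lemma dir_nonneg: "dir N u \<ge> 0"
  unfolding dir_def by (intro sum_nonneg add_nonneg_nonneg) auto

lemma diff_le_dir:
  assumes "s \<in> Lam N" "t \<in> Lam N"
  shows "(u s - u t)\<^sup>2 \<le> 16 * (real N)\<^sup>2 * dir N u"
proof -
  have "\<bar>u s - u t\<bar> \<le> 4 * real N * sqrt (dir N u)"
    using assms by (intro gradient_bound) (auto intro!: real_le_rsqrt gradient_le_dir)
  then have "(u s - u t)\<^sup>2 \<le> (4 * real N * sqrt (dir N u))\<^sup>2"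
    by (rule power2_le_iff_abs_le[THEN iffD2, rotated]) (auto simp: dir_nonneg)
  also have "\<dots> = 16 * (real N)\<^sup>2 * dir N u" by (simp add: power_mult_distrib dir_nonneg)
  finally show ?thesis .
qed

section \<open>Duality between the integer-valued field and the Coulomb gas\<close>

abbreviation org :: site where "org \<equiv> (0, 0)"

text \<open>Fixing the value at the origin chooses one representative of each field modulo
  constants; differences m_i - m_j do not depend on this choice.\<close>

definition Cfg :: "nat \<Rightarrow> (site \<Rightarrow> int) set" where
  "Cfg N = int_funs (Lam N - {org})"

definition iv_weight :: "nat \<Rightarrow> real \<Rightarrow> (site \<Rightarrow> int) \<Rightarrow> real" where
  "iv_weight N b m = exp (- dir N (\<lambda>s. of_int (m s)) / (4 * b))"

text \<open>Neutrality determines the charge at the origin, so neutral configurations are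
  parametrised by free integers at the other sites, the same index set as for the pinned
  field.\<close>

definition neutralize :: "nat \<Rightarrow> (site \<Rightarrow> int) \<Rightarrow> site \<Rightarrow> real" where
  "neutralize N k x = 2 * pi * of_int (if x = org then - (\<Sum>y\<in>Lam N - {org}. k y) else k x)"

lemma bij_betw_neutralize:
  assumes N: "N > 0"
  shows "bij_betw (neutralize N) (Cfg N) (Omega N)"
proof -
  have o: "org \<in> Lam N" using N by (auto simp: Lam_def)
  define inv where "inv = (\<lambda>(f :: site \<Rightarrow> real) x. if x = org then 0 else \<lfloor>f x / (2 * pi)\<rfloor>)"
  show ?thesis
  proof (rule bij_betw_byWitness[where f' = inv])
    show "\<forall>k\<in>Cfg N. inv (neutralize N k) = k"
      by (auto simp: inv_def neutralize_def Cfg_def int_funs_def fun_eq_iff)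
    show "neutralize N ` Cfg N \<subseteq> Omega N"
    proof
      fix f assume "f \<in> neutralize N ` Cfg N"
      then obtain k where k: "k \<in> Cfg N" and f: "f = neutralize N k" by auto
      have "(\<Sum>x\<in>Lam N. f x) = f org + (\<Sum>x\<in>Lam N - {org}. f x)" by (rule sum.remove) (auto simp: o)
      also have "(\<Sum>x\<in>Lam N - {org}. f x) = (\<Sum>x\<in>Lam N - {org}. 2 * pi * of_int (k x))"
        by (rule sum.cong) (auto simp: f neutralize_def)
      also have "\<dots> = 2 * pi * of_int (\<Sum>x\<in>Lam N - {org}. k x)" by (simp add: sum_distrib_left)
      finally have "(\<Sum>x\<in>Lam N. f x) = 0" by (simp add: f neutralize_def)
      then show "f \<in> Omega N"
        unfolding Omega_def using k o by (auto simp: f neutralize_def Cfg_def int_funs_def)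
    qed
    have ch: "of_int \<lfloor>f x / (2 * pi)\<rfloor> * (2 * pi) = f x" if f: "f \<in> Omega N" "x \<in> Lam N" for f x
    proof -
      obtain n :: int where "f x = 2 * pi * of_int n" using f unfolding Omega_def by blast
      then show ?thesis by simp
    qed
    show "\<forall>f\<in>Omega N. neutralize N (inv f) = f"
    proof (intro ballI ext)
      fix f x assume f: "f \<in> Omega N"
      show "neutralize N (inv f) x = f x"
      proof (cases "x \<in> Lam N")
        case False
        then have "f x = 0" "x \<noteq> org" using f o unfolding Omega_def by blast+
        then show ?thesis by (simp add: neutralize_def inv_def)
      next
        case True
        show ?thesis
        proof (cases "x = org")
          case False
          then show ?thesis using ch[OF f True] by (simp add: neutralize_def inv_def mult.commute)
        next
          case True
          have "neutralize N (inv f) org = - (\<Sum>y\<in>Lam N - {org}. of_int \<lfloor>f y / (2 * pi)\<rfloor> * (2 * pi))"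
            by (simp add: neutralize_def inv_def sum_distrib_left mult.commute)
          also have "\<dots> = - (\<Sum>y\<in>Lam N - {org}. f y)" using ch[OF f] by simp
          also have "\<dots> = f org"
            using f sum.remove[OF finite_Lam o, of f] by (simp add: Omega_def)
          finally show ?thesis using True by simp
        qed
      qed
    qed
    show "inv ` Omega N \<subseteq> Cfg N"
      by (auto simp: inv_def Cfg_def int_funs_def Omega_def)
  qed
qed

text \<open>The Green's function with Dirichlet condition at the origin.\<close>
definition green_dir :: "nat \<Rightarrow> site \<Rightarrow> site \<Rightarrow> real" where
  "green_dir N x y = green N x y - green N x org - green N org y + green N org org"

text \<open>\<open>green_dir\<close> vanishes as soon as one argument is the origin, and differs
  from \<open>green\<close> by terms depending on at most one argument, which a neutral charge
  annihilates.\<close>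

lemma quad_green_dir:
  assumes N: "N > 0" and neutral: "(\<Sum>x\<in>Lam N. v x) = 0"
  shows "quad (Lam N - {org}) (green_dir N) v = quad (Lam N) (green N) v"
proof -
  let ?v = "v(org := 0)"
  have o: "org \<in> Lam N" using N by (auto simp: Lam_def)
  have "quad (Lam N - {org}) (green_dir N) v = (\<Sum>x\<in>Lam N. \<Sum>y\<in>Lam N - {org}. v x * green_dir N x y * v y)"
    unfolding quad_def by (rule sum.mono_neutral_left) (auto simp: green_dir_def)
  also have "\<dots> = quad (Lam N) (green_dir N) v"
    unfolding quad_def by (intro sum.cong refl sum.mono_neutral_left) (auto simp: green_dir_def)
  also have "\<dots> = quad (Lam N) (green N) v - (\<Sum>x\<in>Lam N. v x * green N x org) * (\<Sum>y\<in>Lam N. v y)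
      - (\<Sum>x\<in>Lam N. v x) * (\<Sum>y\<in>Lam N. green N org y * v y) + (\<Sum>x\<in>Lam N. v x) * (\<Sum>y\<in>Lam N. green N org org * v y)"
    unfolding quad_def green_dir_def sum_product
    by (simp add: algebra_simps sum.distrib sum_subtractf)
  finally show ?thesis using neutral by simp
qed

text \<open>Poisson summation with a = lapm / (4 pi b), so that pi times its form is the energy
  \<open>dir\<close> / (4 b), and with inverse g = pi b \<open>green_dir\<close>. The source is z =
  tau / (2 pi) (delta_i - delta_j). Summability of the tilted weight for every tau is recorded
  because it later dominates the difference quotients.\<close>

theorem villain_duality:
  assumes N: "N > 0" and b: "b > 0"
  shows "iv_weight N b summable_on Cfg N \<and> (\<exists>C>0. \<forall>i\<in>Lam N. \<forall>j\<in>Lam N. \<forall>\<tau>.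
     (\<lambda>k. cg_weight N b k * exp (b / 2 * \<tau> * voltage N i j k)) summable_on Omega N \<and>
     (\<Sum>\<^sub>\<infinity>m\<in>Cfg N. iv_weight N b m * cos (\<tau> * (of_int (m i) - of_int (m j)))) =
     C * exp (- (b / 2) * \<tau>\<^sup>2 * (green N i i - green N i j)) *
      (\<Sum>\<^sub>\<infinity>k\<in>Omega N. cg_weight N b k * exp (b / 2 * \<tau> * voltage N i j k)))"
proof -
  define I where "I = Lam N - {org}"
  define a where "a = (\<lambda>x y. 1 / (4 * pi * b) * lapm N x y)"
  define g where "g = (\<lambda>x y. pi * b * green_dir N x y)"
  have o: "org \<in> Lam N" using N by (auto simp: Lam_def)
  have fin: "finite I" by (simp add: I_def)
  have scale: "quad J (\<lambda>x y. c * h x y) v = c * quad J h v" for J :: "site set" and c h v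
    unfolding quad_def by (simp add: sum_distrib_left mult_ac)
  have syma: "a x y = a y x" if "x \<in> I" "y \<in> I" for x y
    using that lapm_sym by (auto simp: a_def I_def)
  have symg: "g x y = g y x" if "x \<in> I" "y \<in> I" for x y
    using that green_sym[of x N y] green_sym[of x N org] green_sym[of y N org] o by (auto simp: g_def I_def green_dir_def)
  have inv: "(\<Sum>r\<in>I. a x r * g r y) = of_bool (x = y)" if "x \<in> I" "y \<in> I" for x y
  proof -
    have xy: "x \<in> Lam N" "y \<in> Lam N" "x \<noteq> org" "y \<noteq> org" using that by (auto simp: I_def)
    have "(\<Sum>r\<in>I. a x r * g r y) = (\<Sum>r\<in>Lam N. a x r * g r y)"
      unfolding I_def by (rule sum.mono_neutral_left) (auto simp: g_def green_dir_def)
    also have "\<dots> = 1 / 4 * (\<Sum>r\<in>Lam N. lapm N x r * green_dir N r y)"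
      using b by (simp add: a_def g_def sum_distrib_left mult_ac)
    also have "\<dots> = 1 / 4 * lap N (\<lambda>r. green_dir N r y) x" using xy by (simp add: sum_lapm)
    also have "lap N (\<lambda>r. green_dir N r y) x = lap N (\<lambda>z. green N z y) x - lap N (\<lambda>z. green N z org) x"
      by (simp add: lap_def green_dir_def)
    \<comment> \<open>The terms 1 / N^2 from the columns y and org cancel, and x differs from
      org.\<close>
    also have "\<dots> = 4 * of_bool (x = y)" using xy o by (simp add: lap_green)
    finally show ?thesis by simp
  qed
  have quad_a: "quad I a v = 1 / (4 * pi * b) * dir N v" if "v org = 0" for v
    unfolding a_def scale quad_lapm[symmetric] I_def using that by (subst quad_subset[of "Lam N"]) auto
  have pos: "quad I a v > 0" if v: "\<exists>x\<in>I. v x \<noteq> 0" for v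
  proof -
    define u where "u = v(org := 0)"
    have "quad I a v = quad I a u" unfolding quad_def u_def by (intro sum.cong) (auto simp: I_def)
    also have "\<dots> = 1 / (4 * pi * b) * dir N u" by (rule quad_a) (simp add: u_def)
    finally have q: "quad I a v = 1 / (4 * pi * b) * dir N u" .
    obtain x where x: "x \<in> I" "v x \<noteq> 0" using v by blast
    have "(u x - u org)\<^sup>2 \<le> 16 * (real N)\<^sup>2 * dir N u"
      by (rule diff_le_dir) (use x o in \<open>auto simp: I_def\<close>)
    moreover have "(u x - u org)\<^sup>2 > 0" using x by (auto simp: u_def I_def)
    ultimately have "dir N u > 0" using dir_nonneg[of N u] by (cases "dir N u = 0") auto
    then show ?thesis unfolding q using b by simp
  qed
  have wt: "exp (- pi * quad I a (\<lambda>x. of_int (m x))) = iv_weight N b m" if "m \<in> Cfg N" for m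
    using that b by (subst quad_a) (auto simp: Cfg_def int_funs_def iv_weight_def)
  have Cfg: "int_funs I = Cfg N" by (simp add: Cfg_def I_def)
  from poisson_gauss[OF fin syma symg inv pos]
  have sw: "(\<lambda>m. exp (- pi * quad I a (\<lambda>x. of_int (m x)))) summable_on Cfg N"
    and "\<exists>C>0. \<forall>z. (\<lambda>k. exp (- pi * quad I g (\<lambda>x. of_int (k x) - z x))) summable_on Cfg N \<and>
      (\<Sum>\<^sub>\<infinity>m\<in>Cfg N. of_real (exp (- pi * quad I a (\<lambda>x. of_int (m x)))) * cis (2 * pi * (\<Sum>x\<in>I. of_int (m x) * z x)))
       = of_real (C * (\<Sum>\<^sub>\<infinity>k\<in>Cfg N. exp (- pi * quad I g (\<lambda>x. of_int (k x) - z x))))"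
    unfolding Cfg by auto
  then obtain C where C: "C > 0" and P1: "\<And>z. (\<lambda>k. exp (- pi * quad I g (\<lambda>x. of_int (k x) - z x))) summable_on Cfg N"
    and P2: "\<And>z. (\<Sum>\<^sub>\<infinity>m\<in>Cfg N. of_real (exp (- pi * quad I a (\<lambda>x. of_int (m x)))) * cis (2 * pi * (\<Sum>x\<in>I. of_int (m x) * z x)))
       = of_real (C * (\<Sum>\<^sub>\<infinity>k\<in>Cfg N. exp (- pi * quad I g (\<lambda>x. of_int (k x) - z x))))"
    by auto
  have s: "iv_weight N b summable_on Cfg N"
    by (rule summable_on_cong[THEN iffD1, OF _ sw]) (rule wt)
  have main: "(\<lambda>k. cg_weight N b k * exp (b / 2 * \<tau> * voltage N i j k)) summable_on Omega N \<and>
     (\<Sum>\<^sub>\<infinity>m\<in>Cfg N. iv_weight N b m * cos (\<tau> * (of_int (m i) - of_int (m j)))) =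
     C * exp (- (b / 2) * \<tau>\<^sup>2 * (green N i i - green N i j)) *
      (\<Sum>\<^sub>\<infinity>k\<in>Omega N. cg_weight N b k * exp (b / 2 * \<tau> * voltage N i j k))"
    if i: "i \<in> Lam N" and j: "j \<in> Lam N" for i j \<tau>
  proof -
    define u :: "site \<Rightarrow> real" where "u = (\<lambda>x. of_bool (x = i) - of_bool (x = j))"
    define z where "z = (\<lambda>x. \<tau> / (2 * pi) * u x)"
    have su: "(\<Sum>x\<in>Lam N. f x * u x) = f i - f j" for f
      using i j by (simp add: u_def right_diff_distrib sum_subtractf of_bool_def if_distrib[where f = "\<lambda>c. _ * c"] sum.delta cong: if_cong)
    have neutral: "(\<Sum>x\<in>Lam N. neutralize N k x - \<tau> * u x) = 0" if "k \<in> Cfg N" for k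
    proof -
      have "neutralize N k \<in> Omega N" using bij_betw_neutralize[OF N] that by (auto simp: bij_betw_def)
      moreover have "(\<Sum>x\<in>Lam N. \<tau> * u x) = 0" using su[of "\<lambda>_. \<tau>"] by simp
      ultimately show ?thesis by (simp add: Omega_def sum_subtractf)
    qed
    let ?D = "exp (- (b / 2) * \<tau>\<^sup>2 * (green N i i - green N i j))"
    have w2: "exp (- pi * quad I g (\<lambda>x. of_int (k x) - z x)) = ?D * (cg_weight N b (neutralize N k) * exp (b / 2 * \<tau> * voltage N i j (neutralize N k)))"
      if k: "k \<in> Cfg N" for k
    proof -
      let ?k = "neutralize N k"
      have "pi * quad I g (\<lambda>x. of_int (k x) - z x) = b / 4 * ((2 * pi)\<^sup>2 * quad I (green_dir N) (\<lambda>x. of_int (k x) - z x))"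
        unfolding g_def scale by (simp add: power2_eq_square)
      also have "(2 * pi)\<^sup>2 * quad I (green_dir N) (\<lambda>x. of_int (k x) - z x) = quad I (green_dir N) (\<lambda>x. 2 * pi * (of_int (k x) - z x))"
        unfolding quad_def sum_distrib_left by (intro sum.cong refl) (simp add: power2_eq_square algebra_simps)
      also have "\<dots> = quad I (green_dir N) (\<lambda>x. ?k x - \<tau> * u x)"
        unfolding quad_def by (intro sum.cong refl) (auto simp: I_def neutralize_def z_def algebra_simps)
      \<comment> \<open>The shifted charge is still neutral, so the Dirichlet form may be replaced
        by that of the torus, where the square is expanded.\<close>
      also have "\<dots> = quad (Lam N) (green N) (\<lambda>x. ?k x + (- \<tau>) * u x)"
        unfolding I_def using quad_green_dir[OF N neutral[OF k]] by simp
      also have "\<dots> = quad (Lam N) (green N) ?k + 2 * (- \<tau>) * (\<Sum>x\<in>Lam N. \<Sum>y\<in>Lam N. u x * green N x y * ?k y) + (- \<tau>)\<^sup>2 * quad (Lam N) (green N) u"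
        by (rule quad_add_mult) (rule green_sym)
      also have "(\<Sum>x\<in>Lam N. \<Sum>y\<in>Lam N. u x * green N x y * ?k y) = voltage N i j ?k"
      proof -
        have "(\<Sum>x\<in>Lam N. \<Sum>y\<in>Lam N. u x * green N x y * ?k y) = (\<Sum>x\<in>Lam N. (\<Sum>y\<in>Lam N. green N x y * ?k y) * u x)"
          unfolding sum_distrib_right by (intro sum.cong refl) (simp add: mult_ac)
        then show ?thesis unfolding su voltage_def by (simp add: left_diff_distrib sum_subtractf)
      qed
      also have "quad (Lam N) (green N) u = 2 * (green N i i - green N i j)"
      proof -
        have "quad (Lam N) (green N) u = (\<Sum>x\<in>Lam N. (\<Sum>y\<in>Lam N. green N x y * u y) * u x)"
          unfolding quad_def sum_distrib_right by (intro sum.cong refl) (simp add: mult_ac)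
        then show ?thesis unfolding su using green_sym[OF i j] green_diag[OF i j] by simp
      qed
      finally have "pi * quad I g (\<lambda>x. of_int (k x) - z x) = b / 4 * (energy N ?k - 2 * \<tau> * voltage N i j ?k + \<tau>\<^sup>2 * (2 * (green N i i - green N i j)))"
        by (simp add: quad_def energy_def)
      then have "- pi * quad I g (\<lambda>x. of_int (k x) - z x) = - (b / 4 * (energy N ?k - 2 * \<tau> * voltage N i j ?k + \<tau>\<^sup>2 * (2 * (green N i i - green N i j))))"
        by (simp only: mult_minus_left)
      also have "\<dots> = - (b / 2) * \<tau>\<^sup>2 * (green N i i - green N i j) + (- (b / 4) * energy N ?k + b / 2 * \<tau> * voltage N i j ?k)"
        by (simp add: field_simps)
      finally show ?thesis unfolding cg_weight_def by (simp only: exp_add)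
    qed
    let ?f = "\<lambda>k. cg_weight N b k * exp (b / 2 * \<tau> * voltage N i j k)"
    have "(\<lambda>k. ?D * ?f (neutralize N k)) summable_on Cfg N"
      by (rule summable_on_cong[THEN iffD1, OF _ P1[of z]]) (rule w2)
    then have "(\<lambda>k. ?f (neutralize N k)) summable_on Cfg N"
      using summable_on_cmult_right'[of ?D "\<lambda>k. ?f (neutralize N k)"] by simp
    then have sf: "?f summable_on Omega N"
      using summable_on_reindex_bij_betw[OF bij_betw_neutralize[OF N], of ?f] by simp
    have "(\<Sum>\<^sub>\<infinity>k\<in>Cfg N. exp (- pi * quad I g (\<lambda>x. of_int (k x) - z x))) = (\<Sum>\<^sub>\<infinity>k\<in>Cfg N. ?D * ?f (neutralize N k))"
      by (rule infsum_cong) (rule w2)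
    also have "\<dots> = ?D * infsum ?f (Omega N)"
      using infsum_reindex_bij_betw[OF bij_betw_neutralize[OF N], of ?f] by (simp add: infsum_cmult_right')
    finally have rhs: "(\<Sum>\<^sub>\<infinity>k\<in>Cfg N. exp (- pi * quad I g (\<lambda>x. of_int (k x) - z x))) = ?D * infsum ?f (Omega N)" .
    have ph: "2 * pi * (\<Sum>x\<in>I. of_int (m x) * z x) = \<tau> * (of_int (m i) - of_int (m j))" if m: "m \<in> Cfg N" for m
    proof -
      have "(\<Sum>x\<in>I. of_int (m x) * z x) = (\<Sum>x\<in>Lam N. of_int (m x) * z x)"
        unfolding I_def by (rule sum.mono_neutral_left) (use m in \<open>auto simp: Cfg_def int_funs_def\<close>)
      also have "\<dots> = \<tau> / (2 * pi) * (\<Sum>x\<in>Lam N. of_int (m x) * u x)"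
        by (simp add: z_def sum_distrib_left mult_ac)
      finally show ?thesis unfolding su by simp
    qed
    have "(\<Sum>\<^sub>\<infinity>m\<in>Cfg N. of_real (iv_weight N b m) * cis (\<tau> * (of_int (m i) - of_int (m j)))) = of_real (C * (?D * infsum ?f (Omega N)))"
      unfolding rhs[symmetric] P2[symmetric] by (rule infsum_cong) (simp only: wt ph)
    moreover have "(\<lambda>m. of_real (iv_weight N b m) * cis (\<tau> * (of_int (m i) - of_int (m j)))) summable_on Cfg N"
      by (rule abs_summable_summable, rule summable_on_cong[THEN iffD1, OF _ s]) (simp add: norm_mult iv_weight_def)
    ultimately have "(\<Sum>\<^sub>\<infinity>m\<in>Cfg N. Re (of_real (iv_weight N b m) * cis (\<tau> * (of_int (m i) - of_int (m j))))) = C * (?D * infsum ?f (Omega N))"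
      by (subst infsum_Re) auto
    then show ?thesis using sf by (simp add: mult.assoc)
  qed
  show ?thesis
    by (intro exI[of _ C] conjI ballI allI s C main[THEN conjunct1] main[THEN conjunct2])
qed


section \<open>Circulations in directed graphs\<close>

definition circ :: "('e \<Rightarrow> 'v) \<Rightarrow> ('e \<Rightarrow> 'v) \<Rightarrow> 'e set \<Rightarrow> bool" where
  "circ src tgt F \<longleftrightarrow> finite F \<and> (\<forall>v. card {e\<in>F. src e = v} = card {e\<in>F. tgt e = v})"

definition mincirc :: "('e \<Rightarrow> 'v) \<Rightarrow> ('e \<Rightarrow> 'v) \<Rightarrow> 'e set \<Rightarrow> bool" where
  "mincirc src tgt C \<longleftrightarrow> circ src tgt C \<and> C \<noteq> {} \<and> (\<forall>D. circ src tgt D \<and> D \<subseteq> C \<and> D \<noteq> {} \<longrightarrow> D = C)"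

lemma circ_diff:
  assumes "circ src tgt F" "circ src tgt C" "C \<subseteq> F"
  shows "circ src tgt (F - C)"
proof -
  have d: "card {e\<in>F - C. f e = v} = card {e\<in>F. f e = v} - card {e\<in>C. f e = v}" for f :: "'a \<Rightarrow> 'b" and v
  proof -
    have "{e\<in>F - C. f e = v} = {e\<in>F. f e = v} - {e\<in>C. f e = v}" by auto
    then show ?thesis using assms by (simp add: circ_def) (rule card_Diff_subset; auto)
  qed
  show ?thesis using assms unfolding circ_def d by auto
qed

lemma ex_mincirc:
  assumes "circ src tgt F" "F \<noteq> {}"
  shows "\<exists>C\<subseteq>F. mincirc src tgt C"
proof -
  have "\<exists>C. circ src tgt C \<and> C \<subseteq> F \<and> C \<noteq> {} \<and> (\<forall>D. circ src tgt D \<and> D \<subseteq> F \<and> D \<noteq> {} \<longrightarrow> card C \<le> card D)"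
    using ex_has_least_nat[of "\<lambda>C. circ src tgt C \<and> C \<subseteq> F \<and> C \<noteq> {}" F card] assms by auto
  then obtain C where C: "circ src tgt C" "C \<subseteq> F" "C \<noteq> {}"
    and least: "\<And>D. circ src tgt D \<Longrightarrow> D \<subseteq> F \<Longrightarrow> D \<noteq> {} \<Longrightarrow> card C \<le> card D" by auto
  have "D = C" if "circ src tgt D" "D \<subseteq> C" "D \<noteq> {}" for D
    using least[OF that(1) _ that(3)] that(2) C by (intro card_seteq) (auto simp: circ_def)
  then show ?thesis using C unfolding mincirc_def by blast
qed

section \<open>Closed trails and the number of minimal circulations\<close>

inductive trail :: "('e \<Rightarrow> 'v) \<Rightarrow> ('e \<Rightarrow> 'v) \<Rightarrow> 'v \<Rightarrow> 'e set \<Rightarrow> 'v \<Rightarrow> bool" for src tgt v where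
  empty: "trail src tgt v {} v"
| extend: "trail src tgt v A w \<Longrightarrow> src e = w \<Longrightarrow> e \<notin> A \<Longrightarrow> trail src tgt v (insert e A) (tgt e)"

text \<open>In- and out-degrees balance along a trail except for one extra departure at v and one
  extra arrival at w; the \<open>of_bool\<close> terms cancel when the trail is closed.\<close>

lemma trail_balance:
  assumes "trail src tgt v A w"
  shows "finite A \<and> (\<forall>x. card {e\<in>A. src e = x} + of_bool (x = w) = card {e\<in>A. tgt e = x} + of_bool (x = v))"
  using assms
proof (induction rule: trail.induct)
  case empty
  then show ?case by simp
next
  case (extend A w e)
  have ins: "card {e'\<in>insert e A. f e' = x} = card {e'\<in>A. f e' = x} + of_bool (x = f e)" for f :: "'a \<Rightarrow> 'b" and x
  proof (cases "x = f e")
    case True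
    have "{e'\<in>insert e A. f e' = x} = insert e {e'\<in>A. f e' = x}" using True by auto
    then show ?thesis using extend True by simp
  next
    case False
    have "{e'\<in>insert e A. f e' = x} = {e'\<in>A. f e' = x}" using False by auto
    then show ?thesis using False by simp
  qed
  show ?case unfolding ins
  proof (intro conjI allI)
    fix x
    have "card {e\<in>A. src e = x} + of_bool (x = w) = card {e\<in>A. tgt e = x} + of_bool (x = v)"
      using extend.IH by blast
    then show "card {e\<in>A. src e = x} + of_bool (x = src e) + of_bool (x = tgt e) = card {e\<in>A. tgt e = x} + of_bool (x = tgt e) + of_bool (x = v)"
      unfolding extend.hyps(2) by linarith
  qed (use extend.IH in simp)
qed

lemma closed_trail_circ: "trail src tgt v A v \<Longrightarrow> circ src tgt A"
  using trail_balance[of src tgt v A v] by (auto simp: circ_def)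

text \<open>A longest trail inside a circulation can only stop where it started.\<close>
lemma ex_closed_trail:
  assumes F: "circ src tgt F" and e: "e \<in> F"
  shows "\<exists>A\<subseteq>F. A \<noteq> {} \<and> trail src tgt (src e) A (src e)"
proof -
  let ?v = "src e"
  have fin: "finite F" using F by (simp add: circ_def)
  let ?P = "\<lambda>p. trail src tgt ?v (fst p) (snd p) \<and> fst p \<subseteq> F"
  have "?P ({}, ?v)" by (auto intro: trail.empty)
  moreover have "\<forall>p. ?P p \<longrightarrow> card (fst p) \<le> card F" using fin by (auto intro: card_mono)
  ultimately obtain p where p: "?P p" and great: "\<And>p'. ?P p' \<Longrightarrow> card (fst p') \<le> card (fst p)"
    using ex_has_greatest_nat[of ?P "({}, ?v)" "\<lambda>p. card (fst p)" "card F + 1"] by (metis le_imp_less_Suc Suc_eq_plus1)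
  obtain A w where Aw: "p = (A, w)" by (cases p)
  have t: "trail src tgt ?v A w" and AF: "A \<subseteq> F" using p Aw by auto
  have finA: "finite A" using AF fin finite_subset by blast
  \<comment> \<open>A longest trail has used up every arc of F leaving its end w, otherwise it could
    be extended.\<close>
  have sat: "{e\<in>A. src e = w} = {e\<in>F. src e = w}"
  proof (rule ccontr)
    assume "{e\<in>A. src e = w} \<noteq> {e\<in>F. src e = w}"
    then obtain e' where e': "e' \<in> F" "src e' = w" "e' \<notin> A" using AF by blast
    have "?P (insert e' A, tgt e')" using trail.extend[OF t e'(2,3)] AF e'(1) by auto
    from great[OF this] show False using e' finA Aw by simp
  qed
  \<comment> \<open>If w were not the start, A would enter w once more often than it leaves it,
    although it contains all arcs of F leaving w and F is balanced there.\<close>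
  have "card {e\<in>A. tgt e = w} \<le> card {e\<in>F. tgt e = w}" by (rule card_mono) (use fin AF in auto)
  also have "\<dots> = card {e\<in>A. src e = w}" unfolding sat using F by (simp add: circ_def)
  finally have "w = ?v" using trail_balance[OF t] by (cases "w = ?v") (auto dest!: conjunct2 spec[of _ w])
  moreover have "A \<noteq> {}" using sat e \<open>w = ?v\<close> by auto
  ultimately show ?thesis using t AF by auto
qed

text \<open>A closed trail inside C is itself a circulation, so minimality makes it all of C. Hence
  C can be traced from any of its vertices, which allows it to be counted from a prescribed
  root.\<close>

lemma mincirc_trail:
  assumes "mincirc src tgt C" "e \<in> C"
  shows "trail src tgt (src e) C (src e)"
proof -
  have C: "circ src tgt C" using assms by (simp add: mincirc_def)
  obtain A where A: "A \<subseteq> C" "A \<noteq> {}" "trail src tgt (src e) A (src e)" using ex_closed_trail[OF C assms(2)] by blast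
  then have "A = C" using assms(1) closed_trail_circ[OF A(3)] unfolding mincirc_def by blast
  then show ?thesis using A by simp
qed

text \<open>The last arc leaves the end of the shorter trail, which gives at most four choices.
  Recording only the arc set and the end point identifies trails that differ in order, and this can
  only lower the count.\<close>

lemma card_trails:
  assumes E: "finite E" and deg: "\<And>w. card {e\<in>E. src e = w} \<le> 4"
  shows "finite {(A, w). trail src tgt v A w \<and> A \<subseteq> E \<and> card A = L} \<and>
    card {(A, w). trail src tgt v A w \<and> A \<subseteq> E \<and> card A = L} \<le> 4 ^ L"
proof (induction L)
  case 0
  have "{(A, w). trail src tgt v A w \<and> A \<subseteq> E \<and> card A = 0} \<subseteq> {({}, v)}"
  proof clarify
    fix A w assume "trail src tgt v A w" "A \<subseteq> E" "card A = 0"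
    then show "A = {} \<and> w = v" using E finite_subset[of A E] by (auto elim: trail.cases)
  qed
  from finite_subset[OF this] card_mono[OF _ this] show ?case by simp
next
  case (Suc L)
  let ?T = "\<lambda>L. {(A, w). trail src tgt v A w \<and> A \<subseteq> E \<and> card A = L}"
  let ?S = "Sigma (?T L) (\<lambda>p. {e\<in>E. src e = snd p})"
  let ?f = "\<lambda>(p, e). (insert e (fst p), tgt e)"
  have sub: "?T (Suc L) \<subseteq> ?f ` ?S"
  proof clarify
    fix A w assume A: "trail src tgt v A w" "A \<subseteq> E" "card A = Suc L"
    from A(1) show "(A, w) \<in> ?f ` ?S"
    proof cases
      case empty
      then show ?thesis using A by simp
    next
      case (extend A' w' e)
      have "finite A'" using trail_balance[OF extend(3)] by blast
      then have "card A' = L" using A extend by simp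
      then have "((A', w'), e) \<in> ?S" using A extend by auto
      then show ?thesis using extend by (auto intro!: image_eqI[of _ _ "((A', w'), e)"])
    qed
  qed
  have fS: "finite ?S" using Suc E by (intro finite_SigmaI) auto
  have "card (?T (Suc L)) \<le> card (?f ` ?S)" by (rule card_mono[OF _ sub]) (use fS in blast)
  also have "\<dots> \<le> card ?S" by (rule card_image_le[OF fS])
  also have "\<dots> = (\<Sum>p\<in>?T L. card {e\<in>E. src e = snd p})" by (rule card_SigmaI) (use Suc E in auto)
  also have "\<dots> \<le> (\<Sum>p\<in>?T L. 4)" by (rule sum_mono) (rule deg)
  also have "\<dots> \<le> 4 ^ Suc L" using Suc by simp
  finally show ?case using finite_subset[OF sub] fS by blast
qed

lemma card_mincirc:
  assumes E: "finite E" and deg: "\<And>w. card {e\<in>E. src e = w} \<le> 4"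
  shows "card {C. mincirc src tgt C \<and> C \<subseteq> E \<and> card C = L \<and> v \<in> src ` C} \<le> 4 ^ L"
proof -
  let ?T = "{(A, w). trail src tgt v A w \<and> A \<subseteq> E \<and> card A = L}"
  have "(\<lambda>C. (C, v)) ` {C. mincirc src tgt C \<and> C \<subseteq> E \<and> card C = L \<and> v \<in> src ` C} \<subseteq> ?T"
    using mincirc_trail by fastforce
  then have "card ((\<lambda>C. (C, v)) ` {C. mincirc src tgt C \<and> C \<subseteq> E \<and> card C = L \<and> v \<in> src ` C}) \<le> card ?T"
    using card_trails[OF E deg] by (intro card_mono) auto
  then show ?thesis using card_trails[OF E deg, where tgt = tgt and v = v and L = L] by (subst (asm) card_image) (auto simp: inj_on_def)
qed

text \<open>Sorting by length: a member of length L is a closed trail from one of at most r L roots,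
  giving r L * 4^L of them. The set of roots may grow with L, since a longer contour can lie further
  from its reference site.\<close>

lemma sum_mincirc_le:
  fixes q :: real
  assumes E: "finite E" and deg: "\<And>w. card {e\<in>E. src e = w} \<le> 4"
    and fam: "\<And>C. C \<in> \<C> \<Longrightarrow> mincirc src tgt C \<and> C \<subseteq> E \<and> (\<exists>v\<in>R (card C). v \<in> src ` C)"
    and len: "\<And>C. C \<in> \<C> \<Longrightarrow> l \<le> card C"
    and R: "\<And>L. finite (R L)" "\<And>L. card (R L) \<le> r L" and q: "q \<ge> 0"
  shows "(\<Sum>C\<in>\<C>. q ^ card C) \<le> (\<Sum>L\<in>{l..card E}. real (r L) * (4 * q) ^ L)"
proof -
  have fin: "finite \<C>" by (rule finite_subset[of _ "Pow E"]) (use fam E in auto)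
  have le: "card C \<in> {l..card E}" if "C \<in> \<C>" for C
    using fam[OF that] len[OF that] card_mono[OF E] by auto
  have "(\<Sum>C\<in>\<C>. q ^ card C) = (\<Sum>L\<in>{l..card E}. \<Sum>C\<in>{C\<in>\<C>. card C = L}. q ^ card C)"
    by (rule sum.group[symmetric]) (use fin le in auto)
  also have "\<dots> \<le> (\<Sum>L\<in>{l..card E}. real (r L) * (4 * q) ^ L)"
  proof (rule sum_mono)
    fix L
    let ?M = "\<lambda>v. {C. mincirc src tgt C \<and> C \<subseteq> E \<and> card C = L \<and> v \<in> src ` C}"
    have finM: "finite (?M v)" for v by (rule finite_subset[of _ "Pow E"]) (use E in auto)
    have "card {C\<in>\<C>. card C = L} \<le> card (\<Union>v\<in>R L. ?M v)"
      by (rule card_mono) (use R finM fam in \<open>auto simp: image_iff\<close>)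
    also have "\<dots> \<le> (\<Sum>v\<in>R L. card (?M v))" by (rule card_UN_le[OF R(1)])
    also have "\<dots> \<le> (\<Sum>v\<in>R L. 4 ^ L)" by (rule sum_mono) (rule card_mincirc[OF E deg])
    also have "\<dots> \<le> r L * 4 ^ L" using R(2)[of L] by simp
    finally have "real (card {C\<in>\<C>. card C = L}) \<le> real (r L * 4 ^ L)" by linarith
    then have "real (card {C\<in>\<C>. card C = L}) * q ^ L \<le> real (r L * 4 ^ L) * q ^ L" using q by (intro mult_right_mono) auto
    moreover have "(\<Sum>C\<in>{C\<in>\<C>. card C = L}. q ^ card C) = real (card {C\<in>\<C>. card C = L}) * q ^ L" by simp
    ultimately show "(\<Sum>C\<in>{C\<in>\<C>. card C = L}. q ^ card C) \<le> real (r L) * (4 * q) ^ L"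
      by (simp add: power_mult_distrib mult_ac)
  qed
  finally show ?thesis .
qed

text \<open>Peeling off a minimal circulation gives \<open>Z - 1 \<le> X * Z\<close> for the generating function \<open>Z\<close>.\<close>
lemma sum_circ_le:
  fixes q X :: real and Q :: "'e set \<Rightarrow> bool" and src tgt :: "'e \<Rightarrow> 'v" and E :: "'e set"
  defines "\<C> \<equiv> {C. mincirc src tgt C \<and> C \<subseteq> E \<and> Q C}"
    and "\<F> \<equiv> {F. circ src tgt F \<and> F \<subseteq> E \<and> (\<forall>C\<subseteq>F. mincirc src tgt C \<longrightarrow> Q C)}"
  assumes E: "finite E" and q: "q \<ge> 0" and X: "(\<Sum>C\<in>\<C>. q ^ card C) \<le> X" "X < 1"
  shows "(\<Sum>F\<in>\<F> - {{}}. q ^ card F) \<le> X / (1 - X)"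
proof -
  have finC: "finite \<C>" and finF: "finite \<F>"
    by (rule finite_subset[of _ "Pow E"]; use E in \<open>auto simp: \<C>_def \<F>_def\<close>)+
  define Z where "Z = (\<Sum>F\<in>\<F>. q ^ card F)"
  define Z' where "Z' = (\<Sum>F\<in>\<F> - {{}}. q ^ card F)"
  have emp: "{} \<in> \<F>" by (auto simp: \<F>_def circ_def mincirc_def)
  have ZZ: "Z = 1 + Z'" unfolding Z_def Z'_def using sum.remove[OF finF emp, of "\<lambda>F. q ^ card F"] by simp
  have Z0: "Z \<ge> 0" unfolding Z_def by (intro sum_nonneg) (use q in auto)
  \<comment> \<open>Removing a minimal circulation stays in the family, because sub-circulations of
    the rest are sub-circulations of F.\<close>
  have pick: "\<exists>C\<in>\<C>. C \<subseteq> F \<and> F - C \<in> \<F>" if "F \<in> \<F> - {{}}" for F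
  proof -
    have F: "circ src tgt F" "F \<noteq> {}" "F \<subseteq> E" and Q: "\<forall>C\<subseteq>F. mincirc src tgt C \<longrightarrow> Q C"
      using that by (auto simp: \<F>_def)
    obtain C where C: "C \<subseteq> F" "mincirc src tgt C" using ex_mincirc[OF F(1,2)] by blast
    then have "circ src tgt (F - C)" by (intro circ_diff F) (auto simp: mincirc_def)
    then show ?thesis using C F Q by (intro bexI[of _ C]) (auto simp: \<C>_def \<F>_def)
  qed
  define c where "c = (\<lambda>F. SOME C. C \<in> \<C> \<and> C \<subseteq> F \<and> F - C \<in> \<F>)"
  have c: "c F \<in> \<C> \<and> c F \<subseteq> F \<and> F - c F \<in> \<F>" if "F \<in> \<F> - {{}}" for F
    unfolding c_def by (rule someI_ex) (use pick[OF that] in blast)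
  have "Z' = (\<Sum>F\<in>\<F> - {{}}. q ^ card (c F) * q ^ card (F - c F))"
    unfolding Z'_def
  proof (rule sum.cong)
    fix F assume F: "F \<in> \<F> - {{}}"
    have "finite F" using F E finite_subset by (auto simp: \<F>_def)
    then have "card F = card (c F) + card (F - c F)"
      using c[OF F] by (metis card_Diff_subset card_mono finite_subset le_add_diff_inverse)
    then show "q ^ card F = q ^ card (c F) * q ^ card (F - c F)" by (simp add: power_add)
  qed simp
  also have "\<dots> = (\<Sum>p\<in>(\<lambda>F. (c F, F - c F)) ` (\<F> - {{}}). q ^ card (fst p) * q ^ card (snd p))"
  proof (subst sum.reindex)
    show "inj_on (\<lambda>F. (c F, F - c F)) (\<F> - {{}})"
    proof (rule inj_onI)
      fix F G assume FG: "F \<in> \<F> - {{}}" "G \<in> \<F> - {{}}" "(c F, F - c F) = (c G, G - c G)"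
      then show "F = G" using c[OF FG(1)] c[OF FG(2)] by (metis Diff_partition Pair_inject)
    qed
  qed simp
  also have "\<dots> \<le> (\<Sum>p\<in>\<C> \<times> \<F>. q ^ card (fst p) * q ^ card (snd p))"
    by (rule sum_mono2) (use finC finF c q in auto)
  also have "\<dots> = (\<Sum>C\<in>\<C>. q ^ card C) * Z"
    unfolding Z_def sum_product sum.cartesian_product by (simp add: case_prod_unfold)
  also have "\<dots> \<le> X * Z" by (rule mult_right_mono[OF X(1) Z0])
  finally have "Z' \<le> X * (1 + Z')" unfolding ZZ .
  then show ?thesis unfolding Z'_def[symmetric] using X(2) by (simp add: field_simps)
qed


section \<open>Contours on the torus\<close>

text \<open>A dual arc is a primal edge together with a direction in which it is crossed: \<open>(s, HR)\<close>
  crosses the edge from \<open>s\<close> to its right neighbour, \<open>(s, HL)\<close> the same edge backwards, and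
  \<open>VU\<close>, \<open>VD\<close> do the same for the edge between \<open>s\<close> and its upper neighbour. The plaquette with
  lower left corner \<open>s\<close> is named \<open>s\<close>; an arc keeps the start of the crossing on its left.\<close>
datatype crossing = HR | HL | VU | VD

lemma UNIV_crossing: "UNIV = {HR, HL, VU, VD}"
proof -
  have "c \<in> {HR, HL, VU, VD}" for c by (cases c) auto
  then show ?thesis by blast
qed

definition asrc :: "nat \<Rightarrow> site \<times> crossing \<Rightarrow> site" where
  "asrc N e = (case snd e of HR \<Rightarrow> dn N (fst e) | HL \<Rightarrow> fst e | VU \<Rightarrow> fst e | VD \<Rightarrow> lf N (fst e))"

definition atgt :: "nat \<Rightarrow> site \<times> crossing \<Rightarrow> site" where
  "atgt N e = (case snd e of HR \<Rightarrow> fst e | HL \<Rightarrow> dn N (fst e) | VU \<Rightarrow> lf N (fst e) | VD \<Rightarrow> fst e)"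

abbreviation Arcs :: "nat \<Rightarrow> (site \<times> crossing) set" where
  "Arcs N \<equiv> Lam N \<times> UNIV"

abbreviation tcirc :: "nat \<Rightarrow> (site \<times> crossing) set \<Rightarrow> bool" where
  "tcirc N \<equiv> circ (asrc N) (atgt N)"

abbreviation tmincirc :: "nat \<Rightarrow> (site \<times> crossing) set \<Rightarrow> bool" where
  "tmincirc N \<equiv> mincirc (asrc N) (atgt N)"

text \<open>Net signed crossing of a primal edge: a set of arcs becomes an integer 1-form on the
  primal lattice, in which opposite arcs cancel.\<close>

definition hflow :: "(site \<times> crossing) set \<Rightarrow> site \<Rightarrow> int" where
  "hflow F s = of_bool ((s, HR) \<in> F) - of_bool ((s, HL) \<in> F)"

definition vflow :: "(site \<times> crossing) set \<Rightarrow> site \<Rightarrow> int" where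
  "vflow F s = of_bool ((s, VU) \<in> F) - of_bool ((s, VD) \<in> F)"

lemma finite_Arcs: "finite (Arcs N)"
  by (simp add: UNIV_crossing)

lemma out_arcs:
  assumes "F \<subseteq> Arcs N" "w \<in> Lam N"
  shows "{e\<in>F. asrc N e = w} = F \<inter> {(up N w, HR), (w, HL), (w, VU), (rt N w, VD)}"
proof -
  have "asrc N e = w \<longleftrightarrow> e \<in> {(up N w, HR), (w, HL), (w, VU), (rt N w, VD)}" if "e \<in> F" for e
  proof -
    have "fst e \<in> Lam N" using that assms by auto
    then show ?thesis using assms(2) nbr_inverse
      by (cases e; cases "snd e") (auto simp: asrc_def)
  qed
  then show ?thesis by auto
qed

lemma in_arcs:
  assumes "F \<subseteq> Arcs N" "w \<in> Lam N"
  shows "{e\<in>F. atgt N e = w} = F \<inter> {(w, HR), (up N w, HL), (rt N w, VU), (w, VD)}"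
proof -
  have "atgt N e = w \<longleftrightarrow> e \<in> {(w, HR), (up N w, HL), (rt N w, VU), (w, VD)}" if "e \<in> F" for e
  proof -
    have "fst e \<in> Lam N" using that assms by auto
    then show ?thesis using assms(2) nbr_inverse
      by (cases e; cases "snd e") (auto simp: atgt_def)
  qed
  then show ?thesis by auto
qed

lemma arc_ends_in_Lam:
  assumes "e \<in> Arcs N"
  shows "asrc N e \<in> Lam N" "atgt N e \<in> Lam N"
  using assms by (cases "snd e"; auto simp: asrc_def atgt_def)+

lemma card_out_arcs: "card {e\<in>Arcs N. asrc N e = w} \<le> 4"
proof (cases "w \<in> Lam N")
  case True
  have "card {e\<in>Arcs N. asrc N e = w} \<le> card {(up N w, HR), (w, HL), (w, VU), (rt N w, VD)}"
    unfolding out_arcs[OF subset_refl True] by (rule card_mono) auto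
  also have "\<dots> \<le> 4" by (simp add: card_insert_if)
  finally show ?thesis .
next
  case False
  then have "{e\<in>Arcs N. asrc N e = w} = {}" using arc_ends_in_Lam by blast
  then show ?thesis by (simp only: card.empty)
qed

lemma card_Int_4:
  assumes "distinct [a, b, c, d]"
  shows "card (F \<inter> {a, b, c, d}) = of_bool (a \<in> F) + of_bool (b \<in> F) + of_bool (c \<in> F) + of_bool (d \<in> F)"
  using assms by (simp add: Int_insert_right card_insert_if)

text \<open>Balance at the dual vertex w says that the 1-form (\<open>hflow\<close>,
  \<open>vflow\<close>) has no curl around the plaquette w.\<close>

lemma tcirc_iff:
  assumes F: "F \<subseteq> Arcs N"
  shows "tcirc N F \<longleftrightarrow> (\<forall>w\<in>Lam N. hflow F (up N w) + vflow F w = hflow F w + vflow F (rt N w))"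
proof -
  have fin: "finite F" using F finite_Arcs finite_subset by blast
  have out: "{e\<in>F. asrc N e = w} = {}" "{e\<in>F. atgt N e = w} = {}" if "w \<notin> Lam N" for w
    using that F arc_ends_in_Lam by blast+
  have eq: "card {e\<in>F. asrc N e = w} = card {e\<in>F. atgt N e = w} \<longleftrightarrow> hflow F (up N w) + vflow F w = hflow F w + vflow F (rt N w)"
    if w: "w \<in> Lam N" for w
  proof -
    have 1: "int (card {e\<in>F. asrc N e = w}) = of_bool ((up N w, HR) \<in> F) + of_bool ((w, HL) \<in> F) + of_bool ((w, VU) \<in> F) + of_bool ((rt N w, VD) \<in> F)"
      unfolding out_arcs[OF F w] by (subst card_Int_4) auto
    have 2: "int (card {e\<in>F. atgt N e = w}) = of_bool ((w, HR) \<in> F) + of_bool ((up N w, HL) \<in> F) + of_bool ((rt N w, VU) \<in> F) + of_bool ((w, VD) \<in> F)"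
      unfolding in_arcs[OF F w] by (subst card_Int_4) auto
    have "card {e\<in>F. asrc N e = w} = card {e\<in>F. atgt N e = w} \<longleftrightarrow> int (card {e\<in>F. asrc N e = w}) = int (card {e\<in>F. atgt N e = w})"
      by simp
    then show ?thesis unfolding 1 2 hflow_def vflow_def by linarith
  qed
  have "(\<forall>w. card {e\<in>F. asrc N e = w} = card {e\<in>F. atgt N e = w}) \<longleftrightarrow> (\<forall>w\<in>Lam N. card {e\<in>F. asrc N e = w} = card {e\<in>F. atgt N e = w})"
  proof (intro iffI allI ballI)
    fix w assume A: "\<forall>w\<in>Lam N. card {e\<in>F. asrc N e = w} = card {e\<in>F. atgt N e = w}"
    show "card {e\<in>F. asrc N e = w} = card {e\<in>F. atgt N e = w}"
    proof (cases "w \<in> Lam N")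
      case True
      then show ?thesis using A by blast
    next
      case False
      show ?thesis unfolding out[OF False] ..
    qed
  qed blast
  then show ?thesis unfolding circ_def using fin eq by simp
qed

section \<open>Periods and potentials of closed 1-forms\<close>

lemma sum_cyclic:
  fixes f :: "nat \<Rightarrow> 'a::comm_monoid_add"
  shows "(\<Sum>y<N. f ((y + 1) mod N)) = (\<Sum>y<N. f y)"
proof (cases N)
  case (Suc M)
  have "(\<Sum>y<N. f ((y + 1) mod N)) = (\<Sum>y<M. f ((y + 1) mod N)) + f 0" unfolding Suc by simp
  also have "(\<Sum>y<M. f ((y + 1) mod N)) = (\<Sum>y<M. f (Suc y))" by (rule sum.cong) (auto simp: Suc)
  finally show ?thesis unfolding Suc sum.lessThan_Suc_shift by (simp add: add.commute)
qed simp

lemma partial_sum_cyclic: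
  fixes f :: "nat \<Rightarrow> int"
  assumes "(\<Sum>k<N. f k) = 0" "x < N"
  shows "(\<Sum>k<(x + 1) mod N. f k) - (\<Sum>k<x. f k) = f x"
proof (cases "x + 1 = N")
  case True
  then have "(\<Sum>k<x. f k) + f x = 0" using assms(1) by (metis Suc_eq_plus1 sum.lessThan_Suc)
  moreover have "(x + 1) mod N = 0" using True by simp
  ultimately show ?thesis by simp
next
  case False
  then have "(x + 1) mod N = Suc x" using assms by simp
  then show ?thesis by simp
qed

text \<open>The periods of a closed form along parallel lines agree: when the curl condition is
  added up over the strip between two neighbouring lines, the transverse terms cancel
  cyclically.\<close>

lemma row_sum_const:
  fixes h v :: "site \<Rightarrow> int"
  assumes curl: "\<And>w. w \<in> Lam N \<Longrightarrow> h (up N w) + v w = h w + v (rt N w)"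
  shows "y < N \<Longrightarrow> (\<Sum>x<N. h (x, y)) = (\<Sum>x<N. h (x, 0))"
    and "x < N \<Longrightarrow> (\<Sum>y<N. v (x, y)) = (\<Sum>y<N. v (0, y))"
proof -
  show "(\<Sum>x<N. h (x, y)) = (\<Sum>x<N. h (x, 0))" if "y < N"
    using that
  proof (induction y)
    case (Suc y)
    have "(\<Sum>x<N. h (x, Suc y)) + (\<Sum>x<N. v (x, y)) = (\<Sum>x<N. h (x, y)) + (\<Sum>x<N. v ((x + 1) mod N, y))"
      unfolding sum.distrib[symmetric]
    proof (rule sum.cong)
      fix x assume "x \<in> {..<N}"
      then show "h (x, Suc y) + v (x, y) = h (x, y) + v ((x + 1) mod N, y)"
        using curl[of "(x, y)"] Suc.prems by (simp add: Lam_def up_def rt_def)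
    qed simp
    then show ?case using Suc sum_cyclic[of "\<lambda>x. v (x, y)" N] by simp
  qed simp
  show "(\<Sum>y<N. v (x, y)) = (\<Sum>y<N. v (0, y))" if "x < N"
    using that
  proof (induction x)
    case (Suc x)
    have "(\<Sum>y<N. v (x, y)) + (\<Sum>y<N. h (x, (y + 1) mod N)) = (\<Sum>y<N. v (Suc x, y)) + (\<Sum>y<N. h (x, y))"
      unfolding sum.distrib[symmetric]
    proof (rule sum.cong)
      fix y assume "y \<in> {..<N}"
      then show "v (x, y) + h (x, (y + 1) mod N) = v (Suc x, y) + h (x, y)"
        using curl[of "(x, y)"] Suc.prems by (simp add: Lam_def up_def rt_def)
    qed simp
    then show ?case using Suc sum_cyclic[of "\<lambda>y. h (x, y)" N] by simp
  qed simp
qed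

text \<open>Integration along the bottom row and then up the column. Closedness makes the horizontal
  differences right at every height, and vanishing of the two periods makes the values fit at the
  seams. The minus signs reflect that the form is u at the start minus u at the end of an
  edge.\<close>

lemma ex_potential:
  fixes h v :: "site \<Rightarrow> int"
  assumes curl: "\<And>w. w \<in> Lam N \<Longrightarrow> h (up N w) + v w = h w + v (rt N w)"
    and row: "(\<Sum>x<N. h (x, 0)) = 0" and col: "(\<Sum>y<N. v (0, y)) = 0"
  shows "\<exists>u. \<forall>s\<in>Lam N. u s - u (rt N s) = h s \<and> u s - u (up N s) = v s"
proof -
  define u where "u = (\<lambda>(x, y). - (\<Sum>k<x. h (k, 0)) - (\<Sum>k<y. v (x, k)))"
  have "u s - u (rt N s) = h s \<and> u s - u (up N s) = v s" if s: "s \<in> Lam N" for s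
  proof -
    obtain x y where xy: "s = (x, y)" "x < N" "y < N" using s by (auto simp: Lam_def)
    have "(\<Sum>k<(y + 1) mod N. v (x, k)) - (\<Sum>k<y. v (x, k)) = v (x, y)"
      by (rule partial_sum_cyclic) (use xy row_sum_const(2)[OF curl] col in auto)
    moreover have "(\<Sum>k<(x + 1) mod N. h (k, 0)) - (\<Sum>k<x. h (k, 0)) = h (x, 0)"
      by (rule partial_sum_cyclic[OF row xy(2)])
    moreover have "(\<Sum>k<y. v ((x + 1) mod N, k)) - (\<Sum>k<y. v (x, k)) = h (x, y) - h (x, 0)"
    proof -
      have "(\<Sum>k<y. v ((x + 1) mod N, k)) - (\<Sum>k<y. v (x, k)) = (\<Sum>k<y. h (x, Suc k) - h (x, k))"
        unfolding sum_subtractf[symmetric]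
      proof (rule sum.cong)
        fix k assume "k \<in> {..<y}"
        then show "v ((x + 1) mod N, k) - v (x, k) = h (x, Suc k) - h (x, k)"
          using curl[of "(x, k)"] xy by (simp add: Lam_def up_def rt_def)
      qed simp
      then show ?thesis using sum_lessThan_telescope[of "\<lambda>k. h (x, k)" y] by simp
    qed
    ultimately show ?thesis unfolding xy u_def rt_def up_def by simp
  qed
  then show ?thesis by blast
qed

section \<open>Contours as boundaries of site sets\<close>

definition bd :: "nat \<Rightarrow> site set \<Rightarrow> (site \<times> crossing) set" where
  "bd N S = {(s, c). s \<in> Lam N \<and> (case c of HR \<Rightarrow> s \<in> S \<and> rt N s \<notin> S | HL \<Rightarrow> s \<notin> S \<and> rt N s \<in> S
     | VU \<Rightarrow> s \<in> S \<and> up N s \<notin> S | VD \<Rightarrow> s \<notin> S \<and> up N s \<in> S)}"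

lemma bd_iff [simp]:
  "(s, HR) \<in> bd N S \<longleftrightarrow> s \<in> Lam N \<and> s \<in> S \<and> rt N s \<notin> S"
  "(s, HL) \<in> bd N S \<longleftrightarrow> s \<in> Lam N \<and> s \<notin> S \<and> rt N s \<in> S"
  "(s, VU) \<in> bd N S \<longleftrightarrow> s \<in> Lam N \<and> s \<in> S \<and> up N s \<notin> S"
  "(s, VD) \<in> bd N S \<longleftrightarrow> s \<in> Lam N \<and> s \<notin> S \<and> up N s \<in> S"
  by (auto simp: bd_def)

lemma bd_subset_Arcs: "bd N S \<subseteq> Arcs N"
  by (auto simp: bd_def)

lemma finite_bd [simp]: "finite (bd N S)"
  using finite_subset[OF bd_subset_Arcs finite_Arcs] .

lemma flow_bd:
  assumes "s \<in> Lam N"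
  shows "hflow (bd N S) s = of_bool (s \<in> S) - of_bool (rt N s \<in> S)"
    "vflow (bd N S) s = of_bool (s \<in> S) - of_bool (up N s \<in> S)"
  using assms by (auto simp: hflow_def vflow_def)

lemma tcirc_bd: "tcirc N (bd N S)"
  unfolding tcirc_iff[OF bd_subset_Arcs] by (auto simp: flow_bd rt_up_commute)

text \<open>Where the boundary of a superlevel set is crossed outwards u drops, so the net flow of F
  is positive there; as it is a difference of two indicators, F contains the arc with this very
  orientation.\<close>

lemma bd_level_set:
  assumes "\<And>s. s \<in> Lam N \<Longrightarrow> u s - u (rt N s) = hflow F s \<and> u s - u (up N s) = vflow F s"
  shows "bd N {s \<in> Lam N. u s \<ge> c} \<subseteq> F"
proof
  fix e assume e: "e \<in> bd N {s \<in> Lam N. u s \<ge> c}"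
  obtain s d where sd: "e = (s, d)" by (cases e)
  have s: "s \<in> Lam N" using e sd by (auto simp: bd_def)
  have out: "P" if "(x - y::int) = of_bool P - of_bool Q" "x \<ge> c" "\<not> y \<ge> c" for x y P Q
    using that by (cases P; cases Q) auto
  have inw: "Q" if "(x - y::int) = of_bool P - of_bool Q" "\<not> x \<ge> c" "y \<ge> c" for x y P Q
    using that by (cases P; cases Q) auto
  have h: "u s - u (rt N s) = of_bool ((s, HR) \<in> F) - of_bool ((s, HL) \<in> F)"
    and v: "u s - u (up N s) = of_bool ((s, VU) \<in> F) - of_bool ((s, VD) \<in> F)"
    using assms[OF s] by (auto simp: hflow_def vflow_def)
  show "e \<in> F"
  proof (cases d)
    case HR
    then have "u s \<ge> c" "\<not> u (rt N s) \<ge> c" using e s sd by auto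
    from out[OF h this] show ?thesis using HR sd by simp
  next
    case HL
    then have "\<not> u s \<ge> c" "u (rt N s) \<ge> c" using e s sd by auto
    from inw[OF h this] show ?thesis using HL sd by simp
  next
    case VU
    then have "u s \<ge> c" "\<not> u (up N s) \<ge> c" using e s sd by auto
    from out[OF v this] show ?thesis using VU sd by simp
  next
    case VD
    then have "\<not> u s \<ge> c" "u (up N s) \<ge> c" using e s sd by auto
    from inw[OF v this] show ?thesis using VD sd by simp
  qed
qed

text \<open>One of the two periods is nonzero. For a circulation, constancy along parallel lines
  makes it enough to test row 0 and column 0.\<close>

definition noncontractible :: "nat \<Rightarrow> (site \<times> crossing) set \<Rightarrow> bool" where
  "noncontractible N F \<longleftrightarrow> (\<Sum>x<N. hflow F (x, 0)) \<noteq> 0 \<or> (\<Sum>y<N. vflow F (0, y)) \<noteq> 0"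

text \<open>\<open>S\<close> is chosen with the shortest boundary. A contractible minimal C in that
  boundary has a potential u, and the indicator of S minus u is a potential of the remaining arcs.
  The two potentials add up to the indicator, so at least one of them is larger at i than at j, and
  a level set of it separates i from j with boundary in C or in the rest. The second case
  contradicts the choice of S, the first forces C to be the whole boundary.\<close>

lemma contour_dichotomy:
  assumes ij: "i \<in> Lam N" "j \<in> Lam N" "i \<in> A" "j \<notin> A"
  shows "\<exists>S\<subseteq>Lam N. i \<in> S \<and> j \<notin> S \<and> bd N S \<subseteq> bd N A \<and>
    (tmincirc N (bd N S) \<or> (\<forall>C\<subseteq>bd N S. tmincirc N C \<longrightarrow> noncontractible N C))"
proof -
  let ?P = "\<lambda>S. S \<subseteq> Lam N \<and> i \<in> S \<and> j \<notin> S \<and> bd N S \<subseteq> bd N A"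
  have "?P (A \<inter> Lam N)" using ij by (auto simp: bd_def split: crossing.splits)
  then obtain S where S: "?P S" and least: "\<And>T. ?P T \<Longrightarrow> card (bd N S) \<le> card (bd N T)"
    using ex_has_least_nat[of ?P "A \<inter> Lam N" "\<lambda>S. card (bd N S)"] by blast
  have "tmincirc N (bd N S)" if C: "C \<subseteq> bd N S" "tmincirc N C" "\<not> noncontractible N C" for C
  proof -
    have CA: "C \<subseteq> Arcs N" using C(1) bd_subset_Arcs by blast
    have cC: "tcirc N C" and ne: "C \<noteq> {}" using C(2) by (auto simp: mincirc_def)
    have curl: "\<And>w. w \<in> Lam N \<Longrightarrow> hflow C (up N w) + vflow C w = hflow C w + vflow C (rt N w)"
      using cC unfolding tcirc_iff[OF CA] by blast
    obtain u where u: "\<And>s. s \<in> Lam N \<Longrightarrow> u s - u (rt N s) = hflow C s \<and> u s - u (up N s) = vflow C s"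
      using ex_potential[OF curl] C(3) unfolding noncontractible_def by blast
    define w where "w = (\<lambda>s. of_bool (s \<in> S) - u s)"
    have w: "w s - w (rt N s) = hflow (bd N S - C) s \<and> w s - w (up N s) = vflow (bd N S - C) s" if s: "s \<in> Lam N" for s
    proof -
      have "hflow (bd N S - C) s = hflow (bd N S) s - hflow C s" "vflow (bd N S - C) s = vflow (bd N S) s - vflow C s"
        using C(1) unfolding hflow_def vflow_def by auto
      then show ?thesis using u[OF s] by (simp add: w_def flow_bd[OF s])
    qed
    show ?thesis
    proof (cases "u i > u j")
      case True
      let ?T = "{s \<in> Lam N. u s \<ge> u i}"
      have T: "bd N ?T \<subseteq> C" by (rule bd_level_set[OF u])
      then have "?P ?T" using ij True S C(1) by auto
      then have "card (bd N S) \<le> card (bd N ?T)" by (rule least)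
      also have "\<dots> \<le> card C" by (rule card_mono[OF finite_subset[OF C(1) finite_bd] T])
      finally have "C = bd N S" using C(1) by (intro card_seteq) auto
      then show ?thesis using C(2) by simp
    next
      case False
      let ?T = "{s \<in> Lam N. w s \<ge> w i}"
      have T: "bd N ?T \<subseteq> bd N S - C" by (rule bd_level_set[OF w])
      have "w i > w j" using False S by (simp add: w_def)
      then have "?P ?T" using ij T S by auto
      then have "card (bd N S) \<le> card (bd N ?T)" by (rule least)
      also have "\<dots> \<le> card (bd N S - C)" by (rule card_mono[OF _ T]) auto
      also have "\<dots> < card (bd N S)" using C(1) ne by (intro psubset_card_mono) auto
      finally show ?thesis by simp
    qed
  qed
  then show ?thesis using S by blast
qed

section \<open>Locating a contour relative to i and j\<close>

lemma first_exit:
  fixes P :: "nat \<Rightarrow> bool"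
  assumes "P a" "\<not> P b" "a < N" "b < N"
  shows "\<exists>d<N. (\<forall>e\<le>d. P ((a + e) mod N)) \<and> \<not> P ((a + d + 1) mod N)"
proof -
  define k0 where "k0 = (if a \<le> b then b - a else b + N - a)"
  have k0: "k0 < N \<or> k0 = 0" "(a + k0) mod N = b"
    using assms by (auto simp: k0_def)
  define k where "k = (LEAST k. \<not> P ((a + k) mod N))"
  have k: "\<not> P ((a + k) mod N)" unfolding k_def by (rule LeastI[of _ k0]) (use k0 assms in simp)
  have least: "P ((a + e) mod N)" if "e < k" for e using not_less_Least[of e] that unfolding k_def by blast
  have "k \<le> k0" unfolding k_def by (rule Least_le) (use k0 assms in simp)
  moreover have "k \<noteq> 0" using k assms by (cases k) auto
  ultimately show ?thesis using k least k0 by (intro exI[of _ "k - 1"]) auto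
qed

text \<open>A cyclic line that meets both T and its complement has to leave T and to enter it again,
  so it is crossed in both directions. For \<open>HL\<close> and \<open>VD\<close> the search for an
  exit starts outside T.\<close>

lemma ex_crossing:
  assumes x: "x < N" "x' < N" and y: "y < N" "y' < N"
  shows "(x, y) \<in> T \<Longrightarrow> (x', y) \<notin> T \<Longrightarrow> \<exists>z<N. ((z, y), HR) \<in> bd N T"
    "(x, y) \<in> T \<Longrightarrow> (x', y) \<notin> T \<Longrightarrow> \<exists>z<N. ((z, y), HL) \<in> bd N T"
    "(x, y) \<in> T \<Longrightarrow> (x, y') \<notin> T \<Longrightarrow> \<exists>z<N. ((x, z), VU) \<in> bd N T"
    "(x, y) \<in> T \<Longrightarrow> (x, y') \<notin> T \<Longrightarrow> \<exists>z<N. ((x, z), VD) \<in> bd N T"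
proof -
  have suc: "((a + d) mod N + 1) mod N = (a + d + 1) mod N" for a d by (simp add: mod_simps)
  have lt: "a mod N < N" for a using x by simp
  show "\<exists>z<N. ((z, y), HR) \<in> bd N T" if "(x, y) \<in> T" "(x', y) \<notin> T"
    using first_exit[of "\<lambda>z. (z, y) \<in> T" x x' N] that x y lt suc
    by (auto simp: Lam_def rt_def) (metis lt order_refl)
  show "\<exists>z<N. ((z, y), HL) \<in> bd N T" if "(x, y) \<in> T" "(x', y) \<notin> T"
    using first_exit[of "\<lambda>z. (z, y) \<notin> T" x' x N] that x y lt suc
    by (auto simp: Lam_def rt_def) (metis lt order_refl)
  show "\<exists>z<N. ((x, z), VU) \<in> bd N T" if "(x, y) \<in> T" "(x, y') \<notin> T"
    using first_exit[of "\<lambda>z. (x, z) \<in> T" y y' N] that x y lt suc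
    by (auto simp: Lam_def up_def) (metis lt order_refl)
  show "\<exists>z<N. ((x, z), VD) \<in> bd N T" if "(x, y) \<in> T" "(x, y') \<notin> T"
    using first_exit[of "\<lambda>z. (x, z) \<notin> T" y' y N] that x y lt suc
    by (auto simp: Lam_def up_def) (metis lt order_refl)
qed

lemma add_mod_inj:
  fixes x e e' N :: nat
  assumes "(x + e) mod N = (x + e') mod N" "e < N" "e' < N"
  shows "e = e'"
  using assms
proof (induction e e' rule: linorder_wlog)
  case (le a b)
  then have "N dvd (x + b) - (x + a)" by (intro mod_eq_dvd_iff_nat[THEN iffD1]) auto
  then show ?case using le by (auto dest: dvd_imp_le)
qed simp

text \<open>If \<open>T\<close> avoids a whole row and a whole column, then every column met between \<open>p\<close> and the
  first exit of \<open>T\<close> to the right of \<open>p\<close> contributes an arc to the boundary, so this exit is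
  at distance less than the length of the boundary.\<close>
lemma exit_near:
  assumes p: "p \<in> Lam N" "p \<in> T" and xy0: "x0 < N" "y0 < N"
    and row: "\<And>x. x < N \<Longrightarrow> (x, y0) \<notin> T" and col: "\<And>y. y < N \<Longrightarrow> (x0, y) \<notin> T"
  shows "\<exists>d<card (bd N T). (((fst p + d) mod N, snd p), HR) \<in> bd N T" and "4 \<le> card (bd N T)"
proof -
  obtain x y where xy: "p = (x, y)" "x < N" "y < N" using p by (auto simp: Lam_def)
  obtain d where d: "d < N" "\<And>e. e \<le> d \<Longrightarrow> ((x + e) mod N, y) \<in> T" "((x + d + 1) mod N, y) \<notin> T"
    using first_exit[of "\<lambda>z. (z, y) \<in> T" x x0 N] p xy xy0 col by auto
  have lt: "a mod N < N" for a using xy by simp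
  have "\<exists>z<N. (((x + e) mod N, z), VU) \<in> bd N T" if "e \<le> d" for e
    by (rule ex_crossing(3)[of _ N _ y y0]) (use xy xy0 d(2)[OF that] row lt in auto)
  then obtain f where f: "\<And>e. e \<le> d \<Longrightarrow> (((x + e) mod N, f e), VU) \<in> bd N T" by metis
  have "inj_on (\<lambda>e. (((x + e) mod N, f e), VU)) {..d}"
  proof (rule inj_onI)
    fix e e' assume e: "e \<in> {..d}" "e' \<in> {..d}" "(((x + e) mod N, f e), VU) = (((x + e') mod N, f e'), VU)"
    then show "e = e'" using d(1) by (intro add_mod_inj[of x e N e']) auto
  qed
  then have "card {..d} \<le> card (bd N T)" by (rule card_inj_on_le) (use f in auto)
  then have "d < card (bd N T)" by simp
  moreover have "(((x + d) mod N, y), HR) \<in> bd N T"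
    using d(2)[of d] d(3) xy lt by (auto simp: Lam_def rt_def mod_simps)
  ultimately show "\<exists>d<card (bd N T). (((fst p + d) mod N, snd p), HR) \<in> bd N T" using xy by auto
  \<comment> \<open>The row and the column of p each cross the boundary in both directions, which
    gives four distinct arcs.\<close>
  have pT: "(x, y) \<in> T" "(x0, y) \<notin> T" "(x, y0) \<notin> T" using p xy col row by auto
  obtain z1 z2 z3 z4 where z: "((z1, y), HR) \<in> bd N T" "((z2, y), HL) \<in> bd N T" "((x, z3), VU) \<in> bd N T" "((x, z4), VD) \<in> bd N T"
    using ex_crossing[OF xy(2) xy0(1) xy(3) xy0(2)] pT by metis
  have "card {((z1, y), HR), ((z2, y), HL), ((x, z3), VU), ((x, z4), VD)} \<le> card (bd N T)"
    by (rule card_mono) (use z in auto)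
  then show "4 \<le> card (bd N T)" by simp
qed

text \<open>Taking complements reverses every arc. So when it is the complement of S that avoids a
  row and a column, the same argument applies, based at j instead of i.\<close>

lemma bd_complement:
  "(s, HR) \<in> bd N (- S) \<longleftrightarrow> (s, HL) \<in> bd N S" "card (bd N (- S)) = card (bd N S)"
proof -
  show "(s, HR) \<in> bd N (- S) \<longleftrightarrow> (s, HL) \<in> bd N S" by auto
  define f where "f = (\<lambda>c. case c of HR \<Rightarrow> HL | HL \<Rightarrow> HR | VU \<Rightarrow> VD | VD \<Rightarrow> VU)"
  have ff: "f (f c) = c" for c by (cases c) (auto simp: f_def)
  have fb: "(s, f c) \<in> bd N S \<longleftrightarrow> (s, c) \<in> bd N (- S)" for s c S by (cases c) (auto simp: f_def)
  have "bij_betw (\<lambda>(s, c). (s, f c)) (bd N (- S)) (bd N S)"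
    by (rule bij_betw_byWitness[where f' = "\<lambda>(s, c). (s, f c)"])
       (use ff fb fb[of _ _ "- S"] in auto)
  then show "card (bd N (- S)) = card (bd N S)" by (rule bij_betw_same_card)
qed

lemma long_if_surj:
  assumes "\<And>y. y < N \<Longrightarrow> \<exists>e\<in>F. f e = y" "finite F"
  shows "N \<le> card F"
proof -
  have "{..<N} \<subseteq> f ` F" using assms(1) by fastforce
  then have "card {..<N} \<le> card (f ` F)" using assms(2) by (intro card_mono) auto
  also have "\<dots> \<le> card F" by (rule card_image_le[OF assms(2)])
  finally show ?thesis by simp
qed

text \<open>Three arms of length L: sources of arcs \<open>HR\<close> to the right of i, of arcs
  \<open>HL\<close> to the right of j, and of arcs \<open>VD\<close> above j. The last arm serves
  contours of length at least N.\<close>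

definition roots :: "nat \<Rightarrow> site \<Rightarrow> site \<Rightarrow> nat \<Rightarrow> site set" where
  "roots N i j L = (\<lambda>d. dn N ((fst i + d) mod N, snd i)) ` {..<L} \<union> (\<lambda>d. ((fst j + d) mod N, snd j)) ` {..<L}
     \<union> (\<lambda>d. lf N (fst j, (snd j + d) mod N)) ` {..<L}"

lemma card_roots: "card (roots N i j L) \<le> 3 * L"
proof -
  have "card (f ` {..<L}) \<le> L" for f :: "nat \<Rightarrow> site" using card_image_le[of "{..<L}" f] by simp
  then have "card (f ` {..<L} \<union> g ` {..<L} \<union> h ` {..<L}) \<le> L + L + L" for f g h :: "nat \<Rightarrow> site"
    by (intro order_trans[OF card_Un_le] add_mono)
  from this[of "\<lambda>d. dn N ((fst i + d) mod N, snd i)" "\<lambda>d. ((fst j + d) mod N, snd j)" "\<lambda>d. lf N (fst j, (snd j + d) mod N)"]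
  show ?thesis unfolding roots_def by linarith
qed

text \<open>A contour of length at least N is met on the row of i or on the column of j, and a full
  turn around either fits into an arm of length N. A shorter one misses a full row and a full
  column, on which S is constant; then S or its complement avoids this cross, and an exit lies
  within the length of the contour.\<close>

lemma contour_root:
  assumes N: "N \<ge> 4" and ij: "i \<in> Lam N" "j \<in> Lam N" "i \<in> S" "j \<notin> S"
  shows "4 \<le> card (bd N S) \<and> (\<exists>v\<in>roots N i j (card (bd N S)). v \<in> asrc N ` bd N S)"
proof (cases "N \<le> card (bd N S)")
  case True
  obtain x y where i: "i = (x, y)" "x < N" "y < N" using ij by (auto simp: Lam_def)
  obtain x' y' where j: "j = (x', y')" "x' < N" "y' < N" using ij by (auto simp: Lam_def)
  have lt: "a mod N < N" for a using N by simp
  have "\<exists>v\<in>roots N i j (card (bd N S)). v \<in> asrc N ` bd N S"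
  \<comment> \<open>The corner (x', y), where the row of i meets the column of j, decides which of
    the two lines changes sides.\<close>
  proof (cases "(x', y) \<in> S")
    case False
    then obtain d where d: "d < N" "((x + d) mod N, y) \<in> S" "((x + d + 1) mod N, y) \<notin> S"
      using first_exit[of "\<lambda>z. (z, y) \<in> S" x x' N] ij i j by auto
    then have "(((x + d) mod N, y), HR) \<in> bd N S" using i lt by (auto simp: Lam_def rt_def mod_simps)
    moreover have "asrc N (((x + d) mod N, y), HR) = dn N ((fst i + d) mod N, snd i)" by (simp add: asrc_def i)
    ultimately have "dn N ((fst i + d) mod N, snd i) \<in> asrc N ` bd N S" by (metis imageI)
    moreover have "dn N ((fst i + d) mod N, snd i) \<in> roots N i j (card (bd N S))" using d True by (auto simp: roots_def)
    ultimately show ?thesis by blast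
  next
    case yS: True
    then obtain d where d: "d < N" "(x', (y' + d) mod N) \<notin> S" "(x', (y' + d + 1) mod N) \<in> S"
      using first_exit[of "\<lambda>z. (x', z) \<notin> S" y' y N] ij i j by auto
    then have "((x', (y' + d) mod N), VD) \<in> bd N S" using j lt by (auto simp: Lam_def up_def mod_simps)
    moreover have "asrc N ((x', (y' + d) mod N), VD) = lf N (fst j, (snd j + d) mod N)" by (simp add: asrc_def j)
    ultimately have "lf N (fst j, (snd j + d) mod N) \<in> asrc N ` bd N S" by (metis imageI)
    moreover have "lf N (fst j, (snd j + d) mod N) \<in> roots N i j (card (bd N S))" using d True by (auto simp: roots_def)
    ultimately show ?thesis by blast
  qed
  then show ?thesis using True N by simp
next
  case False
  obtain y0 where y0: "y0 < N" "\<And>e. e \<in> bd N S \<Longrightarrow> snd (fst e) \<noteq> y0"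
    using long_if_surj[of N "bd N S" "\<lambda>e. snd (fst e)"] False by auto
  obtain x0 where x0: "x0 < N" "\<And>e. e \<in> bd N S \<Longrightarrow> fst (fst e) \<noteq> x0"
    using long_if_surj[of N "bd N S" "\<lambda>e. fst (fst e)"] False by auto
  \<comment> \<open>No arc is based in row y0 or in column x0, so S cannot change along either of
    them.\<close>
  have row: "(x, y0) \<in> S \<longleftrightarrow> (x0, y0) \<in> S" if "x < N" for x
    using ex_crossing(1)[of x N x0 y0 y0 S] ex_crossing(1)[of x0 N x y0 y0 S] that x0(1) y0 by fastforce
  have col: "(x0, y) \<in> S \<longleftrightarrow> (x0, y0) \<in> S" if "y < N" for y
    using ex_crossing(3)[of x0 N x0 y y0 S] ex_crossing(3)[of x0 N x0 y0 y S] that x0 y0(1) by fastforce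
  show ?thesis
  proof (cases "(x0, y0) \<in> S")
    case False
    have "\<exists>d<card (bd N S). (((fst i + d) mod N, snd i), HR) \<in> bd N S" and c4: "4 \<le> card (bd N S)"
      by (rule exit_near[OF ij(1,3) x0(1) y0(1)]; use row col False in blast)+
    then obtain d where d: "d < card (bd N S)" "(((fst i + d) mod N, snd i), HR) \<in> bd N S" by blast
    moreover have "asrc N (((fst i + d) mod N, snd i), HR) = dn N ((fst i + d) mod N, snd i)" by (simp add: asrc_def)
    ultimately have "dn N ((fst i + d) mod N, snd i) \<in> asrc N ` bd N S" by (metis imageI)
    moreover have "dn N ((fst i + d) mod N, snd i) \<in> roots N i j (card (bd N S))" using d by (auto simp: roots_def)
    ultimately show ?thesis using c4 by blast
  next
    case True
    have "\<exists>d<card (bd N (- S)). (((fst j + d) mod N, snd j), HR) \<in> bd N (- S)" and c4: "4 \<le> card (bd N (- S))"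
      by (rule exit_near[OF ij(2) _ x0(1) y0(1)]; use row col True ij in blast)+
    then obtain d where d: "d < card (bd N S)" "(((fst j + d) mod N, snd j), HL) \<in> bd N S"
      unfolding bd_complement by blast
    moreover have "asrc N (((fst j + d) mod N, snd j), HL) = ((fst j + d) mod N, snd j)" by (simp add: asrc_def)
    ultimately have "((fst j + d) mod N, snd j) \<in> asrc N ` bd N S" by (metis imageI)
    moreover have "((fst j + d) mod N, snd j) \<in> roots N i j (card (bd N S))" using d by (auto simp: roots_def)
    ultimately show ?thesis using c4 unfolding bd_complement by blast
  qed
qed

lemma flow_nonzero_arc:
  "hflow F s \<noteq> 0 \<Longrightarrow> (s, HR) \<in> F \<or> (s, HL) \<in> F"
  "vflow F s \<noteq> 0 \<Longrightarrow> (s, VU) \<in> F \<or> (s, VD) \<in> F"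
  by (auto simp: hflow_def vflow_def split: if_splits)

lemma circ_tgt_src:
  assumes "circ src tgt F" "e \<in> F"
  shows "tgt e \<in> src ` F"
proof -
  have "card {e'\<in>F. tgt e' = tgt e} > 0" using assms by (auto simp: circ_def card_gt_0_iff)
  then have "card {e'\<in>F. src e' = tgt e} > 0" using assms by (simp add: circ_def)
  then obtain e' where "e' \<in> F" "src e' = tgt e" by (auto simp: card_gt_0_iff)
  then show ?thesis by (metis imageI)
qed

text \<open>A nonzero period is the same for all parallel lines, so C has an arc in each of the N
  lines. In particular it passes through a plaquette of row 0 or of column 0, a root set of size at
  most 2 N that does not involve i or j.\<close>

lemma noncontractible_root:
  assumes C: "C \<subseteq> Arcs N" "tcirc N C" "noncontractible N C"
  shows "N \<le> card C \<and> (\<exists>v\<in>(\<lambda>x. (x, 0)) ` {..<N} \<union> Pair 0 ` {..<N}. v \<in> asrc N ` C)"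
proof -
  have fin: "finite C" using C(1) finite_Arcs finite_subset by blast
  have curl: "\<And>w. w \<in> Lam N \<Longrightarrow> hflow C (up N w) + vflow C w = hflow C w + vflow C (rt N w)"
    using C(2) unfolding tcirc_iff[OF C(1)] by blast
  consider "(\<Sum>x<N. hflow C (x, 0)) \<noteq> 0" | "(\<Sum>y<N. vflow C (0, y)) \<noteq> 0"
    using C(3) unfolding noncontractible_def by blast
  then show ?thesis
  proof cases
    case 1
    have ex: "\<exists>x<N. ((x, y), HR) \<in> C \<or> ((x, y), HL) \<in> C" if "y < N" for y
    proof -
      have "(\<Sum>x<N. hflow C (x, y)) \<noteq> 0" using 1 row_sum_const(1)[OF curl that] by simp
      then obtain x where "x < N" "hflow C (x, y) \<noteq> 0" by (meson lessThan_iff sum.neutral)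
      then show ?thesis using flow_nonzero_arc by blast
    qed
    have "N \<le> card C" by (rule long_if_surj[OF _ fin, where f = "\<lambda>e. snd (fst e)"]) (use ex in \<open>metis fst_conv snd_conv\<close>)
    moreover have "N > 0" using 1 by (cases N) auto
    then obtain x where x: "x < N" "((x, 0), HR) \<in> C \<or> ((x, 0), HL) \<in> C" using ex by blast
    \<comment> \<open>(x, 0) is the source of the \<open>HL\<close> arc but the target of the
      \<open>HR\<close> arc; in a circulation every target is also a source.\<close>
    have "(x, 0) \<in> asrc N ` C"
      using x(2)
    proof
      assume "((x, 0), HR) \<in> C"
      from circ_tgt_src[OF C(2) this] show ?thesis by (simp add: atgt_def)
    next
      assume "((x, 0), HL) \<in> C"
      then show ?thesis by (intro image_eqI[of _ _ "((x, 0), HL)"]) (auto simp: asrc_def)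
    qed
    ultimately show ?thesis using x(1) by blast
  next
    case 2
    have ex: "\<exists>y<N. ((x, y), VU) \<in> C \<or> ((x, y), VD) \<in> C" if "x < N" for x
    proof -
      have "(\<Sum>y<N. vflow C (x, y)) \<noteq> 0" using 2 row_sum_const(2)[OF curl that] by simp
      then obtain y where "y < N" "vflow C (x, y) \<noteq> 0" by (meson lessThan_iff sum.neutral)
      then show ?thesis using flow_nonzero_arc by blast
    qed
    have "N \<le> card C" by (rule long_if_surj[OF _ fin, where f = "\<lambda>e. fst (fst e)"]) (use ex in \<open>metis fst_conv snd_conv\<close>)
    moreover have "N > 0" using 2 by (cases N) auto
    then obtain y where y: "y < N" "((0, y), VU) \<in> C \<or> ((0, y), VD) \<in> C" using ex by blast
    have "(0, y) \<in> asrc N ` C"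
      using y(2)
    proof
      assume "((0, y), VD) \<in> C"
      from circ_tgt_src[OF C(2) this] show ?thesis by (simp add: atgt_def)
    next
      assume "((0, y), VU) \<in> C"
      then show ?thesis by (intro image_eqI[of _ _ "((0, y), VU)"]) (auto simp: asrc_def)
    qed
    ultimately show ?thesis using y(1) by blast
  qed
qed

text \<open>Equal boundaries mean that the difference of the indicators has zero gradient; it is
  constant on the connected torus and 0 at i. So sums over sets S are sums over contours.\<close>

lemma bd_inj:
  assumes "S \<subseteq> Lam N" "S' \<subseteq> Lam N" "i \<in> S" "i \<in> S'" "bd N S = bd N S'"
  shows "S = S'"
proof -
  define u :: "site \<Rightarrow> real" where "u = (\<lambda>s. of_bool (s \<in> S) - of_bool (s \<in> S'))"
  have g: "u s = u (rt N s) \<and> u s = u (up N s)" if s: "s \<in> Lam N" for s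
  proof -
    have h: "of_bool (s \<in> S) - of_bool (rt N s \<in> S) = (of_bool (s \<in> S') - of_bool (rt N s \<in> S') :: int)"
      using flow_bd(1)[OF s, of S] flow_bd(1)[OF s, of S'] assms(5) by simp
    have v: "of_bool (s \<in> S) - of_bool (up N s \<in> S) = (of_bool (s \<in> S') - of_bool (up N s \<in> S') :: int)"
      using flow_bd(2)[OF s, of S] flow_bd(2)[OF s, of S'] assms(5) by simp
    show ?thesis using arg_cong[OF h, of real_of_int] arg_cong[OF v, of real_of_int] by (simp add: u_def)
  qed
  have "u s = 0" if s: "s \<in> Lam N" for s
  proof -
    have "i \<in> Lam N" using assms by auto
    moreover have "\<bar>u s - u (rt N s)\<bar> \<le> 0" "\<bar>u s - u (up N s)\<bar> \<le> 0" if "s \<in> Lam N" for s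
      using g[OF that] by simp_all
    ultimately have "\<bar>u s - u i\<bar> \<le> 4 * real N * 0" using s by (intro gradient_bound)
    then show ?thesis using assms by (simp add: u_def)
  qed
  then have "(of_bool (s \<in> S) :: real) = of_bool (s \<in> S')" if "s \<in> Lam N" for s
    using that unfolding u_def by (metis eq_iff_diff_eq_0)
  then have "s \<in> S \<longleftrightarrow> s \<in> S'" if "s \<in> Lam N" for s
    using that by (metis of_bool_eq_iff)
  then show ?thesis using assms by blast
qed

section \<open>Numerical bounds and the sum over contours\<close>

lemma nat_power_decay:
  fixes y :: real
  assumes y: "0 \<le> y" "y \<le> 1/4"
  shows "real (n + 4) * y ^ (n + 4) \<le> 4 * y ^ 4 * (5/16) ^ n"
proof (induction n)
  case (Suc n)
  \<comment> \<open>The ratio of consecutive terms is (n + 5) / (n + 4) * y <= 5/4 * 1/4 =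
    5/16.\<close>
  have "real (Suc n + 4) \<le> 5/4 * real (n + 4)" by simp
  then have "real (Suc n + 4) * y \<le> (5/4 * real (n + 4)) * (1/4)" using y by (intro mult_mono) auto
  then have "real (Suc n + 4) * y * y ^ (n + 4) \<le> (5/4 * real (n + 4)) * (1/4) * y ^ (n + 4)"
    using y by (intro mult_right_mono) auto
  also have "\<dots> = 5/16 * (real (n + 4) * y ^ (n + 4))" by simp
  also have "\<dots> \<le> 5/16 * (4 * y ^ 4 * (5/16) ^ n)" using Suc by simp
  also have "\<dots> = 4 * y ^ 4 * (5/16) ^ Suc n" by simp
  also have "real (Suc n + 4) * y * y ^ (n + 4) = real (Suc n + 4) * y ^ (Suc n + 4)"
    by (simp only: mult.assoc power_Suc[symmetric] add_Suc)
  finally show ?case .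
qed simp

lemma sum_geometric_le:
  fixes y :: real
  assumes "0 \<le> y" "y < 1"
  shows "(\<Sum>k<n. y ^ k) \<le> 1 / (1 - y)"
proof -
  have "(\<Sum>k<n. y ^ k) * (1 - y) = 1 - y ^ n" by (simp add: one_diff_power_eq mult.commute)
  then have "(\<Sum>k<n. y ^ k) * (1 - y) \<le> 1" using assms by simp
  then show ?thesis using assms by (simp add: field_simps)
qed

lemma sum_atLeast_shift:
  fixes f :: "nat \<Rightarrow> real"
  assumes "\<And>L. f L \<ge> 0"
  shows "(\<Sum>L\<in>{l..m}. f L) \<le> (\<Sum>n<Suc m. f (n + l))"
proof -
  have "{l..m} \<subseteq> (\<lambda>n. n + l) ` {..<Suc m}"
  proof
    fix L assume "L \<in> {l..m}"
    then show "L \<in> (\<lambda>n. n + l) ` {..<Suc m}" by (intro image_eqI[of _ _ "L - l"]) auto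
  qed
  then have "(\<Sum>L\<in>{l..m}. f L) \<le> (\<Sum>L\<in>(\<lambda>n. n + l) ` {..<Suc m}. f L)"
    using assms by (intro sum_mono2) auto
  also have "\<dots> = (\<Sum>n<Suc m. f (n + l))" by (subst sum.reindex) (auto simp: inj_on_def)
  finally show ?thesis .
qed

text \<open>The family consists of the sets whose boundary is a minimal circulation
  (\<open>S1\<close>) and those whose boundary contains only noncontractible ones
  (\<open>S2\<close>). The former are rooted near i or j, the latter are controlled by the
  generating function of unions of long trails.\<close>

theorem contour_sum:
  fixes q :: real
  assumes N: "N \<ge> 4" and ij: "i \<in> Lam N" "j \<in> Lam N" and q: "0 \<le> q" "q \<le> 1/16"
  obtains \<S> where "finite \<S>" "\<And>S. S \<in> \<S> \<Longrightarrow> S \<subseteq> Lam N \<and> i \<in> S \<and> j \<notin> S"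
    "\<And>A. i \<in> A \<Longrightarrow> j \<notin> A \<Longrightarrow> \<exists>S\<in>\<S>. bd N S \<subseteq> bd N A"
    "(\<Sum>S\<in>\<S>. q ^ card (bd N S)) \<le> 480 * 3 ^ 4 * q ^ 4"
proof -
  let ?U = "{S. S \<subseteq> Lam N \<and> i \<in> S \<and> j \<notin> S}"
  define S1 where "S1 = {S\<in>?U. tmincirc N (bd N S)}"
  define S2 where "S2 = {S\<in>?U. \<forall>C\<subseteq>bd N S. tmincirc N C \<longrightarrow> noncontractible N C}"
  define y where "y = 4 * q"
  have y: "0 \<le> y" "y \<le> 1/4" using q by (auto simp: y_def)
  have fU: "finite ?U" by (rule finite_subset[of _ "Pow (Lam N)"]) auto
  have fin: "finite S1" "finite S2" using fU by (auto simp: S1_def S2_def)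
  have inj: "inj_on (bd N) ?U" by (rule inj_onI) (use bd_inj[of _ N _ i] in blast)
  note E = finite_Arcs[of N]

  \<comment> \<open>The 3 L roots contribute the factor 3, the estimate of L y^L a factor 4, and
    16/11 = 1 / (1 - 5/16) sums the geometric series.\<close>
  have sum1: "(\<Sum>S\<in>S1. q ^ card (bd N S)) \<le> 192/11 * y ^ 4"
  proof -
    have "(\<Sum>S\<in>S1. q ^ card (bd N S)) = (\<Sum>C\<in>bd N ` S1. q ^ card C)"
      by (subst sum.reindex) (auto intro: inj_on_subset[OF inj] simp: S1_def)
    also have "\<dots> \<le> (\<Sum>L\<in>{4..card (Arcs N)}. real (3 * L) * (4 * q) ^ L)"
    proof (rule sum_mincirc_le[OF E card_out_arcs, where R = "roots N i j" and tgt = "atgt N"])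
      fix C assume "C \<in> bd N ` S1"
      then obtain S where S: "C = bd N S" "S \<in> S1" by blast
      then have "i \<in> S" "j \<notin> S" "tmincirc N C" by (auto simp: S1_def)
      with contour_root[OF N ij this(1,2)] show "tmincirc N C \<and> C \<subseteq> Arcs N \<and> (\<exists>v\<in>roots N i j (card C). v \<in> asrc N ` C)" "4 \<le> card C"
        using bd_subset_Arcs[of N S] unfolding S(1) by blast+
    qed (use q card_roots in \<open>auto simp: roots_def\<close>)
    also have "\<dots> = 3 * (\<Sum>L\<in>{4..card (Arcs N)}. real L * y ^ L)" by (simp add: y_def sum_distrib_left mult_ac)
    also have "(\<Sum>L\<in>{4..card (Arcs N)}. real L * y ^ L) \<le> (\<Sum>n<Suc (card (Arcs N)). real (n + 4) * y ^ (n + 4))"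
      by (rule sum_atLeast_shift) (use y in auto)
    also have "\<dots> \<le> (\<Sum>n<Suc (card (Arcs N)). 4 * y ^ 4 * (5/16) ^ n)"
      by (rule sum_mono) (rule nat_power_decay[OF y])
    also have "\<dots> = 4 * y ^ 4 * (\<Sum>n<Suc (card (Arcs N)). (5/16) ^ n)" by (simp only: sum_distrib_left)
    also have "\<dots> \<le> 4 * y ^ 4 * (1 / (1 - 5/16))" by (intro mult_left_mono sum_geometric_le) (use y in auto)
    finally show ?thesis by simp
  qed

  let ?C = "{C. tmincirc N C \<and> C \<subseteq> Arcs N \<and> noncontractible N C}"
  let ?F = "{F. tcirc N F \<and> F \<subseteq> Arcs N \<and> (\<forall>C\<subseteq>F. tmincirc N C \<longrightarrow> noncontractible N C)}"
  \<comment> \<open>At most 2 N roots and lengths from N on give 2 N y^N * 4/3, and N y^N <= 4 y^4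
    for N >= 4.\<close>
  have X: "(\<Sum>C\<in>?C. q ^ card C) \<le> 32/3 * y ^ 4"
  proof -
    have "(\<Sum>C\<in>?C. q ^ card C) \<le> (\<Sum>L\<in>{N..card (Arcs N)}. real (2 * N) * (4 * q) ^ L)"
    proof (rule sum_mincirc_le[OF E card_out_arcs, where R = "\<lambda>_. (\<lambda>x. (x, 0)) ` {..<N} \<union> Pair 0 ` {..<N}" and tgt = "atgt N"])
      fix C assume C: "C \<in> ?C"
      then have "tcirc N C" by (simp add: mincirc_def)
      with C noncontractible_root[of C N] show "tmincirc N C \<and> C \<subseteq> Arcs N \<and> (\<exists>v\<in>(\<lambda>x. (x, 0)) ` {..<N} \<union> Pair 0 ` {..<N}. v \<in> asrc N ` C)" "N \<le> card C"
        by blast+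
    next
      have "card ((\<lambda>x. (x, 0::nat)) ` {..<N}) \<le> N" "card (Pair (0::nat) ` {..<N}) \<le> N"
        using card_image_le[of "{..<N}" "\<lambda>x. (x, 0::nat)"] card_image_le[of "{..<N}" "Pair (0::nat)"] by auto
      then show "card ((\<lambda>x. (x, 0)) ` {..<N} \<union> Pair 0 ` {..<N}) \<le> 2 * N"
        using card_Un_le[of "(\<lambda>x. (x, 0::nat)) ` {..<N}" "Pair (0::nat) ` {..<N}"] by linarith
    qed (use q in auto)
    also have "\<dots> = real (2 * N) * (\<Sum>L\<in>{N..card (Arcs N)}. y ^ L)" by (simp only: y_def sum_distrib_left)
    also have "\<dots> \<le> real (2 * N) * (\<Sum>n<Suc (card (Arcs N)). y ^ (n + N))"
      by (intro mult_left_mono sum_atLeast_shift) (use y in auto)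
    also have "(\<Sum>n<Suc (card (Arcs N)). y ^ (n + N)) = y ^ N * (\<Sum>n<Suc (card (Arcs N)). y ^ n)"
      by (simp only: power_add sum_distrib_left mult.commute)
    also have "real (2 * N) * (y ^ N * (\<Sum>n<Suc (card (Arcs N)). y ^ n)) \<le> real (2 * N) * (y ^ N * (4/3))"
    proof (intro mult_left_mono)
      have "(\<Sum>n<Suc (card (Arcs N)). y ^ n) \<le> 1 / (1 - y)" by (rule sum_geometric_le) (use y in auto)
      also have "\<dots> \<le> 4/3" using y by (simp add: field_simps)
      finally show "(\<Sum>n<Suc (card (Arcs N)). y ^ n) \<le> 4/3" .
    qed (use y in auto)
    also have "\<dots> = 8/3 * (real (N - 4 + 4) * y ^ (N - 4 + 4))" using N by simp
    also have "\<dots> \<le> 8/3 * (4 * y ^ 4 * (5/16) ^ (N - 4))"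
      by (intro mult_left_mono nat_power_decay[OF y]) auto
    also have "\<dots> \<le> 8/3 * (4 * y ^ 4 * 1)" by (intro mult_left_mono power_le_one) (use y in auto)
    finally show ?thesis by simp
  qed
  have y4: "y ^ 4 \<le> 1/256" using power_mono[OF y(2,1), of 4] by (simp add: power_divide)
  have y40: "0 \<le> y ^ 4" using y by simp
  have sum2: "(\<Sum>S\<in>S2. q ^ card (bd N S)) \<le> 12 * y ^ 4"
  proof -
    have "(\<Sum>S\<in>S2. q ^ card (bd N S)) = (\<Sum>C\<in>bd N ` S2. q ^ card C)"
      by (subst sum.reindex) (auto intro: inj_on_subset[OF inj] simp: S2_def)
    also have "\<dots> \<le> (\<Sum>F\<in>?F - {{}}. q ^ card F)"
    proof (rule sum_mono2)
      show "finite (?F - {{}})" by (rule finite_subset[of _ "Pow (Arcs N)"]) (use E in auto)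
      show "bd N ` S2 \<subseteq> ?F - {{}}"
      proof
        fix F assume "F \<in> bd N ` S2"
        then obtain S where S: "F = bd N S" "S \<in> S2" by blast
        then have "i \<in> S" "j \<notin> S" by (auto simp: S2_def)
        then have "4 \<le> card F" using contour_root[OF N ij] S by blast
        then show "F \<in> ?F - {{}}" using S bd_subset_Arcs[of N S] tcirc_bd[of N S] by (auto simp: S2_def)
      qed
    qed (use q in auto)
    also have "\<dots> \<le> (32/3 * y ^ 4) / (1 - 32/3 * y ^ 4)"
      by (rule sum_circ_le[OF E q(1) X]) (use y4 in linarith)
    also have "\<dots> \<le> 12 * y ^ 4"
    proof -
      \<comment> \<open>With y^4 <= 1/256 the quadratic term 128 y^8 costs at most y^4 / 2, and 12 -
        1/2 > 32/3.\<close>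
      have "32/3 * y ^ 4 \<le> 12 * y ^ 4 * (1 - 32/3 * y ^ 4)"
      proof -
        have "128 * y ^ 4 * y ^ 4 \<le> 128 * y ^ 4 * (1/256)" using y4 y40 by (intro mult_left_mono) auto
        then show ?thesis by (simp add: algebra_simps) (use y40 in linarith)
      qed
      moreover have "0 < 1 - 32/3 * y ^ 4" using y4 by linarith
      ultimately show ?thesis by (simp only: pos_divide_le_eq)
    qed
    finally show ?thesis .
  qed
  show ?thesis
  proof (rule that[of "S1 \<union> S2"])
    show "finite (S1 \<union> S2)" using fin by simp
    show "S \<subseteq> Lam N \<and> i \<in> S \<and> j \<notin> S" if "S \<in> S1 \<union> S2" for S using that by (auto simp: S1_def S2_def)
    show "\<exists>S\<in>S1 \<union> S2. bd N S \<subseteq> bd N A" if "i \<in> A" "j \<notin> A" for A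
      using contour_dichotomy[OF ij that] unfolding S1_def S2_def by blast
    have "(\<Sum>S\<in>S1 \<union> S2. q ^ card (bd N S)) \<le> (\<Sum>S\<in>S1. q ^ card (bd N S)) + (\<Sum>S\<in>S2. q ^ card (bd N S))"
      using sum.union_inter[OF fin, of "\<lambda>S. q ^ card (bd N S)"] sum_nonneg[of "S1 \<inter> S2" "\<lambda>S. q ^ card (bd N S)"] q by force
    \<comment> \<open>192/11 + 12 < 30, and 30 * 4^4 = 7680 is below 480 * 3^4 = 38880.\<close>
    also have "\<dots> \<le> 30 * y ^ 4" using sum1 sum2 y40 by linarith
    also have "\<dots> \<le> 480 * 3 ^ 4 * q ^ 4" using q by (simp add: y_def power_mult_distrib)
    finally show "(\<Sum>S\<in>S1 \<union> S2. q ^ card (bd N S)) \<le> 480 * 3 ^ 4 * q ^ 4" .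
  qed
qed


section \<open>Localization of the integer-valued Gaussian free field\<close>

text \<open>The length of a contour is the total variation of the indicator, since of two opposite
  arcs over an edge at most one lies in the boundary.\<close>

lemma card_bd:
  "int (card (bd N S)) = (\<Sum>s\<in>Lam N. \<bar>of_bool (s \<in> S) - of_bool (rt N s \<in> S)\<bar> + \<bar>of_bool (s \<in> S) - of_bool (up N s \<in> S)\<bar>)"
proof -
  have "bd N S = Sigma (Lam N) (\<lambda>s. {c. (s, c) \<in> bd N S})" by (auto simp: bd_def)
  then have "card (bd N S) = card (Sigma (Lam N) (\<lambda>s. {c. (s, c) \<in> bd N S}))" by (rule arg_cong)
  also have "\<dots> = (\<Sum>s\<in>Lam N. card {c. (s, c) \<in> bd N S})"
  proof (rule card_SigmaI)
    have "finite (UNIV :: crossing set)" by (simp add: UNIV_crossing)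
    from finite_subset[OF subset_UNIV this] show "\<forall>s\<in>Lam N. finite {c. (s, c) \<in> bd N S}" by (rule ballI)
  qed simp
  finally have "int (card (bd N S)) = (\<Sum>s\<in>Lam N. int (card {c. (s, c) \<in> bd N S}))" by simp
  also have "\<dots> = (\<Sum>s\<in>Lam N. \<bar>of_bool (s \<in> S) - of_bool (rt N s \<in> S)\<bar> + \<bar>of_bool (s \<in> S) - of_bool (up N s \<in> S)\<bar>)"
  proof (rule sum.cong)
    fix s assume s: "s \<in> Lam N"
    have "{c. (s, c) \<in> bd N S} = {c. (s, c) \<in> bd N S} \<inter> {HR, HL, VU, VD}" using UNIV_crossing by auto
    then have "card {c. (s, c) \<in> bd N S} = card ({c. (s, c) \<in> bd N S} \<inter> {HR, HL, VU, VD})" by (rule arg_cong)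
    also have "\<dots> = of_bool ((s, HR) \<in> bd N S) + of_bool ((s, HL) \<in> bd N S)
       + of_bool ((s, VU) \<in> bd N S) + of_bool ((s, VD) \<in> bd N S)"
      by (subst card_Int_4) (simp_all only: mem_Collect_eq distinct.simps list.set insert_iff empty_iff crossing.distinct, simp_all)
    finally have "card {c. (s, c) \<in> bd N S} = of_bool ((s, HR) \<in> bd N S) + of_bool ((s, HL) \<in> bd N S)
       + of_bool ((s, VU) \<in> bd N S) + of_bool ((s, VD) \<in> bd N S)" .
    then show "int (card {c. (s, c) \<in> bd N S}) = \<bar>of_bool (s \<in> S) - of_bool (rt N s \<in> S)\<bar> + \<bar>of_bool (s \<in> S) - of_bool (up N s \<in> S)\<bar>"
      using s by auto
  qed simp
  finally show ?thesis .
qed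

text \<open>Lowering the field by one inside a contour of a superlevel set decreases each gradient
  across the contour by one towards zero.\<close>
lemma dir_lower:
  fixes m :: "site \<Rightarrow> int"
  assumes "bd N S \<subseteq> bd N {s. m s \<ge> c}"
  shows "dir N (\<lambda>s. of_int (m s) - of_bool (s \<in> S)) + real (card (bd N S)) \<le> dir N (\<lambda>s. of_int (m s))"
proof -
  \<comment> \<open>For an integer gradient d >= 1, (d - 1)^2 + 1 <= d^2; the last two hypotheses
    say that the shift always goes towards 0.\<close>
  have sq: "(x - y - (e - f))\<^sup>2 + \<bar>e - f\<bar> \<le> (x - y)\<^sup>2"
    if "e = of_bool P" "f = of_bool Q" "P \<Longrightarrow> \<not> Q \<Longrightarrow> x > y" "\<not> P \<Longrightarrow> Q \<Longrightarrow> x < y" for x y e f :: int and P Q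
    using that by (cases P; cases Q) (auto simp: power2_eq_square algebra_simps)
  have pt: "(m s - m t - (of_bool (s \<in> S) - of_bool (t \<in> S)))\<^sup>2 + \<bar>of_bool (s \<in> S) - of_bool (t \<in> S)\<bar> \<le> (m s - m t)\<^sup>2"
    if s: "s \<in> Lam N" and t: "t = rt N s \<or> t = up N s" for s t
    using t
  proof
    assume t: "t = rt N s"
    show ?thesis
    proof (rule sq[OF refl refl])
      assume "s \<in> S" "t \<notin> S"
      then have "(s, HR) \<in> bd N S" using s t by simp
      then have "(s, HR) \<in> bd N {s. m s \<ge> c}" using assms by blast
      then show "m t < m s" using t by simp
    next
      assume "s \<notin> S" "t \<in> S"
      then have "(s, HL) \<in> bd N S" using s t by simp
      then have "(s, HL) \<in> bd N {s. m s \<ge> c}" using assms by blast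
      then show "m s < m t" using t by simp
    qed
  next
    assume t: "t = up N s"
    show ?thesis
    proof (rule sq[OF refl refl])
      assume "s \<in> S" "t \<notin> S"
      then have "(s, VU) \<in> bd N S" using s t by simp
      then have "(s, VU) \<in> bd N {s. m s \<ge> c}" using assms by blast
      then show "m t < m s" using t by simp
    next
      assume "s \<notin> S" "t \<in> S"
      then have "(s, VD) \<in> bd N S" using s t by simp
      then have "(s, VD) \<in> bd N {s. m s \<ge> c}" using assms by blast
      then show "m s < m t" using t by simp
    qed
  qed
  have "(\<Sum>s\<in>Lam N. (m s - m (rt N s) - (of_bool (s \<in> S) - of_bool (rt N s \<in> S)))\<^sup>2
       + (m s - m (up N s) - (of_bool (s \<in> S) - of_bool (up N s \<in> S)))\<^sup>2) + int (card (bd N S))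
     \<le> (\<Sum>s\<in>Lam N. (m s - m (rt N s))\<^sup>2 + (m s - m (up N s))\<^sup>2)"
    unfolding card_bd sum.distrib[symmetric]
  proof (rule sum_mono)
    fix s assume s: "s \<in> Lam N"
    show "(m s - m (rt N s) - (of_bool (s \<in> S) - of_bool (rt N s \<in> S)))\<^sup>2 + (m s - m (up N s) - (of_bool (s \<in> S) - of_bool (up N s \<in> S)))\<^sup>2
       + (\<bar>of_bool (s \<in> S) - of_bool (rt N s \<in> S)\<bar> + \<bar>of_bool (s \<in> S) - of_bool (up N s \<in> S)\<bar>) \<le> (m s - m (rt N s))\<^sup>2 + (m s - m (up N s))\<^sup>2"
      using pt[OF s, of "rt N s"] pt[OF s, of "up N s"] by simp
  qed
  then have "real_of_int ((\<Sum>s\<in>Lam N. (m s - m (rt N s) - (of_bool (s \<in> S) - of_bool (rt N s \<in> S)))\<^sup>2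
       + (m s - m (up N s) - (of_bool (s \<in> S) - of_bool (up N s \<in> S)))\<^sup>2) + int (card (bd N S)))
     \<le> real_of_int (\<Sum>s\<in>Lam N. (m s - m (rt N s))\<^sup>2 + (m s - m (up N s))\<^sup>2)"
    by (rule of_int_le_iff[THEN iffD2])
  then show ?thesis unfolding dir_def by (simp add: algebra_simps)
qed

text \<open>The constant added when S contains the origin restores the pinning; it changes no
  gradient, and the map stays a bijection of \<open>Cfg N\<close>.\<close>

definition lower :: "nat \<Rightarrow> site set \<Rightarrow> (site \<Rightarrow> int) \<Rightarrow> site \<Rightarrow> int" where
  "lower N S m s = (if s \<in> Lam N then m s - of_bool (s \<in> S) + of_bool (org \<in> S) else 0)"

lemma bij_betw_lower:
  assumes "N > 0"
  shows "bij_betw (lower N S) (Cfg N) (Cfg N)"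
proof -
  have o: "org \<in> Lam N" using assms by (auto simp: Lam_def)
  show ?thesis
    by (rule bij_betw_byWitness[where f' = "\<lambda>m s. if s \<in> Lam N then m s + of_bool (s \<in> S) - of_bool (org \<in> S) else 0"])
       (use o in \<open>auto simp: lower_def Cfg_def int_funs_def fun_eq_iff\<close>)
qed

lemma dir_lower_eq: "dir N (\<lambda>s. of_int (lower N S m s)) = dir N (\<lambda>s. of_int (m s) - of_bool (s \<in> S))"
  unfolding dir_def lower_def by (intro sum.cong refl) (simp add: algebra_simps)

lemma iv_weight_lower:
  assumes b: "b > 0" and bd: "bd N S \<subseteq> bd N {s. m s \<ge> c}"
  shows "iv_weight N b m \<le> exp (- (1 / (4 * b))) ^ card (bd N S) * iv_weight N b (lower N S m)"
proof -
  have "(dir N (\<lambda>s. of_int (lower N S m s)) + real (card (bd N S))) / (4 * b) \<le> dir N (\<lambda>s. of_int (m s)) / (4 * b)"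
    unfolding dir_lower_eq using dir_lower[OF bd] b by (intro divide_right_mono) auto
  then have "iv_weight N b m \<le> exp (real (card (bd N S)) * (- (1 / (4 * b))) + - dir N (\<lambda>s. of_int (lower N S m s)) / (4 * b))"
    unfolding iv_weight_def by (simp add: add_divide_distrib)
  then show ?thesis unfolding iv_weight_def exp_add exp_of_nat_mult .
qed

lemma exp_minus_inverse_le:
  assumes "0 < b" "b \<le> 1/12"
  shows "exp (- (1 / (4 * b))) \<le> (1/16 :: real)"
proof -
  \<comment> \<open>The bound needed is e^3 > 16; the exponent 30 is large enough, as 1.1^30 exceeds
    17.\<close>
  have "(16::real) \<le> (1 + 3 / real 30) ^ 30" by (simp add: power_divide)
  also have "\<dots> \<le> exp 3" by (rule exp_ge_one_plus_x_over_n_power_n) auto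
  also have "\<dots> \<le> exp (1 / (4 * b))" using assms by (simp add: field_simps)
  finally have "inverse (exp (1 / (4 * b))) \<le> inverse 16" by (intro le_imp_inverse_le) auto
  then show ?thesis by (simp add: exp_minus)
qed

text \<open>b <= 1/12 means beta >= 3, so exp(- beta) <= 1/16 and phi <= 480 * 81 / 65536 <
  1.\<close>

lemma phi_bounds:
  assumes "0 < b" "b \<le> 1/12"
  shows "0 < phi (1 / (4 * b))" "phi (1 / (4 * b)) < 1"
proof -
  let ?q = "exp (- (1 / (4 * b)))"
  have "?q ^ 4 \<le> (1/16) ^ 4" by (rule power_mono) (use exp_minus_inverse_le[OF assms] in auto)
  then show "phi (1 / (4 * b)) < 1" by (simp add: phi_def power_mult_distrib power_divide)
  show "0 < phi (1 / (4 * b))" by (simp add: phi_def)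
qed

section \<open>The Peierls estimate for height differences\<close>

lemma iv_weight_nonneg [simp]: "0 \<le> iv_weight N b m"
  by (simp add: iv_weight_def)

lemma iv_summable:
  assumes "N > 0" "b > 0"
  shows "iv_weight N b summable_on Cfg N"
  using villain_duality[OF assms] by blast

text \<open>The squared difference is at most 16 N^2 times the energy, and the energy is at most 8 b
  exp(energy / (8 b)); half of the decay of the weight absorbs this, and the weight at 2 b
  remains.\<close>

lemma iv_second_moment_summable:
  assumes N: "N > 0" and b: "b > 0" and ij: "i \<in> Lam N" "j \<in> Lam N"
  shows "(\<lambda>m. iv_weight N b m * (of_int (m i - m j))\<^sup>2) summable_on Cfg N"
proof (rule summable_on_comparison_test)
  show "(\<lambda>m. 128 * (real N)\<^sup>2 * b * iv_weight N (2 * b) m) summable_on Cfg N"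
    using b N by (intro summable_on_cmult_right iv_summable) auto
  fix m
  let ?d = "dir N (\<lambda>s. of_int (m s))"
  have "(of_int (m i - m j))\<^sup>2 \<le> 16 * (real N)\<^sup>2 * ?d"
    using diff_le_dir[OF ij, of "\<lambda>s. of_int (m s)"] by simp
  also have "?d \<le> 8 * b * exp (?d / (8 * b))"
  proof -
    have "?d / (8 * b) \<le> exp (?d / (8 * b))" using exp_ge_add_one_self[of "?d / (8 * b)"] by linarith
    then show ?thesis using b by (simp add: field_simps)
  qed
  finally have "(of_int (m i - m j))\<^sup>2 \<le> 16 * (real N)\<^sup>2 * (8 * b * exp (?d / (8 * b)))"
    by (simp add: mult_left_mono)
  then have "iv_weight N b m * (of_int (m i - m j))\<^sup>2 \<le> iv_weight N b m * (16 * (real N)\<^sup>2 * (8 * b * exp (?d / (8 * b))))"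
    by (intro mult_left_mono) auto
  also have "\<dots> = 128 * (real N)\<^sup>2 * b * (exp (- ?d / (4 * b)) * exp (?d / (8 * b)))"
    by (simp add: iv_weight_def)
  also have "exp (- ?d / (4 * b)) * exp (?d / (8 * b)) = iv_weight N (2 * b) m"
    using b by (simp add: iv_weight_def exp_add[symmetric] field_simps)
  finally show "iv_weight N b m * (of_int (m i - m j))\<^sup>2 \<le> 128 * (real N)\<^sup>2 * b * iv_weight N (2 * b) m" .
qed auto

lemma has_sum_finite_sum:
  fixes f :: "'b \<Rightarrow> 'a \<Rightarrow> real"
  assumes "finite S" "\<And>s. (f s has_sum c s) A"
  shows "((\<lambda>m. \<Sum>s\<in>S. f s m) has_sum (\<Sum>s\<in>S. c s)) A"
  using assms(1)
proof (induction S)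
  case (insert s S)
  then show ?case using has_sum_add[OF assms(2)[of s] insert.IH] by simp
qed simp

text \<open>Each m with m_i > m_j is sent to a lowered field with difference smaller by one, at the
  price q^|dS| for a suitable S. Bounding by the sum over all S in the family and reindexing by the
  bijection \<open>lower N S\<close> turns the total price into phi. The function f is left open to
  serve for the first and the second moment.\<close>

lemma peierls_shift:
  fixes f :: "int \<Rightarrow> real"
  assumes N: "N \<ge> 4" and ij: "i \<in> Lam N" "j \<in> Lam N" and b: "0 < b" "b \<le> 1/12"
    and f: "\<And>n. n \<ge> 1 \<Longrightarrow> f n \<ge> 0"
    and s1: "(\<lambda>m. iv_weight N b m * (of_bool (m i - m j \<ge> 1) * f (m i - m j))) summable_on Cfg N"
    and s2: "(\<lambda>m. iv_weight N b m * (of_bool (m i - m j \<ge> 0) * f (m i - m j + 1))) summable_on Cfg N"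
  shows "(\<Sum>\<^sub>\<infinity>m\<in>Cfg N. iv_weight N b m * (of_bool (m i - m j \<ge> 1) * f (m i - m j)))
     \<le> phi (1 / (4 * b)) * (\<Sum>\<^sub>\<infinity>m\<in>Cfg N. iv_weight N b m * (of_bool (m i - m j \<ge> 0) * f (m i - m j + 1)))"
proof -
  define q where "q = exp (- (1 / (4 * b)))"
  have q: "0 \<le> q" "q \<le> 1/16" using exp_minus_inverse_le[OF b] by (auto simp: q_def)
  obtain \<S> where fin: "finite \<S>" and S: "\<And>S. S \<in> \<S> \<Longrightarrow> S \<subseteq> Lam N \<and> i \<in> S \<and> j \<notin> S"
    and cover: "\<And>A. i \<in> A \<Longrightarrow> j \<notin> A \<Longrightarrow> \<exists>S\<in>\<S>. bd N S \<subseteq> bd N A"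
    and sum: "(\<Sum>S\<in>\<S>. q ^ card (bd N S)) \<le> 480 * 3 ^ 4 * q ^ 4"
    using contour_sum[OF N ij q] by blast
  define g where "g = (\<lambda>m. iv_weight N b m * (of_bool (m i - m j \<ge> 0) * f (m i - m j + 1)))"
  define h where "h = (\<lambda>m. iv_weight N b m * (of_bool (m i - m j \<ge> 1) * f (m i - m j)))"
  have g0: "g m \<ge> 0" for m unfolding g_def using f[of "m i - m j + 1"] by (cases "m i - m j \<ge> 0") auto
  have N0: "N > 0" using N by simp
  note bij = bij_betw_lower[OF N0]
  have gs: "(\<lambda>m. g (lower N S m)) summable_on Cfg N" for S
    using s2 summable_on_reindex_bij_betw[OF bij, of g S] unfolding g_def by simp
  have gi: "(\<Sum>\<^sub>\<infinity>m\<in>Cfg N. g (lower N S m)) = infsum g (Cfg N)" for S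
    by (rule infsum_reindex_bij_betw[OF bij])
  have pt: "h m \<le> (\<Sum>S\<in>\<S>. q ^ card (bd N S) * g (lower N S m))" for m
  proof (cases "m i - m j \<ge> 1")
    case False
    then show ?thesis unfolding h_def using q g0 by (simp add: sum_nonneg)
  next
    case True
    \<comment> \<open>The level m_j + 1 is the lowest one whose superlevel set excludes j; i belongs
      to it because the heights are integers.\<close>
    then obtain S where SS: "S \<in> \<S>" "bd N S \<subseteq> bd N {s. m s \<ge> m j + 1}"
      using cover[of "{s. m s \<ge> m j + 1}"] by auto
    have diff: "lower N S m i - lower N S m j = m i - m j - 1" using S[OF SS(1)] ij by (simp add: lower_def)
    have "h m = iv_weight N b m * f (m i - m j)" using True by (simp add: h_def)
    also have "\<dots> \<le> (q ^ card (bd N S) * iv_weight N b (lower N S m)) * f (m i - m j)"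
      unfolding q_def by (intro mult_right_mono iv_weight_lower[OF b(1) SS(2)] f True)
    also have "\<dots> = q ^ card (bd N S) * g (lower N S m)"
    proof -
      have "lower N S m j \<le> lower N S m i" using True diff by linarith
      then show ?thesis by (simp add: g_def diff)
    qed
    also have "\<dots> \<le> (\<Sum>S\<in>\<S>. q ^ card (bd N S) * g (lower N S m))"
      by (rule member_le_sum[OF SS(1)]) (use q g0 fin in auto)
    finally show ?thesis .
  qed
  have hs: "((\<lambda>m. \<Sum>S\<in>\<S>. q ^ card (bd N S) * g (lower N S m)) has_sum (\<Sum>S\<in>\<S>. q ^ card (bd N S) * infsum g (Cfg N))) (Cfg N)"
  proof (rule has_sum_finite_sum[OF fin])
    show "((\<lambda>m. q ^ card (bd N S) * g (lower N S m)) has_sum q ^ card (bd N S) * infsum g (Cfg N)) (Cfg N)" for S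
      unfolding gi[of S, symmetric] by (intro has_sum_cmult_right has_sum_infsum gs)
  qed
  have "(h has_sum infsum h (Cfg N)) (Cfg N)" using s1 unfolding h_def by (rule has_sum_infsum)
  from has_sum_mono[OF this hs] pt
  have "infsum h (Cfg N) \<le> (\<Sum>S\<in>\<S>. q ^ card (bd N S) * infsum g (Cfg N))" by blast
  also have "\<dots> = (\<Sum>S\<in>\<S>. q ^ card (bd N S)) * infsum g (Cfg N)" by (simp add: sum_distrib_right)
  also have "\<dots> \<le> (480 * 3 ^ 4 * q ^ 4) * infsum g (Cfg N)"
    by (intro mult_right_mono sum infsum_nonneg g0)
  also have "480 * 3 ^ 4 * q ^ 4 = phi (1 / (4 * b))" by (simp add: phi_def q_def power_mult_distrib)
  finally show ?thesis unfolding h_def g_def .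
qed

text \<open>With Z0, U, V the moments of order 0, 1, 2 of the difference on the event that it is
  nonnegative, the shift gives U <= phi (U + Z0) and V <= phi (V + 2 U + Z0). All three are finite,
  so these can be solved for V.\<close>

lemma iv_half_variance:
  assumes N: "N \<ge> 4" and ij: "i \<in> Lam N" "j \<in> Lam N" and b: "0 < b" "b \<le> 1/12"
  defines "\<phi> \<equiv> phi (1 / (4 * b))"
  shows "(\<Sum>\<^sub>\<infinity>m\<in>Cfg N. iv_weight N b m * (of_bool (m i - m j \<ge> 1) * (of_int (m i - m j))\<^sup>2))
     \<le> \<phi> * (1 + \<phi>) / (1 - \<phi>)\<^sup>2 * infsum (iv_weight N b) (Cfg N)"
proof -
  have N0: "N > 0" using N by simp
  define w where "w = iv_weight N b"
  define P where "P = (\<lambda>m::site \<Rightarrow> int. of_bool (m i - m j \<ge> 0) :: real)"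
  define D where "D = (\<lambda>m::site \<Rightarrow> int. of_int (m i - m j) :: real)"
  have ws: "w summable_on Cfg N" unfolding w_def using iv_summable[OF N0 b(1)] .
  have wD: "(\<lambda>m. w m * (D m)\<^sup>2) summable_on Cfg N"
    unfolding w_def D_def using iv_second_moment_summable[OF N0 b(1) ij] .
  have D1: "\<bar>D m\<bar> \<le> (D m)\<^sup>2" for m
  proof -
    have "\<bar>n\<bar> \<le> n\<^sup>2" for n :: int
    proof (cases "n = 0")
      case False
      then have "\<bar>n\<bar> * 1 \<le> \<bar>n\<bar> * \<bar>n\<bar>" by (intro mult_left_mono) auto
      then show ?thesis by (simp add: power2_eq_square abs_mult_self_eq)
    qed simp
    then have "real_of_int \<bar>m i - m j\<bar> \<le> real_of_int ((m i - m j)\<^sup>2)" by (intro of_int_le_iff[THEN iffD2])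
    then show ?thesis by (simp add: D_def)
  qed
  have w0: "w m \<ge> 0" for m by (simp add: w_def)
  have PZ: "(\<lambda>m. w m * P m) summable_on Cfg N"
    by (rule summable_on_comparison_test[OF ws]) (use w0 in \<open>auto simp: P_def\<close>)
  have PD0: "P m * D m \<ge> 0" for m by (auto simp: P_def D_def)
  have PU: "(\<lambda>m. w m * (P m * D m)) summable_on Cfg N"
  proof (rule summable_on_comparison_test[OF wD])
    fix m
    have "P m * D m \<le> (D m)\<^sup>2" using D1[of m] by (auto simp: P_def D_def)
    then show "w m * (P m * D m) \<le> w m * (D m)\<^sup>2" using w0 by (intro mult_left_mono) auto
    show "0 \<le> w m * (P m * D m)" by (rule mult_nonneg_nonneg[OF w0 PD0])
  qed
  have PV: "(\<lambda>m. w m * (P m * (D m)\<^sup>2)) summable_on Cfg N"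
    by (rule summable_on_comparison_test[OF wD]) (use w0 in \<open>auto simp: P_def\<close>)
  define Z where "Z = infsum w (Cfg N)"
  define Z0 where "Z0 = (\<Sum>\<^sub>\<infinity>m\<in>Cfg N. w m * P m)"
  define U where "U = (\<Sum>\<^sub>\<infinity>m\<in>Cfg N. w m * (P m * D m))"
  define V where "V = (\<Sum>\<^sub>\<infinity>m\<in>Cfg N. w m * (P m * (D m)\<^sup>2))"
  have Z0Z: "Z0 \<le> Z" unfolding Z0_def Z_def by (rule infsum_mono[OF PZ ws]) (use w0 in \<open>auto simp: P_def\<close>)
  have Z00: "Z0 \<ge> 0" unfolding Z0_def by (rule infsum_nonneg) (use w0 in \<open>auto simp: P_def\<close>)
  have U0: "U \<ge> 0" unfolding U_def by (rule infsum_nonneg) (rule mult_nonneg_nonneg[OF w0 PD0])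
  have \<phi>: "0 < \<phi>" "\<phi> < 1" unfolding \<phi>_def using phi_bounds[OF b] .
  \<comment> \<open>At difference 0 the factor \<open>D\<close> vanishes, so the events >= 1 and >=
    0 may be interchanged.\<close>
  have ge1: "of_bool (m i - m j \<ge> 1) * real_of_int (m i - m j) = P m * D m" for m
    by (auto simp: P_def D_def)
  have ge1': "of_bool (m i - m j \<ge> 1) * (real_of_int (m i - m j))\<^sup>2 = P m * (D m)\<^sup>2" for m
    by (auto simp: P_def D_def)
  have eU: "w m * (of_bool (m i - m j \<ge> 0) * real_of_int (m i - m j + 1)) = w m * (P m * D m) + w m * P m" for m
    by (simp add: P_def D_def algebra_simps)
  have eV: "w m * (of_bool (m i - m j \<ge> 0) * (real_of_int (m i - m j + 1))\<^sup>2) = w m * (P m * (D m)\<^sup>2) + (2 * (w m * (P m * D m)) + w m * P m)" for m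
    by (simp add: P_def D_def power2_eq_square algebra_simps)
  have "U \<le> \<phi> * (\<Sum>\<^sub>\<infinity>m\<in>Cfg N. w m * (P m * D m) + w m * P m)"
    using peierls_shift[OF N ij b, of real_of_int] PU summable_on_add[OF PU PZ]
    unfolding w_def[symmetric] \<phi>_def[symmetric] ge1 eU U_def by simp
  also have "\<dots> = \<phi> * (U + Z0)" unfolding U_def Z0_def by (subst infsum_add[OF PU PZ]) simp
  finally have U: "U * (1 - \<phi>) \<le> \<phi> * Z0" by (simp add: algebra_simps)
  note s2 = summable_on_add[OF summable_on_cmult_right[OF PU, of 2] PZ]
  have "V \<le> \<phi> * (\<Sum>\<^sub>\<infinity>m\<in>Cfg N. w m * (P m * (D m)\<^sup>2) + (2 * (w m * (P m * D m)) + w m * P m))"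
    using peierls_shift[OF N ij b, of "\<lambda>n. (real_of_int n)\<^sup>2"] PV summable_on_add[OF PV s2]
    unfolding w_def[symmetric] \<phi>_def[symmetric] ge1' eV V_def by simp
  also have "\<dots> = \<phi> * (V + (2 * U + Z0))"
    unfolding V_def U_def Z0_def
    by (simp add: infsum_add[OF PV s2] infsum_add[OF summable_on_cmult_right[OF PU] PZ] infsum_cmult_right')
  finally have "V * (1 - \<phi>) \<le> \<phi> * (2 * U + Z0)" by (simp add: algebra_simps)
  then have "V * (1 - \<phi>) * (1 - \<phi>) \<le> \<phi> * (2 * U + Z0) * (1 - \<phi>)"
    using \<phi> by (intro mult_right_mono) auto
  also have "\<dots> = \<phi> * (2 * (U * (1 - \<phi>)) + Z0 * (1 - \<phi>))" by (simp add: algebra_simps)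
  also have "\<dots> \<le> \<phi> * (2 * (\<phi> * Z0) + Z0 * (1 - \<phi>))" using U \<phi> by (intro mult_left_mono) auto
  also have "\<dots> = \<phi> * (1 + \<phi>) * Z0" by (simp add: algebra_simps)
  also have "\<dots> \<le> \<phi> * (1 + \<phi>) * Z" using Z0Z \<phi> by (intro mult_left_mono) auto
  finally have "V * (1 - \<phi>)\<^sup>2 \<le> \<phi> * (1 + \<phi>) * Z" by (simp add: power2_eq_square mult.assoc)
  then have "V \<le> \<phi> * (1 + \<phi>) / (1 - \<phi>)\<^sup>2 * Z" using \<phi> by (simp add: field_simps)
  then show ?thesis unfolding V_def Z_def w_def[symmetric] ge1' .
qed

text \<open>The two signs of the difference are bounded separately. The exponent 2 of 1 - phi is
  weakened to 3 to match \<open>Mconst\<close>, using 0 < 1 - phi < 1.\<close>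

theorem iv_variance_bound:
  assumes N: "N \<ge> 4" and ij: "i \<in> Lam N" "j \<in> Lam N" and b: "0 < b" "b \<le> 1/12"
  shows "(\<Sum>\<^sub>\<infinity>m\<in>Cfg N. iv_weight N b m * (of_int (m i - m j))\<^sup>2)
     \<le> Mconst (1 / (4 * b)) * infsum (iv_weight N b) (Cfg N)"
proof -
  have N0: "N > 0" using N by simp
  let ?w = "iv_weight N b" and ?\<phi> = "phi (1 / (4 * b))"
  let ?h = "\<lambda>i j m. ?w m * (of_bool (m i - m j \<ge> 1) * (real_of_int (m i - m j))\<^sup>2)"
  have s: "?h i j summable_on Cfg N" if "i \<in> Lam N" "j \<in> Lam N" for i j
    by (rule summable_on_comparison_test[OF iv_second_moment_summable[OF N0 b(1) that]]) auto
  have "?w m * (of_int (m i - m j))\<^sup>2 = ?h i j m + ?h j i m" for m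
    by (cases "m i - m j \<ge> 1"; cases "m j - m i \<ge> 1") (auto simp: power2_commute)
  then have "(\<Sum>\<^sub>\<infinity>m\<in>Cfg N. ?w m * (of_int (m i - m j))\<^sup>2) = infsum (?h i j) (Cfg N) + infsum (?h j i) (Cfg N)"
    by (simp only: infsum_add[OF s[OF ij] s[OF ij(2,1)]])
  also have "\<dots> \<le> 2 * (?\<phi> * (1 + ?\<phi>) / (1 - ?\<phi>)\<^sup>2 * infsum ?w (Cfg N))"
    using iv_half_variance[OF N ij b] iv_half_variance[OF N ij(2,1) b] by linarith
  also have "\<dots> = 2 * ?\<phi> * (1 + ?\<phi>) / (1 - ?\<phi>)\<^sup>2 * infsum ?w (Cfg N)" by simp
  also have "\<dots> \<le> Mconst (1 / (4 * b)) * infsum ?w (Cfg N)"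
  proof (rule mult_right_mono)
    have p: "0 < ?\<phi>" "?\<phi> < 1" using phi_bounds[OF b] .
    then have "(1 - ?\<phi>) ^ 3 \<le> (1 - ?\<phi>)\<^sup>2" by (intro power_decreasing) auto
    then show "2 * ?\<phi> * (1 + ?\<phi>) / (1 - ?\<phi>)\<^sup>2 \<le> Mconst (1 / (4 * b))"
      unfolding Mconst_def using p by (intro divide_left_mono) auto
    show "0 \<le> infsum ?w (Cfg N)" by (rule infsum_nonneg) simp
  qed
  finally show ?thesis .
qed


section \<open>Fluctuations of the voltage\<close>

text \<open>Dominated convergence for series as tau decreases to 0: the bound makes the partial sums
  converge uniformly in tau, so the limits may be interchanged.\<close>

lemma tendsto_infsum_dominated:
  fixes a :: "'k \<Rightarrow> real \<Rightarrow> real"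
  assumes lim: "\<And>k. (a k \<longlongrightarrow> c k) (at_right 0)"
    and bound: "\<And>k \<tau>. 0 < \<tau> \<Longrightarrow> \<tau> < 1 \<Longrightarrow> \<bar>a k \<tau>\<bar> \<le> M k"
    and M: "M summable_on X"
  shows "c summable_on X" "((\<lambda>\<tau>. \<Sum>\<^sub>\<infinity>k\<in>X. a k \<tau>) \<longlongrightarrow> (\<Sum>\<^sub>\<infinity>k\<in>X. c k)) (at_right 0)"
proof -
  have ev: "eventually (\<lambda>\<tau>::real. \<tau> \<in> {0<..<1}) (at_right 0)" by (rule eventually_at_right_real) simp
  have cM: "\<bar>c k\<bar> \<le> M k" for k
  proof (rule tendsto_upperbound)
    show "((\<lambda>\<tau>. \<bar>a k \<tau>\<bar>) \<longlongrightarrow> \<bar>c k\<bar>) (at_right 0)" by (intro tendsto_rabs lim)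
    show "eventually (\<lambda>\<tau>. \<bar>a k \<tau>\<bar> \<le> M k) (at_right 0)" using ev by eventually_elim (auto intro: bound)
  qed simp
  have "(\<lambda>k. norm (c k)) summable_on X"
    by (rule summable_on_comparison_test[OF M]) (use cM in auto)
  then show cs: "c summable_on X" by (rule abs_summable_summable)
  show "((\<lambda>\<tau>. \<Sum>\<^sub>\<infinity>k\<in>X. a k \<tau>) \<longlongrightarrow> (\<Sum>\<^sub>\<infinity>k\<in>X. c k)) (at_right 0)"
  proof (rule swap_uniform_limit'[where S = "{0<..<1}" and F = "finite_subsets_at_top X"])
    show "uniform_limit {0<..<1} (\<lambda>n \<tau>. \<Sum>k\<in>n. a k \<tau>) (\<lambda>\<tau>. \<Sum>\<^sub>\<infinity>k\<in>X. a k \<tau>) (finite_subsets_at_top X)"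
      by (rule Weierstrass_m_test_general[OF _ M]) (auto intro: bound)
    show "\<forall>\<^sub>F n in finite_subsets_at_top X. ((\<lambda>\<tau>. \<Sum>k\<in>n. a k \<tau>) \<longlongrightarrow> (\<Sum>k\<in>n. c k)) (at_right 0)"
      by (intro always_eventually allI tendsto_sum lim)
    show "((\<lambda>n. \<Sum>k\<in>n. c k) \<longlongrightarrow> (\<Sum>\<^sub>\<infinity>k\<in>X. c k)) (finite_subsets_at_top X)"
      using cs by (rule infsum_tendsto)
  qed (use ev in auto)
qed

lemma cos_second_difference:
  fixes d :: real
  shows "((\<lambda>\<tau>. 2 * (1 - cos (\<tau> * d)) / \<tau>\<^sup>2) \<longlongrightarrow> d\<^sup>2) (at_right 0)"
    and "0 < \<tau> \<Longrightarrow> \<bar>2 * (1 - cos (\<tau> * d)) / \<tau>\<^sup>2\<bar> \<le> d\<^sup>2"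
proof -
  show "((\<lambda>\<tau>. 2 * (1 - cos (\<tau> * d)) / \<tau>\<^sup>2) \<longlongrightarrow> d\<^sup>2) (at_right 0)"
  proof (cases "d = 0")
    case False
    then show ?thesis unfolding power2_eq_square by real_asymp
  qed simp
  assume t: "0 < \<tau>"
  have c: "1 - cos (\<tau> * d) = 2 * (sin (\<tau> * d / 2))\<^sup>2"
    using cos_double_sin[of "\<tau> * d / 2"] by simp
  have "\<bar>sin (\<tau> * d / 2)\<bar> \<le> \<bar>\<tau> * d / 2\<bar>" by (rule abs_sin_x_le_abs_x)
  then have "(sin (\<tau> * d / 2))\<^sup>2 \<le> (\<tau> * d / 2)\<^sup>2" by (rule abs_le_square_iff[THEN iffD1])
  then have "2 * (1 - cos (\<tau> * d)) \<le> d\<^sup>2 * \<tau>\<^sup>2" unfolding c by (simp add: power_mult_distrib power_divide mult.commute)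
  then have "2 * (1 - cos (\<tau> * d)) / \<tau>\<^sup>2 \<le> d\<^sup>2" using t by (simp add: pos_divide_le_eq)
  moreover have "2 * (1 - cos (\<tau> * d)) / \<tau>\<^sup>2 \<ge> 0" by (intro divide_nonneg_nonneg) auto
  ultimately show "\<bar>2 * (1 - cos (\<tau> * d)) / \<tau>\<^sup>2\<bar> \<le> d\<^sup>2" by simp
qed

lemma exp_second_order:
  fixes x :: real
  shows "exp x + exp (- x) - 2 \<le> x\<^sup>2 * exp \<bar>x\<bar>" "0 \<le> exp x + exp (- x) - 2" "x\<^sup>2 \<le> 2 * exp \<bar>x\<bar>"
proof -
  obtain t where t: "\<bar>t\<bar> \<le> \<bar>x\<bar>" "exp x = (\<Sum>m<2. x ^ m / fact m) + exp t / fact 2 * x ^ 2"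
    using Maclaurin_exp_le[of x 2] by blast
  obtain s where s: "\<bar>s\<bar> \<le> \<bar>- x\<bar>" "exp (- x) = (\<Sum>m<2. (- x) ^ m / fact m) + exp s / fact 2 * (- x) ^ 2"
    using Maclaurin_exp_le[of "- x" 2] by blast
  have eq: "exp x + exp (- x) - 2 = (exp t + exp s) / 2 * x\<^sup>2"
    unfolding t(2) s(2) by (simp add: numeral_2_eq_2 field_simps)
  have "exp t \<le> exp \<bar>x\<bar>" "exp s \<le> exp \<bar>x\<bar>" using t(1) s(1) by simp_all
  then have "(exp t + exp s) / 2 \<le> (exp \<bar>x\<bar> + exp \<bar>x\<bar>) / 2" by (intro divide_right_mono add_mono) auto
  then have "(exp t + exp s) / 2 \<le> exp \<bar>x\<bar>" by simp
  then have "(exp t + exp s) / 2 * x\<^sup>2 \<le> exp \<bar>x\<bar> * x\<^sup>2" by (intro mult_right_mono) auto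
  then show "exp x + exp (- x) - 2 \<le> x\<^sup>2 * exp \<bar>x\<bar>" unfolding eq by (simp add: mult.commute)
  show "0 \<le> exp x + exp (- x) - 2" unfolding eq by (intro mult_nonneg_nonneg) (auto intro: add_nonneg_nonneg)
  have "1 + \<bar>x\<bar> + \<bar>x\<bar>\<^sup>2 / 2 \<le> exp \<bar>x\<bar>" by (rule exp_lower_Taylor_quadratic) simp
  then show "x\<^sup>2 \<le> 2 * exp \<bar>x\<bar>" by simp
qed

text \<open>The majorant is made of exp(2 u) and exp(- 2 u) because the duality supplies summability
  of the tilted weight at tau = 2 and -2; the factor u^2 is absorbed by one of two factors exp
  |u|.\<close>

lemma exp_second_difference:
  fixes u :: real
  shows "((\<lambda>\<tau>. (exp (\<tau> * u) + exp (- \<tau> * u) - 2) / \<tau>\<^sup>2) \<longlongrightarrow> u\<^sup>2) (at_right 0)"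
    and "0 < \<tau> \<Longrightarrow> \<tau> < 1 \<Longrightarrow> \<bar>(exp (\<tau> * u) + exp (- \<tau> * u) - 2) / \<tau>\<^sup>2\<bar> \<le> 2 * (exp (2 * u) + exp (- 2 * u))"
proof -
  show "((\<lambda>\<tau>. (exp (\<tau> * u) + exp (- \<tau> * u) - 2) / \<tau>\<^sup>2) \<longlongrightarrow> u\<^sup>2) (at_right 0)"
  proof (cases "u = 0")
    case False
    then show ?thesis unfolding power2_eq_square by real_asymp
  qed simp
  assume t: "0 < \<tau>" "\<tau> < 1"
  have "exp (\<tau> * u) + exp (- \<tau> * u) - 2 \<le> (\<tau> * u)\<^sup>2 * exp \<bar>\<tau> * u\<bar>"
    using exp_second_order(1)[of "\<tau> * u"] by simp
  also have "\<dots> \<le> (\<tau> * u)\<^sup>2 * exp \<bar>u\<bar>"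
  proof -
    have "\<bar>\<tau> * u\<bar> \<le> \<bar>u\<bar>" using t by (simp add: abs_mult mult_left_le_one_le)
    then show ?thesis by (intro mult_left_mono) auto
  qed
  also have "\<dots> \<le> (\<tau>\<^sup>2 * (2 * exp \<bar>u\<bar>)) * exp \<bar>u\<bar>"
    using exp_second_order(3)[of u] by (intro mult_right_mono) (auto simp: power_mult_distrib intro!: mult_left_mono)
  also have "\<dots> = 2 * exp (2 * \<bar>u\<bar>) * \<tau>\<^sup>2" by (simp add: mult_exp_exp mult_ac)
  also have "\<dots> \<le> 2 * (exp (2 * u) + exp (- 2 * u)) * \<tau>\<^sup>2"
    by (intro mult_right_mono) (auto simp: abs_if)
  finally have "(exp (\<tau> * u) + exp (- \<tau> * u) - 2) / \<tau>\<^sup>2 \<le> 2 * (exp (2 * u) + exp (- 2 * u))"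
    using t by (simp add: pos_divide_le_eq)
  moreover have "(exp (\<tau> * u) + exp (- \<tau> * u) - 2) / \<tau>\<^sup>2 \<ge> 0"
    using exp_second_order(2)[of "\<tau> * u"] by simp
  ultimately show "\<bar>(exp (\<tau> * u) + exp (- \<tau> * u) - 2) / \<tau>\<^sup>2\<bar> \<le> 2 * (exp (2 * u) + exp (- 2 * u))" by simp
qed

lemma iv_partition_pos:
  assumes "N > 0" "b > 0"
  shows "0 < infsum (iv_weight N b) (Cfg N)"
proof -
  have "(\<Sum>m\<in>{\<lambda>_. 0}. iv_weight N b m) \<le> infsum (iv_weight N b) (Cfg N)"
    by (rule finite_sum_le_infsum[OF iv_summable[OF assms]]) (auto simp: Cfg_def int_funs_def)
  then show ?thesis by (simp add: iv_weight_def) (smt (verit) exp_gt_zero)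
qed

text \<open>Comparing second derivatives at \<open>0\<close> of both sides of the duality relation.\<close>
theorem voltage_second_moment:
  assumes N: "N > 0" and b: "b > 0" and ij: "i \<in> Lam N" "j \<in> Lam N"
  shows "cg_E N b (\<lambda>k. (voltage N i j k)\<^sup>2) = 4 / b\<^sup>2 * (b * (green N i i - green N i j)
     - (\<Sum>\<^sub>\<infinity>m\<in>Cfg N. iv_weight N b m * (of_int (m i - m j))\<^sup>2) / infsum (iv_weight N b) (Cfg N))"
proof -
  let ?w = "iv_weight N b"
  \<comment> \<open>The factor b / 2 is absorbed so that the tilt becomes exp(tau u); it returns at
    the end as 4 / b^2.\<close>
  define u where "u = (\<lambda>k. b / 2 * voltage N i j k)"
  define g where "g = green N i i - green N i j"
  define F where "F = (\<lambda>\<tau>. \<Sum>\<^sub>\<infinity>m\<in>Cfg N. ?w m * cos (\<tau> * of_int (m i - m j)))"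
  define E where "E = (\<lambda>\<tau>. \<Sum>\<^sub>\<infinity>k\<in>Omega N. cg_weight N b k * exp (\<tau> * u k))"
  define W where "W = (\<Sum>\<^sub>\<infinity>m\<in>Cfg N. ?w m * (of_int (m i - m j))\<^sup>2)"
  define Q where "Q = (\<Sum>\<^sub>\<infinity>k\<in>Omega N. cg_weight N b k * (u k)\<^sup>2)"
  have ar: "b / 2 * \<tau> * voltage N i j k = \<tau> * u k" "\<tau> * (real_of_int x - real_of_int y) = \<tau> * of_int (x - y)" for \<tau> k x y
    by (auto simp: u_def)
  obtain C where C: "C > 0" and dual0: "\<And>\<tau>. (\<lambda>k. cg_weight N b k * exp (b / 2 * \<tau> * voltage N i j k)) summable_on Omega N \<and>
     (\<Sum>\<^sub>\<infinity>m\<in>Cfg N. ?w m * cos (\<tau> * (of_int (m i) - of_int (m j)))) =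
     C * exp (- (b / 2) * \<tau>\<^sup>2 * (green N i i - green N i j)) * (\<Sum>\<^sub>\<infinity>k\<in>Omega N. cg_weight N b k * exp (b / 2 * \<tau> * voltage N i j k))"
    using villain_duality[OF N b] ij by blast
  have dual: "(\<lambda>k. cg_weight N b k * exp (\<tau> * u k)) summable_on Omega N \<and>
      F \<tau> = C * exp (- (b / 2) * \<tau>\<^sup>2 * g) * E \<tau>" for \<tau>
    using dual0[of \<tau>] unfolding F_def E_def g_def ar .
  have Es: "(\<lambda>k. cg_weight N b k * exp (\<tau> * u k)) summable_on Omega N" and FE: "F \<tau> = C * exp (- (b / 2) * \<tau>\<^sup>2 * g) * E \<tau>" for \<tau>
    using dual by blast+
  have F0: "F 0 = infsum ?w (Cfg N)" by (simp add: F_def)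
  have E0: "E 0 = cg_Z N b" by (simp add: E_def cg_Z_def)
  have F0E0: "F 0 = C * E 0" using FE[of 0] by simp
  have F0pos: "F 0 > 0" unfolding F0 by (rule iv_partition_pos[OF N b])
  have E0pos: "E 0 > 0" using F0pos C unfolding F0E0 by (simp add: zero_less_mult_iff)
  \<comment> \<open>The field side and the Gaussian factor are even in tau, so E is even; its
    symmetric second difference is therefore 2 (E tau - E 0).\<close>
  have Esym: "E (- \<tau>) = E \<tau>" for \<tau>
  proof -
    have "F (- \<tau>) = F \<tau>" by (simp add: F_def)
    then show ?thesis using FE[of \<tau>] FE[of "- \<tau>"] C by simp
  qed
  have ws: "?w summable_on Cfg N" by (rule iv_summable[OF N b])
  have wc: "(\<lambda>m. ?w m * cos (\<tau> * of_int (m i - m j))) summable_on Cfg N" for \<tau>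
  proof (rule abs_summable_summable, rule summable_on_comparison_test[OF ws])
    fix m
    have "?w m * \<bar>cos (\<tau> * of_int (m i - m j))\<bar> \<le> ?w m * 1" by (intro mult_left_mono) auto
    then show "norm (?w m * cos (\<tau> * of_int (m i - m j))) \<le> ?w m" by (simp add: abs_mult)
  qed auto
  have limF: "((\<lambda>\<tau>. 2 * (F 0 - F \<tau>) / \<tau>\<^sup>2) \<longlongrightarrow> W) (at_right 0)"
  proof -
    have "((\<lambda>\<tau>. \<Sum>\<^sub>\<infinity>m\<in>Cfg N. ?w m * (2 * (1 - cos (\<tau> * of_int (m i - m j))) / \<tau>\<^sup>2)) \<longlongrightarrow> W) (at_right 0)"
      unfolding W_def
    proof (rule tendsto_infsum_dominated(2)[OF _ _ iv_second_moment_summable[OF N b ij]])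
      show "\<bar>?w m * (2 * (1 - cos (\<tau> * of_int (m i - m j))) / \<tau>\<^sup>2)\<bar> \<le> ?w m * (of_int (m i - m j))\<^sup>2" if "0 < \<tau>" for m \<tau>
        using mult_left_mono[OF cos_second_difference(2)[OF that, of "of_int (m i - m j)"], of "?w m"]
        by (simp add: abs_mult)
    qed (intro tendsto_intros cos_second_difference)
    moreover have "(\<Sum>\<^sub>\<infinity>m\<in>Cfg N. ?w m * (2 * (1 - cos (\<tau> * of_int (m i - m j))) / \<tau>\<^sup>2)) = 2 * (F 0 - F \<tau>) / \<tau>\<^sup>2" for \<tau>
    proof -
      have "(\<Sum>\<^sub>\<infinity>m\<in>Cfg N. ?w m * (2 * (1 - cos (\<tau> * of_int (m i - m j))) / \<tau>\<^sup>2))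
        = (\<Sum>\<^sub>\<infinity>m\<in>Cfg N. 2 / \<tau>\<^sup>2 * (?w m + - (?w m * cos (\<tau> * of_int (m i - m j)))))"
        by (rule infsum_cong) (simp add: field_simps)
      also have "\<dots> = 2 / \<tau>\<^sup>2 * (F 0 + - F \<tau>)"
        unfolding F0 F_def infsum_cmult_right' infsum_uminus[symmetric]
        by (simp only: infsum_add[OF ws summable_on_uminus[THEN iffD2, OF wc]] mult_zero_left cos_zero mult_1_right)
      finally show ?thesis by simp
    qed
    ultimately show ?thesis by simp
  qed
  have limE: "((\<lambda>\<tau>. 2 * (E \<tau> - E 0) / \<tau>\<^sup>2) \<longlongrightarrow> Q) (at_right 0)"
  proof -
    have cg0: "cg_weight N b k \<ge> 0" for k by (simp add: cg_weight_def)
    have M: "(\<lambda>k. 2 * (cg_weight N b k * exp (2 * u k) + cg_weight N b k * exp ((- 2) * u k))) summable_on Omega N"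
      by (intro summable_on_cmult_right summable_on_add Es)
    have "((\<lambda>\<tau>. \<Sum>\<^sub>\<infinity>k\<in>Omega N. cg_weight N b k * ((exp (\<tau> * u k) + exp (- \<tau> * u k) - 2) / \<tau>\<^sup>2)) \<longlongrightarrow> Q) (at_right 0)"
      unfolding Q_def
    proof (rule tendsto_infsum_dominated(2)[OF _ _ M])
      show "\<bar>cg_weight N b k * ((exp (\<tau> * u k) + exp (- \<tau> * u k) - 2) / \<tau>\<^sup>2)\<bar>
          \<le> 2 * (cg_weight N b k * exp (2 * u k) + cg_weight N b k * exp ((- 2) * u k))" if "0 < \<tau>" "\<tau> < 1" for k \<tau>
      proof -
        have "\<bar>cg_weight N b k * ((exp (\<tau> * u k) + exp (- \<tau> * u k) - 2) / \<tau>\<^sup>2)\<bar>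
            = cg_weight N b k * \<bar>(exp (\<tau> * u k) + exp (- \<tau> * u k) - 2) / \<tau>\<^sup>2\<bar>"
          by (simp only: abs_mult[of "cg_weight N b k"] abs_of_nonneg[OF cg0])
        also have "\<dots> \<le> cg_weight N b k * (2 * (exp (2 * u k) + exp (- 2 * u k)))"
          by (rule mult_left_mono[OF exp_second_difference(2)[OF that] cg0])
        finally show ?thesis by (simp add: algebra_simps)
      qed
    qed (intro tendsto_intros exp_second_difference)
    moreover have "(\<Sum>\<^sub>\<infinity>k\<in>Omega N. cg_weight N b k * ((exp (\<tau> * u k) + exp (- \<tau> * u k) - 2) / \<tau>\<^sup>2)) = 2 * (E \<tau> - E 0) / \<tau>\<^sup>2" for \<tau>
    proof -
      have s0: "(\<lambda>k. (- 2) * (cg_weight N b k * exp (0 * u k))) summable_on Omega N" by (intro summable_on_cmult_right Es)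
      have "(\<Sum>\<^sub>\<infinity>k\<in>Omega N. cg_weight N b k * ((exp (\<tau> * u k) + exp (- \<tau> * u k) - 2) / \<tau>\<^sup>2))
        = (\<Sum>\<^sub>\<infinity>k\<in>Omega N. 1 / \<tau>\<^sup>2 * ((cg_weight N b k * exp (\<tau> * u k) + cg_weight N b k * exp (- \<tau> * u k)) + (- 2) * (cg_weight N b k * exp (0 * u k))))"
        by (rule infsum_cong) (simp add: field_simps)
      also have "\<dots> = 1 / \<tau>\<^sup>2 * ((E \<tau> + E (- \<tau>)) + (- 2) * E 0)"
        unfolding E_def infsum_cmult_right'
        by (subst infsum_add[OF summable_on_add[OF Es Es] s0], subst infsum_add[OF Es Es], subst infsum_cmult_right') simp
      finally show ?thesis unfolding Esym by simp
    qed
    ultimately show ?thesis by simp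
  qed
  have limX: "((\<lambda>\<tau>. (1 - exp (- (b / 2) * \<tau>\<^sup>2 * g)) / \<tau>\<^sup>2) \<longlongrightarrow> b / 2 * g) (at_right 0)"
  proof (cases "g = 0")
    case False
    then show ?thesis using b by real_asymp
  qed simp
  have limY: "((\<lambda>\<tau>. exp (- (b / 2) * \<tau>\<^sup>2 * g)) \<longlongrightarrow> exp (- (b / 2) * 0\<^sup>2 * g)) (at_right 0)"
    by (intro tendsto_intros)
  have "((\<lambda>\<tau>. C * (2 * E 0 * ((1 - exp (- (b / 2) * \<tau>\<^sup>2 * g)) / \<tau>\<^sup>2) - exp (- (b / 2) * \<tau>\<^sup>2 * g) * (2 * (E \<tau> - E 0) / \<tau>\<^sup>2)))
     \<longlongrightarrow> C * (2 * E 0 * (b / 2 * g) - exp (- (b / 2) * 0\<^sup>2 * g) * Q)) (at_right 0)"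
    by (intro tendsto_mult tendsto_diff tendsto_const limX limY limE)
  \<comment> \<open>With X the Gaussian factor, E 0 - X E tau = E 0 (1 - X) - X (E tau - E 0). At
    tau = 0 both sides are 0, division by 0 being 0.\<close>
  moreover have "C * (2 * E 0 * ((1 - exp (- (b / 2) * \<tau>\<^sup>2 * g)) / \<tau>\<^sup>2) - exp (- (b / 2) * \<tau>\<^sup>2 * g) * (2 * (E \<tau> - E 0) / \<tau>\<^sup>2))
     = 2 * (F 0 - F \<tau>) / \<tau>\<^sup>2" for \<tau>
    unfolding FE[of \<tau>] F0E0 by (cases "\<tau> = 0") (auto simp: field_simps)
  ultimately have "((\<lambda>\<tau>. 2 * (F 0 - F \<tau>) / \<tau>\<^sup>2) \<longlongrightarrow> C * (E 0 * (b * g) - Q)) (at_right 0)"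
    by simp
  then have WQ: "W = C * (E 0 * (b * g) - Q)" using tendsto_unique[OF _ limF] by simp
  have "(\<Sum>\<^sub>\<infinity>k\<in>Omega N. (voltage N i j k)\<^sup>2 * cg_weight N b k) = (\<Sum>\<^sub>\<infinity>k\<in>Omega N. 4 / b\<^sup>2 * (cg_weight N b k * (u k)\<^sup>2))"
    by (rule infsum_cong) (use b in \<open>simp add: u_def power_mult_distrib power_divide\<close>)
  also have "\<dots> = 4 / b\<^sup>2 * Q" unfolding Q_def by (rule infsum_cmult_right')
  finally have "cg_E N b (\<lambda>k. (voltage N i j k)\<^sup>2) = 4 / b\<^sup>2 * (Q / E 0)"
    by (simp add: cg_E_def E0)
  also have "Q / E 0 = b * g - W / F 0"
    unfolding WQ F0E0 using C E0pos by (simp add: field_simps)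
  finally show ?thesis unfolding g_def W_def F0 .
qed

text \<open>The reflection of k to - k preserves neutrality and energy and reverses the
  voltage.\<close>

lemma cg_E_voltage:
  "cg_E N b (voltage N i j) = 0"
proof -
  have v: "voltage N i j (\<lambda>x. - k x) = - voltage N i j k" for k
    by (simp add: voltage_def sum_negf)
  have w: "cg_weight N b (\<lambda>x. - k x) = cg_weight N b k" for k
    by (simp add: cg_weight_def energy_def)
  have mem: "(\<lambda>x. - k x) \<in> Omega N" if k: "k \<in> Omega N" for k
  proof -
    have "\<exists>n::int. - k x = 2 * pi * real_of_int n" if "x \<in> Lam N" for x
    proof -
      obtain n :: int where "k x = 2 * pi * real_of_int n" using k \<open>x \<in> Lam N\<close> unfolding Omega_def by blast
      then show ?thesis by (intro exI[of _ "- n"]) simp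
    qed
    then show ?thesis using k unfolding Omega_def by (auto simp: sum_negf)
  qed
  have "(\<Sum>\<^sub>\<infinity>k\<in>Omega N. voltage N i j k * cg_weight N b k) = (\<Sum>\<^sub>\<infinity>k\<in>Omega N. - (voltage N i j k * cg_weight N b k))"
    by (rule infsum_reindex_bij_witness[where i = "\<lambda>k x. - k x" and j = "\<lambda>k x. - k x"]) (auto simp: v w intro: mem)
  then have "(\<Sum>\<^sub>\<infinity>k\<in>Omega N. voltage N i j k * cg_weight N b k) = 0" by (simp add: infsum_uminus)
  then show ?thesis by (simp add: cg_E_def)
qed

text \<open>All terms of the spectral formula are nonnegative. If they all vanished, the cosines
  would add up to N^2, whereas orthogonality gives 0 for distinct sites. Positivity allows division
  by the leading term.\<close>

lemma green_gap_pos: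
  assumes ij: "i \<in> Lam N" "j \<in> Lam N" "i \<noteq> j"
  shows "green N i i - green N i j > 0"
proof -
  have N: "N > 0" using ij by (auto simp: Lam_def)
  have o: "org \<in> Lam N" using N by (auto simp: Lam_def)
  let ?S = "Lam N - {org}"
  let ?t = "\<lambda>p. (1 - cos (ang N p i - ang N p j)) / (1 - eigv N p)"
  have eq: "green N i i - green N i j = (\<Sum>p\<in>?S. ?t p) / (real N * real N)"
    using ij by (simp add: green_spectral diff_divide_distrib sum_subtractf)
  have nn: "?t p \<ge> 0" if "p \<in> ?S" for p
    using eigv_bounds(1)[OF that] by (intro divide_nonneg_nonneg) auto
  have "\<exists>p\<in>?S. cos (ang N p i - ang N p j) \<noteq> 1"
  proof (rule ccontr)
    assume "\<not> (\<exists>p\<in>?S. cos (ang N p i - ang N p j) \<noteq> 1)"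
    then have "cos (ang N p i - ang N p j) = 1" if "p \<in> Lam N" for p
      using that by (cases "p = org") (auto simp: ang_def)
    then have "(\<Sum>p\<in>Lam N. cos (ang N p i - ang N p j)) = real (card (Lam N))" by simp
    then show False using sum_cos_ang[OF ij(1,2)] ij(3) N by (simp add: card_Lam)
  qed
  then obtain p where p: "p \<in> ?S" "cos (ang N p i - ang N p j) \<noteq> 1" by blast
  then have "cos (ang N p i - ang N p j) < 1" using cos_le_one[of "ang N p i - ang N p j"] by linarith
  then have "?t p > 0" using eigv_bounds(1)[OF p(1)] by simp
  then have "(\<Sum>p\<in>?S. ?t p) > 0" using p(1) nn by (intro sum_pos2) auto
  then show ?thesis unfolding eq using N by simp
qed

lemma voltage_second_moment_bounds:
  assumes N: "N \<ge> 4" and ij: "i \<in> Lam N" "j \<in> Lam N" and b: "0 < b" "b \<le> 1/12"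
  shows "4 / b * (green N i i - green N i j) - 4 / b\<^sup>2 * Mconst (1 / (4 * b)) \<le> cg_E N b (\<lambda>k. (voltage N i j k)\<^sup>2)"
    "cg_E N b (\<lambda>k. (voltage N i j k)\<^sup>2) \<le> 4 / b * (green N i i - green N i j)"
proof -
  have N0: "N > 0" using N by simp
  define V where "V = (\<Sum>\<^sub>\<infinity>m\<in>Cfg N. iv_weight N b m * (of_int (m i - m j))\<^sup>2) / infsum (iv_weight N b) (Cfg N)"
  have pos: "infsum (iv_weight N b) (Cfg N) > 0" by (rule iv_partition_pos[OF N0 b(1)])
  have "V \<le> Mconst (1 / (4 * b))"
    unfolding V_def using iv_variance_bound[OF N ij b] pos by (simp add: pos_divide_le_eq)
  then have up: "4 / b\<^sup>2 * V \<le> 4 / b\<^sup>2 * Mconst (1 / (4 * b))" by (intro mult_left_mono) auto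
  have "V \<ge> 0" unfolding V_def using pos by (intro divide_nonneg_nonneg infsum_nonneg) auto
  then have lo: "4 / b\<^sup>2 * V \<ge> 0" by simp
  have "cg_E N b (\<lambda>k. (voltage N i j k)\<^sup>2) = 4 / b\<^sup>2 * (b * (green N i i - green N i j) - V)"
    unfolding V_def by (rule voltage_second_moment[OF N0 b(1) ij])
  also have "\<dots> = 4 / b * (green N i i - green N i j) - 4 / b\<^sup>2 * V"
    using b by (simp add: right_diff_distrib power2_eq_square)
  finally show "4 / b * (green N i i - green N i j) - 4 / b\<^sup>2 * Mconst (1 / (4 * b)) \<le> cg_E N b (\<lambda>k. (voltage N i j k)\<^sup>2)"
    "cg_E N b (\<lambda>k. (voltage N i j k)\<^sup>2) \<le> 4 / b * (green N i i - green N i j)"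
    using up lo by linarith+
qed

text \<open>For i = j both functions vanish identically. Otherwise, after division by the right
  side, the correction is Mconst(1 / (4 b)) / (b g), and \<open>phi (1 / (4 * b))\<close> is a
  multiple of exp(- 1 / b), which beats the factor 1 / b.\<close>

lemma voltage_second_moment_asymp:
  assumes N: "N \<ge> 4" and ij: "i \<in> Lam N" "j \<in> Lam N"
  shows "(\<lambda>b. cg_E N b (\<lambda>k. (voltage N i j k)\<^sup>2)) \<sim>[at_right 0] (\<lambda>b. 4 / b * (green N i i - green N i j))"
proof (cases "i = j")
  case True
  then show ?thesis by (simp add: voltage_def cg_E_def)
next
  case False
  define g where "g = green N i i - green N i j"
  have g: "g > 0" unfolding g_def by (rule green_gap_pos[OF ij False])
  let ?E = "\<lambda>b. cg_E N b (\<lambda>k. (voltage N i j k)\<^sup>2)"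
  have ev: "eventually (\<lambda>b::real. b \<in> {0<..<1/12}) (at_right 0)" by (rule eventually_at_right_real) simp
  have "((\<lambda>b. ?E b / (4 / b * g)) \<longlongrightarrow> 1) (at_right 0)"
  proof (rule tendsto_sandwich)
    show "\<forall>\<^sub>F b in at_right 0. 1 - Mconst (1 / (4 * b)) / b / g \<le> ?E b / (4 / b * g)"
      using ev
    proof eventually_elim
      case (elim b)
      then have b: "0 < b" "b \<le> 1/12" by auto
      have "(1 - Mconst (1 / (4 * b)) / b / g) * (4 / b * g) = 4 / b * g - 4 / b\<^sup>2 * Mconst (1 / (4 * b))"
        using b g by (simp add: field_simps power2_eq_square)
      also have "\<dots> \<le> ?E b" unfolding g_def by (rule voltage_second_moment_bounds(1)[OF N ij b])
      finally show ?case using b g by (subst pos_le_divide_eq) auto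
    qed
    show "\<forall>\<^sub>F b in at_right 0. ?E b / (4 / b * g) \<le> 1"
      using ev
    proof eventually_elim
      case (elim b)
      then have b: "0 < b" "b \<le> 1/12" by auto
      then show ?case using voltage_second_moment_bounds(2)[OF N ij b] g unfolding g_def[symmetric]
        by (subst pos_divide_le_eq) auto
    qed
    have "((\<lambda>b. Mconst (1 / (4 * b)) / b) \<longlongrightarrow> 0) (at_right 0)"
      unfolding Mconst_def phi_def by real_asymp
    then have "((\<lambda>b. 1 - Mconst (1 / (4 * b)) / b / g) \<longlongrightarrow> 1 - 0 / g) (at_right 0)"
      by (intro tendsto_intros) (use g in auto)
    then show "((\<lambda>b. 1 - Mconst (1 / (4 * b)) / b / g) \<longlongrightarrow> 1) (at_right 0)" by simp
  qed simp
  then show ?thesis unfolding g_def[symmetric]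
    by (rule asymp_equivI')
qed

theorem mainTheorem9:
  shows "(\<forall>N::nat. \<forall>i\<in>Lam N. \<forall>j\<in>Lam N. \<forall>b::real.
            N \<ge> 4 \<and> 0 < b \<and> b \<le> 1/12 \<longrightarrow>
              4 / b * (green N i i - green N i j) - 4 / b^2 * Mconst (1 / (4 * b))
                \<le> cg_Var N b (voltage N i j)
            \<and> cg_Var N b (voltage N i j) = cg_E N b (\<lambda>k. (voltage N i j k)^2)
            \<and> cg_E N b (\<lambda>k. (voltage N i j k)^2) \<le> 4 / b * (green N i i - green N i j))
       \<and> (\<forall>N::nat. \<forall>i\<in>Lam N. \<forall>j\<in>Lam N. N \<ge> 4 \<longrightarrow>
            (\<lambda>b. cg_E N b (\<lambda>k. (voltage N i j k)^2))
              \<sim>[at_right 0] (\<lambda>b. 4 / b * (green N i i - green N i j)))"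
proof -
  have "cg_Var N b (voltage N i j) = cg_E N b (\<lambda>k. (voltage N i j k)^2)" for N b i j
    by (simp add: cg_Var_def cg_E_voltage)
  then show ?thesis
    using voltage_second_moment_bounds voltage_second_moment_asymp by simp
qed


end
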